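(* Let $\mu\ge 0$, $L>0$, let $W_L$ be a weight function on $[0,L]$, let $n\ge 0$ be an integer, and let $\xi_\nu=\frac{\nu\pi}{n+1}$ for $0\le\nu\le n$. Then for every $f\in L^2(W_{\mu,L};B_L)$ and $\mathbf x=(x_1,x_2,x_3)\in B_L$, $$S_{n,L}^\mu f(\mathbf x)=\frac{1}{n+1}\sum_{\nu=0}^n a_\mu\int_{-1}^1\int_0^L\mathcal R_{\xi_\nu}^\mu(f(\cdot,\cdot,w);t)\,\Phi_n^\mu(\xi_\nu,w,t;\mathbf x)\,W_L(w)\,dw\,dt,$$ where $$\Phi_n^\mu(\xi,w,t;\mathbf x)=\sum_{k=0}^n D_k^{\mu+1/2}(\xi,t;x_1,x_2)\sum_{l=0}^{n-k}p_l(w)\,p_l(x_3).$$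
   Context: $B^2$ is the closed unit disk in $\mathbb R^2$; $W_\mu(x,y)=(1-x^2-y^2)^{\mu-1/2}$; $a_\mu=(\mu+1/2)/\pi=1/\int_{B^2}W_\mu$. $B_L=B^2\times[0,L]$ and $W_{\mu,L}(x,y,z)=W_\mu(x,y)W_L(z)$, where $W_L$ is a weight function on $[0,L]$ (nonnegative, with finite moments and $\int_0^Lp^2W_L>0$ for every nonzero polynomial $p$). $p_k$ is the orthonormal polynomial of degree $k$ with respect to $W_L$: $\int_0^Lp_kp_lW_L\,dz=\delta_{k,l}$. $\mathcal V_k^2(W_\mu)$ is the space of polynomials in two variables of degree $k$ (together with $0$) orthogonal to all polynomials of degree $<k$ under $\langle P,Q\rangle_\mu=a_\mu\int_{B^2}PQW_\mu\,dx\,dy$. Partial sum operator: let $\{P_j^k:0\le j\le k\}$ be an orthonormal basis of $\mathcal V_k^2(W_\mu)$ and $P_{l,k,j}^\mu(x,y,z)=P_j^k(x,y)p_{l-k}(z)$ for $0\le j\le k\le l$; then $$S_{n,L}^\mu f=\sum_{l=0}^n\sum_{k=0}^l\sum_{j=0}^k\widehat f_{l,k,j}^{\,\mu}P_{l,k,j}^\mu,\qquad\widehat f_{l,k,j}^{\,\mu}=a_\mu\int_{B_L}f\,P_{l,k,j}^\mu\,W_{\mu,L}\,d\mathbf x .$$ Attenuated Radon projection: for a function $g$ on $B^2$, $$\mathcal R_\theta^\mu(g;t)=\int_{-\sqrt{1-t^2}}^{\sqrt{1-t^2}}g(t\cos\theta-s\sin\theta,\,t\sin\theta+s\cos\theta)\,(1-s^2-t^2)^{\mu-1/2}\,ds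 ;$$ $\mathcal R_\theta^\mu(f(\cdot,\cdot,w);t)$ is this projection of $(x,y)\mapsto f(x,y,w)$ for fixed $w\in[0,L]$. The kernel: $(a)_k=a(a+1)\cdots(a+k-1)$. $C_k^\lambda$ is the Gegenbauer polynomial of degree $k$, orthogonal for $(1-s^2)^{\lambda-1/2}$ on $[-1,1]$, with $C_k^\lambda(1)=(2\lambda)_k/k!$. $p_l^{(\alpha,\beta)}$ is the Jacobi polynomial of degree $l$ with positive leading coefficient, orthonormal for $(1-t)^\alpha(1+t)^\beta$ normalized to integral $1$ on $[-1,1]$. With $x=r\cos\phi$, $y=r\sin\phi$, put $$P_{l,\varepsilon}^k(x,y)=h_{l,k}\,p_l^{(\mu-1/2,\,k-2l)}(2r^2-1)\,r^{k-2l}S_{k-2l,\varepsilon}(\phi),$$ where $S_{j,0}(\phi)=\cos j\phi$, $S_{j,1}(\phi)=\sin j\phi$, with $0\le 2l\le k$ if $\varepsilon=0$ and $0\le 2l\le k-1$ if $\varepsilon=1$, and $$h_{l,k}>0,\qquad h_{l,k}^2=\frac{\Gamma(k-2l+\mu+3/2)}{\Gamma(\mu+3/2)\,\Gamma(k-2l+1)} .$$ Let $$H_{l,k}^\mu=h_{l,k}\,p_l^{(\mu-1/2,\,k-2l)}(1),\qquad \lambda_{l,k}^\mu=[H_{l,k}^\mu]^{-2},$$ $$D_k^{\mu+1/2}(\xi;x,y)=\sum_{l,\varepsilon}\lambda_{l,k}^\mu\,P_{l,\varepsilon}^k(\cos\xi,\sin\xi)\,P_{l,\varepsilon}^k(x,y)$$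 (sum over all admissible $(l,\varepsilon)$), and $$D_k^{\mu+1/2}(\xi,t;x,y)=\frac{k+\mu+1/2}{\mu+1/2}\,C_k^{\mu+1/2}(t)\,D_k^{\mu+1/2}(\xi;x,y).$$
   Formalization: For j ≥ 1 the circular harmonics are taken as S_{j,0}=√2 cos jφ and S_{j,1}=√2 sin jφ (S_{0,0}=1), not bare cos jφ and sin jφ; with the printed ones the formula fails for every n ≥ 1 (f(x,y,z)=x gives x₁/2 instead of x₁). *)

theory Defs
  imports "HOL-Analysis.Analysis" "HOL-Computational_Algebra.Polynomial"
begin

text \<open>
  All integrals are Lebesgue integrals for the completed measure, so that measurable means
  Lebesgue measurable. Since \<open>0 powr a = 0\<close> for every \<open>a\<close>, the weights below vanish on the
  boundary, which is a null set.
\<close>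

subsection \<open>Weights and orthogonal polynomials on an interval\<close>

text \<open>Measurability of \<open>W\<close> on \<open>[0,L]\<close> is the case \<open>k = 0\<close> of the moment condition.\<close>

definition weight_function :: "real \<Rightarrow> (real \<Rightarrow> real) \<Rightarrow> bool" where
  "weight_function L W \<longleftrightarrow>
     (\<forall>z\<in>{0..L}. 0 \<le> W z) \<and>
     (\<forall>k::nat. set_integrable lebesgue {0..L} (\<lambda>z. z ^ k * W z)) \<and>
     (\<forall>q::real poly. q \<noteq> 0 \<longrightarrow> 0 < (LINT z:{0..L}|lebesgue. (poly q z)\<^sup>2 * W z))"

definition orthogonal_polys :: "real set \<Rightarrow> (real \<Rightarrow> real) \<Rightarrow> (nat \<Rightarrow> real poly) \<Rightarrow> bool" where
  "orthogonal_polys A w p \<longleftrightarrow>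
     (\<forall>k. degree (p k) = k) \<and>
     (\<forall>k l. k \<noteq> l \<longrightarrow> (LINT z:A|lebesgue. poly (p k) z * poly (p l) z * w z) = 0)"

definition orthonormal_polys :: "real set \<Rightarrow> (real \<Rightarrow> real) \<Rightarrow> (nat \<Rightarrow> real poly) \<Rightarrow> bool" where
  "orthonormal_polys A w p \<longleftrightarrow>
     (\<forall>k. degree (p k) = k) \<and>
     (\<forall>k l. (LINT z:A|lebesgue. poly (p k) z * poly (p l) z * w z) = (if k = l then 1 else 0))"

definition gegenbauer :: "real \<Rightarrow> nat \<Rightarrow> real poly" where
  "gegenbauer a = (THE C.
     orthogonal_polys {-1..1} (\<lambda>s. (1 - s\<^sup>2) powr (a - 1/2)) C \<and>
     (\<forall>k. poly (C k) 1 = pochhammer (2 * a) k / fact k))"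

definition jacobi_weight :: "real \<Rightarrow> real \<Rightarrow> real \<Rightarrow> real" where
  "jacobi_weight \<alpha> \<beta> t =
     ((1 - t) powr \<alpha> * (1 + t) powr \<beta>) /
     (LINT u:{-1..1}|lebesgue. (1 - u) powr \<alpha> * (1 + u) powr \<beta>)"

definition jacobi :: "real \<Rightarrow> real \<Rightarrow> nat \<Rightarrow> real poly" where
  "jacobi \<alpha> \<beta> = (THE p.
     orthonormal_polys {-1..1} (jacobi_weight \<alpha> \<beta>) p \<and> (\<forall>l. 0 < lead_coeff (p l)))"


subsection \<open>Orthogonal polynomials on the disk\<close>

definition disk :: "(real \<times> real) set" where
  "disk = {(x, y). x\<^sup>2 + y\<^sup>2 \<le> 1}"

definition W_disk :: "real \<Rightarrow> real \<times> real \<Rightarrow> real" where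
  "W_disk \<mu> = (\<lambda>(x, y). (1 - x\<^sup>2 - y\<^sup>2) powr (\<mu> - 1/2))"

definition a_const :: "real \<Rightarrow> real" where
  "a_const \<mu> = (\<mu> + 1/2) / pi"

definition disk_inner :: "real \<Rightarrow> (real \<times> real \<Rightarrow> real) \<Rightarrow> (real \<times> real \<Rightarrow> real) \<Rightarrow> real" where
  "disk_inner \<mu> P Q = a_const \<mu> * (LINT v:disk|lebesgue. P v * Q v * W_disk \<mu> v)"

text \<open>Polynomial functions in two variables of total degree less than \<open>k\<close>.\<close>

definition polys_below :: "nat \<Rightarrow> (real \<times> real \<Rightarrow> real) set" where
  "polys_below k =
     {P. \<exists>c :: nat \<Rightarrow> nat \<Rightarrow> real.
        P = (\<lambda>(x, y). \<Sum>(i, j) \<in> {(i, j). i + j < k}. c i j * x ^ i * y ^ j)}"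

definition V_space :: "real \<Rightarrow> nat \<Rightarrow> (real \<times> real \<Rightarrow> real) set" where
  "V_space \<mu> k =
     {P \<in> polys_below (Suc k).
        (P = (\<lambda>_. 0) \<or> P \<notin> polys_below k) \<and> (\<forall>Q \<in> polys_below k. disk_inner \<mu> P Q = 0)}"

text \<open>\<open>B 0, \<dots>, B k\<close> is an orthonormal basis of \<open>V_space \<mu> k\<close>.\<close>

definition onb_V :: "real \<Rightarrow> nat \<Rightarrow> (nat \<Rightarrow> real \<times> real \<Rightarrow> real) \<Rightarrow> bool" where
  "onb_V \<mu> k B \<longleftrightarrow>
     (\<forall>j\<le>k. B j \<in> V_space \<mu> k) \<and>
     (\<forall>i\<le>k. \<forall>j\<le>k. disk_inner \<mu> (B i) (B j) = (if i = j then 1 else 0)) \<and>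
     (\<forall>Q \<in> V_space \<mu> k. \<exists>c. \<forall>v. Q v = (\<Sum>j\<le>k. c j * B j v))"


subsection \<open>The cylinder and the partial sum operator\<close>

definition cylinder :: "real \<Rightarrow> (real \<times> real \<times> real) set" where
  "cylinder L = {(x, y, z). (x, y) \<in> disk \<and> z \<in> {0..L}}"

definition W_cyl :: "real \<Rightarrow> (real \<Rightarrow> real) \<Rightarrow> real \<times> real \<times> real \<Rightarrow> real" where
  "W_cyl \<mu> W = (\<lambda>(x, y, z). W_disk \<mu> (x, y) * W z)"

definition L2_space :: "('a::euclidean_space \<Rightarrow> real) \<Rightarrow> 'a set \<Rightarrow> ('a \<Rightarrow> real) set" where
  "L2_space w A =
     {f. set_borel_measurable lebesgue A f \<and> set_integrable lebesgue A (\<lambda>v. (f v)\<^sup>2 * w v)}"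

definition P_cyl ::
  "(nat \<Rightarrow> nat \<Rightarrow> real \<times> real \<Rightarrow> real) \<Rightarrow> (nat \<Rightarrow> real poly) \<Rightarrow>
     nat \<Rightarrow> nat \<Rightarrow> nat \<Rightarrow> real \<times> real \<times> real \<Rightarrow> real" where
  "P_cyl B p l k j = (\<lambda>(x, y, z). B k j (x, y) * poly (p (l - k)) z)"

definition fourier_coeff ::
  "real \<Rightarrow> real \<Rightarrow> (real \<Rightarrow> real) \<Rightarrow> (nat \<Rightarrow> nat \<Rightarrow> real \<times> real \<Rightarrow> real) \<Rightarrow> (nat \<Rightarrow> real poly) \<Rightarrow>
     (real \<times> real \<times> real \<Rightarrow> real) \<Rightarrow> nat \<Rightarrow> nat \<Rightarrow> nat \<Rightarrow> real" where
  "fourier_coeff \<mu> L W B p f l k j =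
     a_const \<mu> * (LINT v:cylinder L|lebesgue. f v * P_cyl B p l k j v * W_cyl \<mu> W v)"

definition partial_sum ::
  "real \<Rightarrow> real \<Rightarrow> (real \<Rightarrow> real) \<Rightarrow> (nat \<Rightarrow> nat \<Rightarrow> real \<times> real \<Rightarrow> real) \<Rightarrow> (nat \<Rightarrow> real poly) \<Rightarrow>
     nat \<Rightarrow> (real \<times> real \<times> real \<Rightarrow> real) \<Rightarrow> real \<times> real \<times> real \<Rightarrow> real" where
  "partial_sum \<mu> L W B p n f v =
     (\<Sum>l=0..n. \<Sum>k=0..l. \<Sum>j=0..k. fourier_coeff \<mu> L W B p f l k j * P_cyl B p l k j v)"


subsection \<open>Attenuated Radon projections and the kernel\<close>

definition radon :: "real \<Rightarrow> real \<Rightarrow> (real \<times> real \<Rightarrow> real) \<Rightarrow> real \<Rightarrow> real" where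
  "radon \<mu> \<theta> g t =
     (LINT s:{- sqrt (1 - t\<^sup>2)..sqrt (1 - t\<^sup>2)}|lebesgue.
        g (t * cos \<theta> - s * sin \<theta>, t * sin \<theta> + s * cos \<theta>) * (1 - s\<^sup>2 - t\<^sup>2) powr (\<mu> - 1/2))"

text \<open>
  Circular harmonics normalised to mean square 1 on the unit circle (with respect to
  \<open>d\<phi> / (2 * pi)\<close>): \<open>1\<close>, \<open>sqrt 2 * cos (j * \<phi>)\<close> and \<open>sqrt 2 * sin (j * \<phi>)\<close> for \<open>j \<ge> 1\<close>.
  The constants \<open>h_const\<close> make the polynomials \<open>P_disk\<close> orthonormal for \<open>disk_inner\<close>
  precisely for this normalisation. With bare \<open>cos (j * \<phi>)\<close> and \<open>sin (j * \<phi>)\<close> every summand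
  of \<open>D_angle\<close> with \<open>2 * l < k\<close> is too small by a factor of 2 (\<open>h_const\<close> cancels there), and
  the reconstruction formula already fails for \<open>n = 1\<close> and \<open>f (x, y, z) = x\<close>.
\<close>

definition circ_harm :: "nat \<Rightarrow> nat \<Rightarrow> real \<Rightarrow> real" where
  "circ_harm j \<epsilon> \<phi> =
     (if j = 0 then 1 else sqrt 2) * (if \<epsilon> = 0 then cos (real j * \<phi>) else sin (real j * \<phi>))"

definition h_const :: "real \<Rightarrow> nat \<Rightarrow> nat \<Rightarrow> real" where
  "h_const \<mu> l k =
     sqrt (Gamma (real (k - 2 * l) + \<mu> + 3/2) / (Gamma (\<mu> + 3/2) * Gamma (real (k - 2 * l) + 1)))"

text \<open>
  Polar coordinates of \<open>(x, y)\<close> are read off from the complex number \<open>x + i y\<close>. The choice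
  of the angle at the origin does not matter, because \<open>r ^ (k - 2 * l) = 0\<close> there unless
  \<open>k = 2 * l\<close>.
\<close>

definition P_disk :: "real \<Rightarrow> nat \<Rightarrow> nat \<Rightarrow> nat \<Rightarrow> real \<times> real \<Rightarrow> real" where
  "P_disk \<mu> k l \<epsilon> = (\<lambda>(x, y).
     let r = cmod (Complex x y); \<phi> = Arg (Complex x y)
     in h_const \<mu> l k * poly (jacobi (\<mu> - 1/2) (real (k - 2 * l)) l) (2 * r\<^sup>2 - 1)
          * r ^ (k - 2 * l) * circ_harm (k - 2 * l) \<epsilon> \<phi>)"

definition adm_index :: "nat \<Rightarrow> (nat \<times> nat) set" where
  "adm_index k = {(l, \<epsilon>). (\<epsilon> = 0 \<and> 2 * l \<le> k) \<or> (\<epsilon> = 1 \<and> 2 * l + 1 \<le> k)}"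

definition H_const :: "real \<Rightarrow> nat \<Rightarrow> nat \<Rightarrow> real" where
  "H_const \<mu> l k = h_const \<mu> l k * poly (jacobi (\<mu> - 1/2) (real (k - 2 * l)) l) 1"

definition lambda_const :: "real \<Rightarrow> nat \<Rightarrow> nat \<Rightarrow> real" where
  "lambda_const \<mu> l k = 1 / (H_const \<mu> l k)\<^sup>2"

definition D_angle :: "real \<Rightarrow> nat \<Rightarrow> real \<Rightarrow> real \<times> real \<Rightarrow> real" where
  "D_angle \<mu> k \<xi> v =
     (\<Sum>(l, \<epsilon>) \<in> adm_index k.
        lambda_const \<mu> l k * P_disk \<mu> k l \<epsilon> (cos \<xi>, sin \<xi>) * P_disk \<mu> k l \<epsilon> v)"

definition D_kernel :: "real \<Rightarrow> nat \<Rightarrow> real \<Rightarrow> real \<Rightarrow> real \<times> real \<Rightarrow> real" where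
  "D_kernel \<mu> k \<xi> t v =
     (real k + \<mu> + 1/2) / (\<mu> + 1/2) * poly (gegenbauer (\<mu> + 1/2) k) t * D_angle \<mu> k \<xi> v"

definition Phi_kernel ::
  "real \<Rightarrow> (nat \<Rightarrow> real poly) \<Rightarrow> nat \<Rightarrow> real \<Rightarrow> real \<Rightarrow> real \<Rightarrow> real \<times> real \<times> real \<Rightarrow> real" where
  "Phi_kernel \<mu> p n \<xi> w t = (\<lambda>(x1, x2, x3).
     \<Sum>k=0..n. D_kernel \<mu> k \<xi> t (x1, x2) * (\<Sum>l=0..n - k. poly (p l) w * poly (p l) x3))"

end

(*
  Write e(xi) = (cos xi, sin xi). The reproducing kernel of the polynomials of degree k orthogonal to
  lower degree satisfies K_k(u, e(xi)) = (k + mu + 1/2) / (mu + 1/2) * C_k(<u, e(xi)>): after a rotation,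
  integrating such a polynomial over the lines x = t gives (1 - t^2)^mu times a polynomial orthogonal
  to all lower degrees, hence a multiple of the Gegenbauer polynomial C_k, and the factor is read off
  at t = 1. On the unit circle the Jacobi basis reduces to trigonometric functions of frequency at
  most k <= n and of the parity of k. These are orthogonal over the n + 1 equidistant angles, so
  averaging K_k(u, e(xi_nu)) * D_k(xi_nu; x) over nu gives back K_k(u, x). Inserting this into the
  partial sum and rotating the cylinder by xi_nu turns the integral over the cylinder into an
  integral of Radon projections. The norms of the Jacobi polynomials never enter, because D_k
  does not depend on their normalisation.
*)
theory Submission
  imports Defs "HOL-Library.Function_Algebras"
begin

subsection \<open>Lebesgue integrals through Borel representatives\<close>

text \<open>The nodes fill only half of the circle, yet n + 1 of them suffice. Products of two
  circle values in degree k have even frequencies 2m with |m| <= n, and exp(2 i xi_nu) runs through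
  the (n+1)-st roots of unity, so equal weights integrate them exactly. Since
  \<open>lambda_const\<close> is the inverse square of \<open>H_const\<close>,
  \<open>D_angle\<close> pairs each basis function with its dual functional on the circle, and
  thereby recovers a polynomial of the degree k space from its values at the nodes.

  Two obstacles shape the development. The functions f and W_L are only Lebesgue measurable, while
  Fubini and the transport of measures are used for Borel functions, so integrals pass through Borel
  representatives; rotations are factored into shears, which Fubini handles. And
  \<open>gegenbauer\<close> and \<open>jacobi\<close> are definite descriptions of whole sequences,
  so existence and uniqueness come before any of their properties. The shift to the parameter mu +
  1/2 arises because integrating the disk weight along a chord gains half a power of 1 -
  t^2.\<close>

lemma borel_measurable_lebesgueI:
  fixes g :: "'a::euclidean_space \<Rightarrow> 'b::topological_space"
  assumes "g \<in> borel_measurable borel"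
  shows "g \<in> borel_measurable lebesgue"
  using assms by (auto intro: measurable_completion)

text \<open>Fubini and the transport of measures are used on \<open>lborel\<close>, the integrals of
  the statement live on its completion. The functions compared differ on a null set only, and
  completeness makes even the measurability of \<open>F\<close> follow from that of
  \<open>G\<close>.\<close>

lemma lebesgue_eq_AE_borel:
  fixes F G :: "'a::euclidean_space \<Rightarrow> real"
  assumes G: "G \<in> borel_measurable borel" and eq: "AE x in lborel. F x = G x"
  shows "F \<in> borel_measurable lebesgue"
    and "integrable lebesgue F \<longleftrightarrow> integrable lborel G"
    and "integral\<^sup>L lebesgue F = integral\<^sup>L lborel G"
proof -
  have G': "G \<in> borel_measurable lebesgue"
    using G by (auto intro: measurable_completion)
  have eq': "AE x in lebesgue. F x = G x"
    using eq by (rule AE_completion)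
  show F: "F \<in> borel_measurable lebesgue"
  proof (rule measurableI)
    fix A :: "real set" assume A: "A \<in> sets borel"
    have "AE x in lebesgue. (x \<in> G -` A) = (x \<in> F -` A)"
      using eq' by eventually_elim auto
    from completion.in_sets_AE[OF this] show "F -` A \<inter> space lebesgue \<in> sets lebesgue"
      using measurable_sets[OF G' A] by simp
  qed auto
  have "integrable lebesgue F \<longleftrightarrow> integrable lebesgue G"
    using F G' eq' by (rule integrable_cong_AE)
  then show "integrable lebesgue F \<longleftrightarrow> integrable lborel G"
    using G by (simp add: integrable_completion)
  have "integral\<^sup>L lebesgue F = integral\<^sup>L lebesgue G"
    using F G' eq' by (rule integral_cong_AE)
  then show "integral\<^sup>L lebesgue F = integral\<^sup>L lborel G"
    using G by (simp add: integral_completion)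
qed

lemma borel_representative:
  fixes F :: "'a::euclidean_space \<Rightarrow> real"
  assumes "F \<in> borel_measurable lebesgue"
  obtains G where "G \<in> borel_measurable borel" "AE x in lborel. F x = G x"
  using completion_ex_borel_measurable_real[OF assms] by auto

section \<open>Fubini for Lebesgue integrals\<close>

lemma borel_measurable_Pair2:
  fixes G :: "'a::euclidean_space \<times> 'b::euclidean_space \<Rightarrow> 'c::topological_space"
  assumes "G \<in> borel_measurable borel"
  shows "(\<lambda>y. G (x, y)) \<in> borel_measurable borel"
proof -
  have "(\<lambda>y. (x, y)) \<in> borel_measurable borel"
    by (intro borel_measurable_continuous_onI continuous_intros)
  then show ?thesis
    using assms by (rule measurable_compose)
qed

lemma AE_lborel_pair:
  fixes P :: "'a::euclidean_space \<times> 'b::euclidean_space \<Rightarrow> bool"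
  assumes "AE v in lborel. P v"
  shows "AE x in lborel. AE y in lborel. P (x, y)"
  using assms lborel_pair.AE_pair[of P] unfolding lborel_prod by simp

lemma lborel_integral_pair:
  fixes G :: "'a::euclidean_space \<times> 'b::euclidean_space \<Rightarrow> real"
  assumes "integrable lborel G"
  shows "integral\<^sup>L lborel G = (LINT x|lborel. LINT y|lborel. G (x, y))"
    and "AE x in lborel. integrable lborel (\<lambda>y. G (x, y))"
  using assms lborel_pair.integral_fst'[of G] lborel_pair.AE_integrable_fst'[of G]
  unfolding lborel_prod by simp_all

lemma borel_measurable_LINT_pair:
  fixes G :: "'a::euclidean_space \<times> 'b::euclidean_space \<Rightarrow> real"
  assumes "G \<in> borel_measurable borel"
  shows "(\<lambda>x. LINT y|lborel. G (x, y)) \<in> borel_measurable borel"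
proof -
  have "case_prod (\<lambda>x y. G (x, y)) \<in> borel_measurable (borel \<Otimes>\<^sub>M lborel)"
    using assms by (subst measurable_cong_sets[OF sets_pair_measure_cong[OF refl sets_lborel] refl],
      subst borel_prod) simp
  from lborel.borel_measurable_lebesgue_integral[OF this] show ?thesis .
qed

text \<open>Sections of \<open>F\<close> are Lebesgue measurable only for almost all
  \<open>x\<close>. The inner integrals are therefore compared with those of a representative
  \<open>G\<close> almost everywhere, and the outer integral absorbs the exceptional set.\<close>

lemma lebesgue_integral_pair:
  fixes F :: "'a::euclidean_space \<times> 'b::euclidean_space \<Rightarrow> real"
  assumes F: "integrable lebesgue F"
  shows "integral\<^sup>L lebesgue F = (LINT x|lebesgue. LINT y|lebesgue. F (x, y))"
proof -
  obtain G where G: "G \<in> borel_measurable borel" "AE v in lborel. F v = G v"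
    using borel_representative borel_measurable_integrable[OF F] by blast
  have [measurable]: "(\<lambda>y. G (x, y)) \<in> borel_measurable borel" for x
    using G(1) by (rule borel_measurable_Pair2)
  have "integrable lborel G"
    using F G lebesgue_eq_AE_borel(2) by blast
  then have "integral\<^sup>L lborel G = (LINT x|lborel. LINT y|lborel. G (x, y))"
    by (rule lborel_integral_pair)
  also have "\<dots> = (LINT x|lebesgue. LINT y|lebesgue. F (x, y))"
  proof (rule lebesgue_eq_AE_borel(3)[symmetric])
    show "(\<lambda>x. LINT y|lborel. G (x, y)) \<in> borel_measurable borel"
      using G(1) by (rule borel_measurable_LINT_pair)
    show "AE x in lborel. (LINT y|lebesgue. F (x, y)) = (LINT y|lborel. G (x, y))"
      using AE_lborel_pair[OF G(2)]
      by eventually_elim (auto intro!: lebesgue_eq_AE_borel(3))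
  qed
  finally show ?thesis
    using lebesgue_eq_AE_borel(3)[OF G] by simp
qed

text \<open>The version for pairs does not apply to every section \<open>F (x, _)\<close>, since
  these are integrable only for almost all \<open>x\<close>. One representative \<open>G\<close>
  serves both levels instead.\<close>

lemma lebesgue_integral_triple:
  fixes F :: "'a::euclidean_space \<times> 'b::euclidean_space \<times> 'c::euclidean_space \<Rightarrow> real"
  assumes F: "integrable lebesgue F"
  shows "integral\<^sup>L lebesgue F =
    (LINT x|lebesgue. LINT y|lebesgue. LINT z|lebesgue. F (x, y, z))"
proof -
  obtain G where G: "G \<in> borel_measurable borel" "AE v in lborel. F v = G v"
    using borel_representative borel_measurable_integrable[OF F] by blast
  have 1[measurable]: "(\<lambda>q. G (x, q)) \<in> borel_measurable borel" for x
    using G(1) by (rule borel_measurable_Pair2)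
  have 2[measurable]: "(\<lambda>z. G (x, y, z)) \<in> borel_measurable borel" for x y
    using 1 by (rule borel_measurable_Pair2)
  have int: "integrable lborel G"
    using F G lebesgue_eq_AE_borel(2) by blast
  have "integral\<^sup>L lebesgue F = integral\<^sup>L lborel G"
    using lebesgue_eq_AE_borel(3)[OF G] .
  also have "\<dots> = (LINT x|lborel. LINT q|lborel. G (x, q))"
    using int by (rule lborel_integral_pair)
  also have "\<dots> = (LINT x|lebesgue. LINT y|lebesgue. LINT z|lebesgue. F (x, y, z))"
  proof (rule lebesgue_eq_AE_borel(3)[symmetric])
    show "(\<lambda>x. LINT q|lborel. G (x, q)) \<in> borel_measurable borel"
      using G(1) by (rule borel_measurable_LINT_pair)
    show "AE x in lborel. (LINT y|lebesgue. LINT z|lebesgue. F (x, y, z)) =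
        (LINT q|lborel. G (x, q))"
      using AE_lborel_pair[OF G(2)] lborel_integral_pair(2)[OF int]
    proof eventually_elim
      case (elim x)
      have "(LINT y|lebesgue. LINT z|lebesgue. F (x, y, z)) =
          (LINT y|lborel. LINT z|lborel. G (x, y, z))"
      proof (rule lebesgue_eq_AE_borel(3))
        show "(\<lambda>y. LINT z|lborel. G (x, y, z)) \<in> borel_measurable borel"
          using borel_measurable_LINT_pair[OF 1[of x]] .
        show "AE y in lborel. (LINT z|lebesgue. F (x, y, z)) = (LINT z|lborel. G (x, y, z))"
          using AE_lborel_pair[OF elim(1)]
          by eventually_elim (auto intro!: lebesgue_eq_AE_borel(3))
      qed
      then show ?case
        using lborel_integral_pair(1)[OF elim(2)] by simp
    qed
  qed
  finally show ?thesis .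
qed

section \<open>Measure-preserving maps\<close>

lemma lebesgue_measure_preserving:
  fixes F :: "'a::euclidean_space \<Rightarrow> real" and T :: "'b::euclidean_space \<Rightarrow> 'a"
  assumes T: "T \<in> borel_measurable borel" "distr lborel borel T = lborel"
    and F: "integrable lebesgue F"
  shows "integrable lebesgue (\<lambda>x. F (T x))"
    and "(LINT x|lebesgue. F (T x)) = integral\<^sup>L lebesgue F"
proof -
  obtain G where G: "G \<in> borel_measurable borel" "AE v in lborel. F v = G v"
    using borel_representative borel_measurable_integrable[OF F] by blast
  have m: "(\<lambda>x. G (T x)) \<in> borel_measurable borel"
    using T(1) G(1) by (rule measurable_compose)
  \<comment> \<open>Under a Borel map the preimage of a null set may have positive measure;
    preservation of the measure is what makes the exceptional set of
    \<open>F (T x) = G (T x)\<close> null.\<close>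
  obtain N where N: "N \<in> null_sets lborel" "{v \<in> space lborel. F v \<noteq> G v} \<subseteq> N"
    using G(2) unfolding eventually_ae_filter by blast
  have "AE v in distr lborel borel T. v \<notin> N"
    unfolding T(2) using N(1) by (rule AE_not_in)
  then have "AE x in lborel. T x \<notin> N"
    using T(1) N(1) by (subst (asm) AE_distr_iff) auto
  then have ae: "AE x in lborel. F (T x) = G (T x)"
    by eventually_elim (use N(2) in auto)
  have "integrable (distr lborel borel T) G"
    using lebesgue_eq_AE_borel(2)[OF G] F by (simp add: T(2))
  then have "integrable lborel (\<lambda>x. G (T x))"
    using T(1) G(1) by (subst (asm) integrable_distr_eq) auto
  then show "integrable lebesgue (\<lambda>x. F (T x))"
    using lebesgue_eq_AE_borel(2)[OF m ae] by simp
  have "(LINT x|lebesgue. F (T x)) = (LINT x|lborel. G (T x))"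
    by (rule lebesgue_eq_AE_borel(3)[OF m ae])
  also have "\<dots> = integral\<^sup>L (distr lborel borel T) G"
    using T(1) G(1) by (subst integral_distr) auto
  finally show "(LINT x|lebesgue. F (T x)) = integral\<^sup>L lebesgue F"
    using lebesgue_eq_AE_borel(3)[OF G] by (simp add: T(2))
qed

lemma distr_lborel_compose:
  fixes T :: "'a::euclidean_space \<Rightarrow> 'b::euclidean_space"
    and S :: "'b \<Rightarrow> 'c::euclidean_space"
  assumes "T \<in> borel_measurable borel" "distr lborel borel T = lborel"
    and "S \<in> borel_measurable borel" "distr lborel borel S = lborel"
  shows "distr lborel borel (\<lambda>x. S (T x)) = lborel"
  using distr_distr[of S borel borel T lborel] assms by (simp add: o_def)

lemma emeasure_distr_lborel:
  fixes T :: "'a::euclidean_space \<Rightarrow> 'b::euclidean_space"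
  assumes "T \<in> borel_measurable borel" "A \<in> sets borel"
  shows "emeasure (distr lborel borel T) A = (\<integral>\<^sup>+ v. indicator A (T v) \<partial>lborel)"
proof -
  have "emeasure (distr lborel borel T) A = (\<integral>\<^sup>+ v. indicator A v \<partial>distr lborel borel T)"
    using assms by simp
  also have "\<dots> = (\<integral>\<^sup>+ v. indicator A (T v) \<partial>lborel)"
    using assms by (intro nn_integral_distr) auto
  finally show ?thesis .
qed

text \<open>For fixed \<open>y\<close> the map is a translation in \<open>x\<close>, so Fubini
  reduces the claim to the translation invariance of \<open>lborel\<close>.\<close>

lemma distr_lborel_shear_fst:
  fixes c :: "'b::euclidean_space \<Rightarrow> 'a::euclidean_space"
  assumes [measurable]: "c \<in> borel_measurable borel"
  shows "distr lborel borel (\<lambda>(x, y). (x + c y, y)) = lborel"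
proof (rule measure_eqI)
  fix A :: "('a \<times> 'b) set" assume "A \<in> sets (distr lborel borel (\<lambda>(x, y). (x + c y, y)))"
  then have A: "A \<in> sets borel" by simp
  then have [measurable]: "A \<in> sets (borel \<Otimes>\<^sub>M borel)" unfolding borel_prod .
  have "emeasure (distr lborel borel (\<lambda>(x, y). (x + c y, y))) A =
      (\<integral>\<^sup>+ v. indicator A (fst v + c (snd v), snd v) \<partial>lborel)"
    using A by (subst emeasure_distr_lborel)
      (auto simp: case_prod_unfold borel_prod[symmetric])
  also have "\<dots> = (\<integral>\<^sup>+ v. indicator A (fst v + c (snd v), snd v) \<partial>(lborel \<Otimes>\<^sub>M lborel))"
    unfolding lborel_prod ..
  also have "\<dots> = (\<integral>\<^sup>+ y. \<integral>\<^sup>+ x. indicator A (x + c y, y) \<partial>lborel \<partial>lborel)"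
    by (subst lborel_pair.nn_integral_snd[symmetric]) auto
  also have "\<dots> = (\<integral>\<^sup>+ y. \<integral>\<^sup>+ x. indicator A (x, y) \<partial>lborel \<partial>lborel)"
  proof (rule nn_integral_cong)
    fix y
    have "(\<integral>\<^sup>+ x. indicator A (x, y) \<partial>(distr lborel borel ((+) (c y)))) =
        (\<integral>\<^sup>+ x. indicator A (c y + x, y) \<partial>lborel)"
      by (subst nn_integral_distr) auto
    then show "(\<integral>\<^sup>+ x. indicator A (x + c y, y) \<partial>lborel) = (\<integral>\<^sup>+ x. indicator A (x, y) \<partial>lborel)"
      by (simp add: lborel_distr_plus add.commute)
  qed
  also have "\<dots> = (\<integral>\<^sup>+ v. indicator A v \<partial>(lborel \<Otimes>\<^sub>M lborel))"
    by (subst lborel_pair.nn_integral_snd[symmetric]) auto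
  finally show "emeasure (distr lborel borel (\<lambda>(x, y). (x + c y, y))) A = emeasure lborel A"
    using A unfolding lborel_prod by simp
qed simp

lemma distr_lborel_shear_snd:
  fixes c :: "'a::euclidean_space \<Rightarrow> 'b::euclidean_space"
  assumes [measurable]: "c \<in> borel_measurable borel"
  shows "distr lborel borel (\<lambda>(x, y). (x, y + c x)) = lborel"
proof (rule measure_eqI)
  fix A :: "('a \<times> 'b) set" assume "A \<in> sets (distr lborel borel (\<lambda>(x, y). (x, y + c x)))"
  then have A: "A \<in> sets borel" by simp
  then have [measurable]: "A \<in> sets (borel \<Otimes>\<^sub>M borel)" unfolding borel_prod .
  have "emeasure (distr lborel borel (\<lambda>(x, y). (x, y + c x))) A =
      (\<integral>\<^sup>+ v. indicator A (fst v, snd v + c (fst v)) \<partial>lborel)"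
    using A by (subst emeasure_distr_lborel)
      (auto simp: case_prod_unfold borel_prod[symmetric])
  also have "\<dots> = (\<integral>\<^sup>+ v. indicator A (fst v, snd v + c (fst v)) \<partial>(lborel \<Otimes>\<^sub>M lborel))"
    unfolding lborel_prod ..
  also have "\<dots> = (\<integral>\<^sup>+ x. \<integral>\<^sup>+ y. indicator A (x, y + c x) \<partial>lborel \<partial>lborel)"
    by (subst lborel.nn_integral_fst[symmetric]) auto
  also have "\<dots> = (\<integral>\<^sup>+ x. \<integral>\<^sup>+ y. indicator A (x, y) \<partial>lborel \<partial>lborel)"
  proof (rule nn_integral_cong)
    fix x
    have "(\<integral>\<^sup>+ y. indicator A (x, y) \<partial>(distr lborel borel ((+) (c x)))) =
        (\<integral>\<^sup>+ y. indicator A (x, c x + y) \<partial>lborel)"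
      by (subst nn_integral_distr) auto
    then show "(\<integral>\<^sup>+ y. indicator A (x, y + c x) \<partial>lborel) = (\<integral>\<^sup>+ y. indicator A (x, y) \<partial>lborel)"
      by (simp add: lborel_distr_plus add.commute)
  qed
  also have "\<dots> = (\<integral>\<^sup>+ v. indicator A v \<partial>(lborel \<Otimes>\<^sub>M lborel))"
    by (subst lborel.nn_integral_fst[symmetric]) auto
  finally show "emeasure (distr lborel borel (\<lambda>(x, y). (x, y + c x))) A = emeasure lborel A"
    using A unfolding lborel_prod by simp
qed simp

lemma distr_lborel_swap_snd:
  "distr lborel borel (\<lambda>(x, y, z). (x, z, y)) =
    (lborel :: ('a::euclidean_space \<times> 'b::euclidean_space \<times> 'c::euclidean_space) measure)"
proof (rule measure_eqI)
  let ?T = "(\<lambda>(x, y, z). (x, z, y)) :: 'a \<times> 'c \<times> 'b \<Rightarrow> 'a \<times> 'b \<times> 'c"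
  fix A :: "('a \<times> 'b \<times> 'c) set"
  assume "A \<in> sets (distr lborel borel ?T)"
  then have A: "A \<in> sets borel" by simp
  then have A'[measurable]: "A \<in> sets (borel \<Otimes>\<^sub>M borel \<Otimes>\<^sub>M borel)" unfolding borel_prod .
  have T: "?T \<in> borel_measurable borel"
    by (auto intro!: borel_measurable_continuous_onI continuous_intros simp: case_prod_unfold)
  have fst: "(\<integral>\<^sup>+ x. \<integral>\<^sup>+ q. h (x, q) \<partial>lborel \<partial>lborel) = integral\<^sup>N lborel h"
    if "h \<in> borel_measurable borel"
    for h :: "'d::euclidean_space \<times> 'e::euclidean_space \<Rightarrow> ennreal"
    using lborel.nn_integral_fst[of h lborel] that unfolding lborel_prod by simp
  have inner: "(\<integral>\<^sup>+ q. indicator A (x, snd q, fst q) \<partial>lborel) = (\<integral>\<^sup>+ q. indicator A (x, q) \<partial>lborel)"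
    for x
  proof -
    have m: "(\<lambda>q. indicator A (x, q) :: ennreal) \<in> borel_measurable (lborel \<Otimes>\<^sub>M lborel)"
      by measurable
    have "(\<integral>\<^sup>+ q. indicator A (x, q) \<partial>(lborel \<Otimes>\<^sub>M lborel)) =
        (\<integral>\<^sup>+ q. indicator A (x, snd q, fst q) \<partial>(lborel \<Otimes>\<^sub>M lborel))"
      by (subst lborel_pair.distr_pair_swap, subst nn_integral_distr)
        (auto simp: case_prod_unfold intro: m)
    then show ?thesis
      unfolding lborel_prod by simp
  qed
  have "emeasure (distr lborel borel ?T) A = (\<integral>\<^sup>+ v. indicator A (?T v) \<partial>lborel)"
    using T A by (rule emeasure_distr_lborel)
  also have "\<dots> = (\<integral>\<^sup>+ x. \<integral>\<^sup>+ q. indicator A (x, snd q, fst q) \<partial>lborel \<partial>lborel)"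
    using fst[OF measurable_compose[OF T borel_measurable_indicator[OF A]]]
    by (simp add: case_prod_unfold)
  also have "\<dots> = emeasure lborel A"
    using A fst[OF borel_measurable_indicator[OF A]] by (simp add: inner)
  finally show "emeasure (distr lborel borel ?T) A = emeasure lborel A" .
qed simp


text \<open>A rotation is a product of three shears, unless its sine vanishes.\<close>

lemma distr_lborel_rotation:
  fixes e :: "'b::euclidean_space"
  assumes e: "norm e = 1" and cd: "c\<^sup>2 + d\<^sup>2 = (1::real)"
  defines "T \<equiv> (\<lambda>c d. (\<lambda>(t, q). (c * t - d * (q \<bullet> e), q + (d * t + (c - 1) * (q \<bullet> e)) *\<^sub>R e)))"
  shows "distr lborel borel (T c d) = lborel"
proof -
  have ee: "e \<bullet> e = 1"
    using e by (simp add: dot_square_norm)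
  have meas: "T c d \<in> borel_measurable borel" for c d
    unfolding T_def case_prod_unfold
    by (intro borel_measurable_continuous_onI continuous_intros)
  have generic: "distr lborel borel (T c d) = lborel" if "c\<^sup>2 + d\<^sup>2 = 1" "d \<noteq> 0" for c d
  proof -
    \<comment> \<open>With \<open>c\<close> = cos \<theta> and \<open>d\<close> = sin \<theta> this
      is -tan(\<theta>/2). The rotation acts in the plane of the first coordinate and
      \<open>e\<close> and fixes the complement of \<open>e\<close>; the outer shears change the
      first coordinate, the middle one moves along \<open>e\<close>.\<close>
    define a where "a = (c - 1) / d"
    let ?S1 = "\<lambda>(t, q :: 'b). (t + a * (q \<bullet> e), q)"
    let ?S2 = "\<lambda>(t, q :: 'b). (t, q + (d * t) *\<^sub>R e)"
    have m1: "?S1 \<in> borel_measurable borel" and m2: "?S2 \<in> borel_measurable borel"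
      unfolding case_prod_unfold
      by (intro borel_measurable_continuous_onI continuous_intros)+
    have d1: "distr lborel borel ?S1 = lborel"
      by (intro distr_lborel_shear_fst borel_measurable_continuous_onI continuous_intros)
    have d2: "distr lborel borel ?S2 = lborel"
      by (intro distr_lborel_shear_snd borel_measurable_continuous_onI continuous_intros)
    have ad: "a * d = c - 1"
      using that(2) by (simp add: a_def)
    have "a * (1 + c) * d = (1 + c) * (c - 1)"
      by (simp add: ad[symmetric])
    also have "\<dots> = (- d) * d"
      using that(1) by (simp add: algebra_simps power2_eq_square)
    finally have "a * (1 + c) * d = (- d) * d" .
    then have aa: "a * (1 + c) = - d"
      using that(2) by (metis mult_right_cancel)
    have eq: "?S1 (?S2 (?S1 v)) = T c d v" for v
    proof (cases v)
      case (Pair t q)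
      have "t + a * (q \<bullet> e) + a * (q \<bullet> e + d * (t + a * (q \<bullet> e))) =
          (1 + a * d) * t + (a * (1 + (1 + a * d))) * (q \<bullet> e)"
        by (simp add: algebra_simps)
      also have "\<dots> = c * t - d * (q \<bullet> e)"
        unfolding ad using aa by simp
      finally have 1: "t + a * (q \<bullet> e) + a * (q \<bullet> e + d * (t + a * (q \<bullet> e))) =
        c * t - d * (q \<bullet> e)" .
      have "d * (t + a * (q \<bullet> e)) = d * t + (c - 1) * (q \<bullet> e)"
        using ad by (simp only: ad[symmetric] distrib_left mult.assoc) (simp only: mult.left_commute)
      with 1 show ?thesis
        by (simp only: Pair T_def case_prod_conv inner_add_left inner_scaleR_left ee mult_1_right)
    qed
    have "T c d = (\<lambda>v. ?S1 (?S2 (?S1 v)))"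
      by (rule ext, rule eq[symmetric])
    moreover have "distr lborel borel (\<lambda>v. ?S1 (?S2 (?S1 v))) = lborel"
      by (rule distr_lborel_compose[OF measurable_compose[OF m1 m2]
            distr_lborel_compose[OF m1 d1 m2 d2] m1 d1])
    ultimately show ?thesis
      by (simp only:)
  qed
  show ?thesis
  proof (cases "d = 0")
    case False
    with cd show ?thesis by (rule generic)
  next
    case True
    have "c = 1 \<or> c = -1"
      using cd True by (simp add: power2_eq_1_iff)
    then show ?thesis
    proof
      assume "c = 1"
      then have "T c d = (\<lambda>v. v)"
        by (auto simp: T_def True)
      then show ?thesis
        by (simp add: distr_id2)
    next
      \<comment> \<open>The half turn in this plane is the square of the quarter turn
        \<open>T 0 1\<close>, to which the factorisation applies.\<close>
      assume "c = -1"
      then have "T c d v = T 0 1 (T 0 1 v)" for v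
        by (cases v) (simp add: T_def True inner_add_left inner_diff_left ee algebra_simps)
      then have "T c d = (\<lambda>v. T 0 1 (T 0 1 v))"
        by (intro ext)
      moreover have "distr lborel borel (T 0 1) = lborel"
        by (rule generic) simp_all
      ultimately show ?thesis
        using distr_lborel_compose[OF meas _ meas, of 0 1 0 1] by (simp only:)
    qed
  qed
qed

lemma lebesgue_rotation:
  fixes F :: "real \<times> real \<Rightarrow> real"
  assumes "c\<^sup>2 + d\<^sup>2 = (1::real)" and "integrable lebesgue F"
  shows "integrable lebesgue (\<lambda>(t, s). F (t * c - s * d, t * d + s * c))"
    and "(LINT (t, s)|lebesgue. F (t * c - s * d, t * d + s * c)) = integral\<^sup>L lebesgue F"
proof -
  let ?T = "\<lambda>(t, s). (t * c - s * d, t * d + s * c)"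
  have m: "?T \<in> borel_measurable borel"
    unfolding case_prod_unfold
    by (intro borel_measurable_continuous_onI continuous_intros)
  have "distr lborel borel ?T = lborel"
    using distr_lborel_rotation[of "1::real" c d] assms(1)
    by (simp add: algebra_simps)
  from lebesgue_measure_preserving[OF m this assms(2)]
  show "integrable lebesgue (\<lambda>(t, s). F (t * c - s * d, t * d + s * c))"
    and "(LINT (t, s)|lebesgue. F (t * c - s * d, t * d + s * c)) = integral\<^sup>L lebesgue F"
    by (simp_all add: case_prod_unfold)
qed

text \<open>The order \<open>t\<close>, \<open>w\<close>, \<open>s\<close> of the variables is the order of integration in the theorem.\<close>

lemma lebesgue_rotation_cylinder:
  fixes F :: "real \<times> real \<times> real \<Rightarrow> real"
  assumes "c\<^sup>2 + d\<^sup>2 = (1::real)" and "integrable lebesgue F"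
  shows "integrable lebesgue (\<lambda>(t, w, s). F (t * c - s * d, t * d + s * c, w))"
    and "(LINT (t, w, s)|lebesgue. F (t * c - s * d, t * d + s * c, w)) = integral\<^sup>L lebesgue F"
proof -
  let ?T = "\<lambda>(t, s, w :: real). (t * c - s * d, t * d + s * c, w)"
  let ?S = "\<lambda>(t :: real, w :: real, s :: real). (t, s, w)"
  have m: "?T \<in> borel_measurable borel" "?S \<in> borel_measurable borel"
    unfolding case_prod_unfold
    by (intro borel_measurable_continuous_onI continuous_intros)+
  \<comment> \<open>The unit vector \<open>(1, 0)\<close> singles out \<open>s\<close> in the pair
    \<open>(s, w)\<close>, so the height \<open>w\<close> stays fixed.\<close>
  have "distr lborel borel ?T = lborel"
    using distr_lborel_rotation[of "(1::real, 0::real)" c d] assms(1)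
    by (simp add: algebra_simps case_prod_unfold prod_eq_iff zero_prod_def[symmetric] plus_prod_def inner_prod_def)
  from lebesgue_measure_preserving[OF measurable_compose[OF m(2) m(1)]
    distr_lborel_compose[OF m(2) distr_lborel_swap_snd m(1) this] assms(2)]
  show "integrable lebesgue (\<lambda>(t, w, s). F (t * c - s * d, t * d + s * c, w))"
    and "(LINT (t, w, s)|lebesgue. F (t * c - s * d, t * d + s * c, w)) = integral\<^sup>L lebesgue F"
    by (simp_all add: case_prod_unfold)
qed


subsection \<open>Orthogonal polynomials of a positive functional\<close>

lemma degree_eqI_coeff:
  assumes "coeff p k \<noteq> 0" "\<forall>i>k. coeff p i = 0"
  shows "degree p = k"
  using assms by (intro antisym degree_le le_degree)

text \<open>Integration of polynomials against a weight, reduced to linearity and definiteness, so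
  that the Gegenbauer weight and the plain and normalised Jacobi weights share one theory.\<close>

locale positive_functional =
  fixes \<Lambda> :: "real poly \<Rightarrow> real"
  assumes add: "\<Lambda> (p + q) = \<Lambda> p + \<Lambda> q"
    and smult: "\<Lambda> (smult c p) = c * \<Lambda> p"
    and pos: "q \<noteq> 0 \<Longrightarrow> 0 < \<Lambda> (q * q)"
begin

lemma zero: "\<Lambda> 0 = 0"
  using smult[of 0 0] by simp

lemma diff: "\<Lambda> (p - q) = \<Lambda> p - \<Lambda> q"
  using add[of "p - q" q] by simp

lemma sum: "\<Lambda> (\<Sum>i\<in>A. f i) = (\<Sum>i\<in>A. \<Lambda> (f i))"
  by (induction A rule: infinite_finite_induct) (simp_all add: zero add)

text \<open>A polynomial \<open>r\<close> below degree \<open>k\<close> is a combination of the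
  \<open>p i\<close>; its top coefficients are removed one at a time. The bound is written through
  coefficients so that \<open>k = 0\<close> means \<open>r = 0\<close>, where
  \<open>degree r < 0\<close> would be unsatisfiable.\<close>

lemma orthogonal_lower:
  assumes orth: "\<And>i. i < k \<Longrightarrow> \<Lambda> (q * p i) = 0"
    and deg: "\<And>i. i < k \<Longrightarrow> degree (p i) = i \<and> p i \<noteq> 0"
    and r: "\<forall>i\<ge>k. coeff r i = 0"
  shows "\<Lambda> (q * r) = 0"
proof -
  have "\<Lambda> (q * r) = 0" if "m \<le> k" "\<forall>i\<ge>m. coeff r i = 0" for m r
    using that
  proof (induction m arbitrary: r)
    case 0
    then have "r = 0" by (simp add: poly_eq_iff)
    then show ?case by (simp add: zero)
  next
    case (Suc m)
    define c where "c = coeff r m / lead_coeff (p m)"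
    define r' where "r' = r - smult c (p m)"
    have m: "degree (p m) = m" "p m \<noteq> 0"
      using deg[of m] Suc.prems by auto
    have "coeff r' i = 0" if "i \<ge> m" for i
    proof (cases "i = m")
      case True
      then show ?thesis using m by (simp add: r'_def c_def leading_coeff_0_iff[symmetric] del: leading_coeff_0_iff)
    next
      case False
      then show ?thesis using m that Suc.prems by (simp add: r'_def coeff_eq_0)
    qed
    then have "\<Lambda> (q * r') = 0"
      using Suc by auto
    moreover have "q * r = q * r' + smult c (q * p m)"
      by (simp add: r'_def algebra_simps)
    ultimately show ?case
      using orth[of m] Suc.prems by (simp add: add smult)
  qed
  from this[of k r] r show ?thesis by simp
qed

text \<open>Subtracting the multiple of \<open>p\<close> with the same coefficient at
  \<open>k\<close> leaves a polynomial \<open>D\<close> of lower degree that is orthogonal to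
  itself, hence zero by definiteness.\<close>

lemma orthogonal_unique:
  assumes p: "\<And>r. \<forall>i\<ge>k. coeff r i = 0 \<Longrightarrow> \<Lambda> (p * r) = 0" "degree p = k" "p \<noteq> 0"
    and q: "\<And>r. \<forall>i\<ge>k. coeff r i = 0 \<Longrightarrow> \<Lambda> (q * r) = 0" "degree q \<le> k"
  shows "q = smult (coeff q k / lead_coeff p) p"
proof -
  define c where "c = coeff q k / lead_coeff p"
  define D where "D = q - smult c p"
  have low: "\<forall>i\<ge>k. coeff D i = 0"
  proof (intro allI impI)
    fix i assume "k \<le> i"
    then show "coeff D i = 0"
      using p(2,3) q(2) by (cases "i = k") (auto simp: D_def c_def coeff_eq_0)
  qed
  have "D * D = (q - smult c p) * D"
    by (simp only: D_def)
  also have "\<dots> = q * D - smult c (p * D)"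
    by (simp add: left_diff_distrib)
  finally have "D * D = q * D - smult c (p * D)" .
  then have "\<Lambda> (D * D) = 0"
    using p(1)[OF low] q(1)[OF low] by (simp add: diff smult)
  then have "D = 0"
    using pos[of D] by auto
  then show ?thesis by (simp add: D_def c_def)
qed

lemma monic_orthogonal_exists:
  "\<exists>q. degree q = k \<and> lead_coeff q = 1 \<and> (\<forall>r. (\<forall>i\<ge>k. coeff r i = 0) \<longrightarrow> \<Lambda> (q * r) = 0)"
proof (induction k rule: less_induct)
  case (less k)
  then obtain p where p: "\<And>m. m < k \<Longrightarrow> degree (p m) = m" "\<And>m. m < k \<Longrightarrow> lead_coeff (p m) = 1"
    "\<And>m r. m < k \<Longrightarrow> (\<forall>i\<ge>m. coeff r i = 0) \<Longrightarrow> \<Lambda> (p m * r) = 0"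
    by metis
  have nz: "p m \<noteq> 0" if "m < k" for m
    using p(2)[OF that] by auto
  have orth: "\<Lambda> (p i * p j) = 0" if "i < k" "j < k" "i \<noteq> j" for i j
  proof (cases "j < i")
    case True
    then show ?thesis using that p(1)[of j] by (intro p(3)) (auto simp: coeff_eq_0)
  next
    case False
    then have "\<Lambda> (p j * p i) = 0"
      using that p(1)[of i] by (intro p(3)) (auto simp: coeff_eq_0)
    then show ?thesis by (simp add: mult.commute)
  qed
  \<comment> \<open>Gram-Schmidt applied to the monomial of degree \<open>k\<close>.\<close>
  define c where "c i = \<Lambda> (monom 1 k * p i) / \<Lambda> (p i * p i)" for i
  define q where "q = monom 1 k - (\<Sum>i<k. smult (c i) (p i))"
  have "coeff q i = (if i = k then 1 else 0)" if "i \<ge> k" for i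
    using that p(1) by (auto simp: q_def coeff_sum intro!: sum.neutral coeff_eq_0)
  then have coeff: "coeff q k = 1" "\<forall>i>k. coeff q i = 0"
    by auto
  then have deg: "degree q = k"
    by (intro degree_eqI_coeff) auto
  with coeff have lead: "lead_coeff q = 1"
    by simp
  have orth_p: "\<Lambda> (q * p j) = 0" if "j < k" for j
  proof -
    have "\<Lambda> (q * p j) = \<Lambda> (monom 1 k * p j) - (\<Sum>i<k. c i * \<Lambda> (p i * p j))"
      by (simp add: q_def left_diff_distrib diff sum_distrib_right sum smult)
    also have "(\<Sum>i<k. c i * \<Lambda> (p i * p j)) = (\<Sum>i<k. if i = j then c j * \<Lambda> (p j * p j) else 0)"
      using that orth by (intro sum.cong) auto
    also have "\<dots> = \<Lambda> (monom 1 k * p j)"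
      using that pos[OF nz[OF that]] by (simp add: c_def)
    finally show ?thesis by simp
  qed
  have "\<Lambda> (q * r) = 0" if "\<forall>i\<ge>k. coeff r i = 0" for r
    by (rule orthogonal_lower[of k q p]) (use orth_p that p(1) nz in auto)
  with deg lead show ?case by auto
qed

text \<open>Orthogonality fixes the polynomial of each degree up to a factor, norm 1 fixes the
  modulus of that factor and the leading coefficient its sign. This is what gives the definite
  description \<open>jacobi\<close> a value.\<close>

lemma orthonormal_exists_unique:
  "\<exists>!p. (\<forall>k. degree (p k) = k) \<and> (\<forall>k l. \<Lambda> (p k * p l) = (if k = l then 1 else 0)) \<and>
     (\<forall>l. 0 < lead_coeff (p l))"
proof -
  obtain q where q: "\<And>k. degree (q k) = k" "\<And>k. lead_coeff (q k) = 1"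
    "\<And>k r. \<forall>i\<ge>k. coeff r i = 0 \<Longrightarrow> \<Lambda> (q k * r) = 0"
    using monic_orthogonal_exists by metis
  have nz: "q k \<noteq> 0" for k
    using q(2)[of k] by auto
  have orth: "\<Lambda> (q i * q j) = 0" if "i \<noteq> j" for i j
  proof (cases "j < i")
    case True
    then show ?thesis using q(1)[of j] by (intro q(3)) (auto simp: coeff_eq_0)
  next
    case False
    then have "\<Lambda> (q j * q i) = 0"
      using that q(1)[of i] by (intro q(3)) (auto simp: coeff_eq_0)
    then show ?thesis by (simp add: mult.commute)
  qed
  define s where "s k = 1 / sqrt (\<Lambda> (q k * q k))" for k
  have s: "s k > 0" "s k * s k * \<Lambda> (q k * q k) = 1" for k
    using pos[OF nz[of k]] by (auto simp: s_def)
  show ?thesis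
  proof (rule ex1I[of _ "\<lambda>k. smult (s k) (q k)"], intro conjI allI)
    show "degree (smult (s k) (q k)) = k" for k
      using s(1)[of k] q(1)[of k] by simp
    show "\<Lambda> (smult (s k) (q k) * smult (s l) (q l)) = (if k = l then 1 else 0)" for k l
      using orth[of k l] s(2)[of k] by (auto simp: smult mult.assoc)
    show "0 < lead_coeff (smult (s l) (q l))" for l
      using s(1)[of l] q(2)[of l] by simp
  next
    fix p assume p: "(\<forall>k. degree (p k) = k) \<and> (\<forall>k l. \<Lambda> (p k * p l) = (if k = l then 1 else 0)) \<and>
     (\<forall>l. 0 < lead_coeff (p l))"
    show "p = (\<lambda>k. smult (s k) (q k))"
    proof (rule ext)
      fix k
      have pnz: "p i \<noteq> 0" for i using p by (metis leading_coeff_0_iff less_irrefl)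
      have "\<Lambda> (p k * r) = 0" if "\<forall>i\<ge>k. coeff r i = 0" for r
        by (rule orthogonal_lower[of k "p k" p]) (use that p pnz in auto)
      with q nz p have eq: "p k = smult (coeff (p k) k / lead_coeff (q k)) (q k)"
        by (intro orthogonal_unique) auto
      define c where "c = coeff (p k) k"
      have pk: "p k = smult c (q k)"
        using eq q(2)[of k] by (simp add: c_def)
      have "c > 0" using p by (metis c_def)
      have "c * c * \<Lambda> (q k * q k) = 1"
        using p[THEN conjunct2, THEN conjunct1, rule_format, of k k] by (simp add: pk smult mult.assoc)
      then have "c\<^sup>2 = (s k)\<^sup>2"
        using s(2)[of k] pos[OF nz[of k]] unfolding power2_eq_square by (metis less_irrefl mult_right_cancel)
      then have "c = s k"
        using \<open>c > 0\<close> s(1)[of k] by (simp add: power2_eq_iff_nonneg)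
      then show "p k = smult (s k) (q k)" using pk by simp
    qed
  qed
qed

end

lemma positive_functional_cmult:
  assumes "positive_functional \<Lambda>" "c > 0"
  shows "positive_functional (\<lambda>q. c * \<Lambda> q)"
proof -
  interpret positive_functional \<Lambda> by fact
  show ?thesis
    using assms(2) by unfold_locales (auto simp: add smult pos algebra_simps)
qed


subsection \<open>Weights on \<open>[-1,1]\<close>\<close>

lemma set_integrable_bounded_mult:
  fixes g w :: "'a::euclidean_space \<Rightarrow> real"
  assumes w: "set_integrable lebesgue A w" and g: "g \<in> borel_measurable borel"
    and bd: "\<And>x. x \<in> A \<Longrightarrow> \<bar>g x\<bar> \<le> C"
  shows "set_integrable lebesgue A (\<lambda>x. g x * w x)"
proof -
  have w': "integrable lebesgue (\<lambda>x. indicator A x * w x)"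
    using w by (simp add: set_integrable_def)
  have "g \<in> borel_measurable lebesgue"
    using g by (auto intro: measurable_completion)
  then have m: "(\<lambda>x. g x * (indicator A x * w x)) \<in> borel_measurable lebesgue"
    using w' by measurable
  have "integrable lebesgue (\<lambda>x. g x * (indicator A x * w x))"
  proof (rule Bochner_Integration.integrable_bound[OF _ m])
    show "integrable lebesgue (\<lambda>x. C * \<bar>indicator A x * w x\<bar>)"
      using w' by simp
    show "AE x in lebesgue. norm (g x * (indicator A x * w x)) \<le> norm (C * \<bar>indicator A x * w x\<bar>)"
    proof (rule AE_I2)
      fix x
      show "norm (g x * (indicator A x * w x)) \<le> norm (C * \<bar>indicator A x * w x\<bar>)"
        using bd[of x] by (cases "x \<in> A") (auto simp: abs_mult intro!: mult_right_mono)
    qed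
  qed
  moreover have "(\<lambda>x. g x * (indicator A x * w x)) = (\<lambda>x. indicator A x *\<^sub>R (g x * w x))"
    by (simp add: algebra_simps)
  ultimately show ?thesis
    by (simp add: set_integrable_def)
qed

lemma set_integrable_continuous_mult:
  fixes g w :: "'a::euclidean_space \<Rightarrow> real"
  assumes w: "set_integrable lebesgue A w" and g: "continuous_on UNIV g" and A: "compact A"
  shows "set_integrable lebesgue A (\<lambda>x. g x * w x)"
proof -
  have "bounded (g ` A)"
    using A g by (intro compact_imp_bounded compact_continuous_image) (auto intro: continuous_on_subset)
  then obtain C where "\<And>x. x \<in> A \<Longrightarrow> \<bar>g x\<bar> \<le> C"
    by (auto simp: bounded_iff)
  then show ?thesis
    by (intro set_integrable_bounded_mult[OF w borel_measurable_continuous_onI[OF g]])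
qed

text \<open>If the integral of \<open>q * q\<close> vanished, the weight would vanish almost
  everywhere off the finitely many roots of \<open>q\<close>, and an interval would be null. Strict
  positivity is asked only inside because \<open>powr\<close> gives the weights in use the value 0
  at the endpoints.\<close>

lemma positive_functional_weight:
  assumes w: "set_integrable lebesgue {-1..1} w"
    and nonneg: "\<And>t. -1 \<le> t \<Longrightarrow> t \<le> 1 \<Longrightarrow> 0 \<le> w t"
    and pos: "\<And>t. -1 < t \<Longrightarrow> t < 1 \<Longrightarrow> 0 < w t"
  shows "positive_functional (\<lambda>q. LINT t:{-1..1}|lebesgue. poly q t * w t)"
proof
  have int: "set_integrable lebesgue {-1..1} (\<lambda>t. poly q t * w t)" for q
    by (intro set_integrable_continuous_mult w continuous_intros) simp
  show "(LINT t:{-1..1}|lebesgue. poly (p + q) t * w t) =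
      (LINT t:{-1..1}|lebesgue. poly p t * w t) + (LINT t:{-1..1}|lebesgue. poly q t * w t)" for p q
    by (simp add: distrib_right set_integral_add[OF int int])
  show "(LINT t:{-1..1}|lebesgue. poly (smult c p) t * w t) =
      c * (LINT t:{-1..1}|lebesgue. poly p t * w t)" for c p
    by (simp add: mult.assoc)
  fix q :: "real poly" assume q: "q \<noteq> 0"
  let ?f = "\<lambda>t. indicator {-1..1} t * (poly (q * q) t * w t)"
  have f: "integrable lebesgue ?f"
    using int[of "q * q"] by (simp only: set_integrable_def real_scaleR_def)
  have f0: "0 \<le> ?f t" for t
    using nonneg[of t] by (auto simp: indicator_def)
  have "integral\<^sup>L lebesgue ?f \<noteq> 0"
  proof
    assume "integral\<^sup>L lebesgue ?f = 0"
    then have "AE t in lebesgue. ?f t = 0"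
      using integral_nonneg_eq_0_iff_AE[OF f] f0 by simp
    moreover have "AE t in lebesgue. t \<notin> {t. poly q t = 0}"
      using poly_roots_finite[OF q] by (intro AE_completion AE_not_in finite_imp_null_set_lborel)
    ultimately have "AE t in lebesgue. t \<notin> {-1<..<(1::real)}"
    proof eventually_elim
      case (elim t)
      then show ?case using pos[of t] by (auto simp: indicator_def split: if_splits)
    qed
    then have "{-1<..<1} \<in> null_sets (lebesgue :: real measure)"
      by (simp add: completion.null_sets_iff_AE)
    then show False
      by (simp add: null_sets_def)
  qed
  moreover have "0 \<le> integral\<^sup>L lebesgue ?f"
    by (intro integral_nonneg_AE AE_I2 f0)
  ultimately show "0 < (LINT t:{-1..1}|lebesgue. poly (q * q) t * w t)"
    by (simp add: set_lebesgue_integral_def)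
qed

text \<open>For \<open>a < 0\<close> the integrand is unbounded near 1, but the antiderivative is
  continuous up to the endpoint, which suffices for the interior form of the fundamental theorem.
  The exponent \<mu> - 1/2 is of this kind for \<mu> < 1/2.\<close>

lemma has_integral_one_minus_powr:
  assumes a: "a > (-1::real)"
  shows "((\<lambda>t. (1 - t) powr a) has_integral 2 powr (a + 1) / (a + 1)) {-1..1}"
proof -
  have "((\<lambda>t. (1 - t) powr a) has_integral
      (- ((1 - 1) powr (a + 1) / (a + 1)) - (- ((1 - (-1)) powr (a + 1) / (a + 1))))) {-1..1}"
  proof (rule fundamental_theorem_of_calculus_interior)
    show "continuous_on {-1..1} (\<lambda>t. - ((1 - t) powr (a + 1) / (a + 1)))"
      using a by (intro continuous_intros continuous_on_powr') auto
    show "((\<lambda>t. - ((1 - t) powr (a + 1) / (a + 1))) has_vector_derivative (1 - t) powr a) (at t)"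
      if "t \<in> {-1<..<1}" for t
      unfolding has_real_derivative_iff_has_vector_derivative[symmetric]
    proof -
      have "((\<lambda>t. (1 - t) powr (a + 1)) has_real_derivative - ((a + 1) * (1 - t) powr a)) (at t)"
        using that by (auto intro!: derivative_eq_intros)
      from DERIV_minus[OF DERIV_cdivide[OF this, of "a + 1"]]
      show "((\<lambda>t. - ((1 - t) powr (a + 1) / (a + 1))) has_real_derivative (1 - t) powr a) (at t)"
        using a by simp
    qed
  qed auto
  then show ?thesis by simp
qed

lemma integral_one_minus_powr:
  assumes a: "a > (-1::real)"
  shows "set_integrable lebesgue {-1..1} (\<lambda>t. (1 - t) powr a)"
    and "(LINT t:{-1..1}|lebesgue. (1 - t) powr a) = 2 powr (a + 1) / (a + 1)"
proof -
  show int: "set_integrable lebesgue {-1..1} (\<lambda>t. (1 - t) powr a)"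
    using has_integral_one_minus_powr[OF a]
    by (intro nonnegative_absolutely_integrable_1) (auto simp: has_integral_integrable)
  show "(LINT t:{-1..1}|lebesgue. (1 - t) powr a) = 2 powr (a + 1) / (a + 1)"
    using has_integral_one_minus_powr[OF a] set_lebesgue_integral_eq_integral(2)[OF int]
    by (simp add: integral_unique)
qed


subsection \<open>Gegenbauer polynomials\<close>

text \<open>The classical three-term recurrence. The value at 1, the differential equation and the
  norm are derived from it; orthogonality then identifies the family with
  \<open>gegenbauer\<close>.\<close>

fun geg :: "real \<Rightarrow> nat \<Rightarrow> real poly" where
  "geg a 0 = 1"
| "geg a (Suc 0) = [:0, 2 * a:]"
| "geg a (Suc (Suc k)) = smult (1 / (real k + 2))
     (smult (2 * (real k + 1 + a)) (pCons 0 (geg a (Suc k))) - smult (real k + 2 * a) (geg a k))"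

lemma geg_rec:
  "(real k + 2) * poly (geg a (Suc (Suc k))) x =
     2 * (real k + 1 + a) * x * poly (geg a (Suc k)) x - (real k + 2 * a) * poly (geg a k) x"
  by (simp add: field_simps)

declare geg.simps(3)[simp del]

lemma geg_coeff:
  assumes "a > 0"
  shows "0 < coeff (geg a k) k \<and> (\<forall>i>k. coeff (geg a k) i = 0)"
proof (induction k rule: induct_nat_012)
  case 1
  then show ?case using assms by (auto simp: coeff_pCons split: nat.splits)
next
  case (ge2 k)
  then show ?case using assms by (auto simp: geg.simps(3) coeff_pCons split: nat.splits)
qed simp

lemma geg_degree:
  assumes "a > 0"
  shows "degree (geg a k) = k" "geg a k \<noteq> 0"
proof -
  show "geg a k \<noteq> 0"
    using geg_coeff[OF assms, of k] by auto
  show "degree (geg a k) = k"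
    using geg_coeff[OF assms, of k] by (intro degree_eqI_coeff) auto
qed

lemma geg_one:
  assumes "a > 0"
  shows "poly (geg a k) 1 = pochhammer (2 * a) k / fact k"
proof (induction k rule: induct_nat_012)
  case (ge2 k)
  have "(real k + 2) * poly (geg a (Suc (Suc k))) 1 =
      2 * (real k + 1 + a) * poly (geg a (Suc k)) 1 - (real k + 2 * a) * poly (geg a k) 1"
    using geg_rec[of k a 1] by simp
  also have "(real k + 2 * a) * poly (geg a k) 1 = (real k + 1) * poly (geg a (Suc k)) 1"
    unfolding ge2 by (simp add: pochhammer_Suc field_simps del: of_nat_Suc) (simp add: algebra_simps)
  finally have "(real k + 2) * poly (geg a (Suc (Suc k))) 1 =
      (2 * a + (real k + 1)) * poly (geg a (Suc k)) 1"
    by (simp add: algebra_simps)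
  then have "poly (geg a (Suc (Suc k))) 1 =
      (2 * a + (real k + 1)) * (pochhammer (2 * a) (Suc k) / fact (Suc k)) / (real k + 2)"
    unfolding ge2 by (simp add: eq_divide_eq mult_ac)
  also have "\<dots> = pochhammer (2 * a) (Suc (Suc k)) / fact (Suc (Suc k))"
    unfolding pochhammer_Suc[of _ "Suc k"] fact_Suc[of "Suc k"]
    by (simp add: mult.commute add.commute)
  finally show ?case .
qed simp_all

text \<open>Both first-order relations go through one induction, because the differentiated
  recurrence contains the derivatives of the two preceding polynomials.\<close>

lemma geg_pderiv:
  "(1 - x\<^sup>2) * poly (pderiv (geg a (Suc k))) x =
     (real k + 2 * a) * poly (geg a k) x - (real k + 1) * x * poly (geg a (Suc k)) x \<and>
   (1 - x\<^sup>2) * poly (pderiv (geg a k)) x =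
     (real k + 2 * a) * x * poly (geg a k) x - (real k + 1) * poly (geg a (Suc k)) x"
proof (induction k)
  case 0
  show ?case by (simp add: pderiv_pCons algebra_simps power2_eq_square)
next
  case (Suc k)
  define K where "K = real k"
  define c0 where "c0 = poly (geg a k) x"
  define c1 where "c1 = poly (geg a (Suc k)) x"
  define c2 where "c2 = poly (geg a (Suc (Suc k))) x"
  define d0 where "d0 = poly (pderiv (geg a k)) x"
  define d1 where "d1 = poly (pderiv (geg a (Suc k))) x"
  define d2 where "d2 = poly (pderiv (geg a (Suc (Suc k)))) x"
  have K: "K + 2 \<noteq> 0" by (simp add: K_def)
  have r: "(K + 2) * c2 = 2 * (K + 1 + a) * x * c1 - (K + 2 * a) * c0"
    using geg_rec[of k a x] by (simp add: c0_def c1_def c2_def K_def)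
  have rd: "(K + 2) * d2 = 2 * (K + 1 + a) * (c1 + x * d1) - (K + 2 * a) * d0"
    using K by (simp add: d0_def d1_def d2_def c1_def K_def geg.simps(3) pderiv_smult pderiv_diff pderiv_pCons)
      (simp add: algebra_simps)
  have i1: "(1 - x\<^sup>2) * d1 = (K + 2 * a) * c0 - (K + 1) * x * c1"
    and i2: "(1 - x\<^sup>2) * d0 = (K + 2 * a) * x * c0 - (K + 1) * c1"
    using Suc.IH by (simp_all add: c0_def c1_def d0_def d1_def K_def)
  have g2: "(1 - x\<^sup>2) * d1 = (K + 1 + 2 * a) * x * c1 - (K + 1 + 1) * c2"
    using i1 r by algebra
  have "(K + 2) * ((1 - x\<^sup>2) * d2) = (K + 2) * ((K + 1 + 2 * a) * c1 - (K + 1 + 1) * x * c2)"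
    using i1 i2 r rd by algebra
  then have "(1 - x\<^sup>2) * d2 = (K + 1 + 2 * a) * c1 - (K + 1 + 1) * x * c2"
    using K by simp
  with g2 show ?case
    by (simp add: c1_def c2_def d1_def d2_def K_def algebra_simps)
qed

lemma geg_pderiv_diff:
  "poly (pderiv (geg a k)) x =
     x * poly (pderiv (geg a (Suc k))) x - (real k + 1) * poly (geg a (Suc k)) x"
proof -
  \<comment> \<open>Eliminating between the two relations leaves a factor 1 - x^2. It is cancelled
    among polynomials, so the identity also holds at x = 1 and x = -1.\<close>
  let ?q = "pCons 0 (pderiv (geg a (Suc k))) - smult (real k + 1) (geg a (Suc k))"
  have "[:1, 0, -1:] * pderiv (geg a k) = [:1, 0, -1:] * ?q"
  proof (rule poly_ext)
    fix x
    show "poly ([:1, 0, -1:] * pderiv (geg a k)) x = poly ([:1, 0, -1:] * ?q) x"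
      using geg_pderiv[of x a k] by (simp add: algebra_simps power2_eq_square) algebra
  qed
  then have "pderiv (geg a k) = ?q"
    by (metis mult_cancel_left pCons_eq_0_iff zero_neq_one)
  then show ?thesis by simp
qed

text \<open>Differentiating the first relation of \<open>geg_pderiv\<close> and removing the
  derivative of the lower polynomial by \<open>geg_pderiv_diff\<close> gives the Gegenbauer
  equation. Its use is to exhibit the polynomials as eigenfunctions.\<close>

lemma geg_ode:
  "(1 - x\<^sup>2) * poly (pderiv (pderiv (geg a k))) x - (2 * a + 1) * x * poly (pderiv (geg a k)) x =
     - (real k * (real k + 2 * a)) * poly (geg a k) x"
proof (cases k)
  case 0
  then show ?thesis by simp
next
  case (Suc m)
  let ?C = "geg a (Suc m)"
  have "[:1, 0, -1:] * pderiv ?C =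
      smult (real m + 2 * a) (geg a m) - smult (real m + 1) (pCons 0 ?C)"
    by (rule poly_ext) (use geg_pderiv[of _ a m] in \<open>simp add: algebra_simps power2_eq_square\<close>)
  then have "pderiv ([:1, 0, -1:] * pderiv ?C) =
      pderiv (smult (real m + 2 * a) (geg a m) - smult (real m + 1) (pCons 0 ?C))"
    by simp
  then have "poly (pderiv ([:1, 0, -1:] * pderiv ?C)) x =
      poly (pderiv (smult (real m + 2 * a) (geg a m) - smult (real m + 1) (pCons 0 ?C))) x"
    by simp
  then have "(1 - x\<^sup>2) * poly (pderiv (pderiv ?C)) x - 2 * x * poly (pderiv ?C) x =
      (real m + 2 * a) * poly (pderiv (geg a m)) x -
      (real m + 1) * (poly ?C x + x * poly (pderiv ?C) x)"
    unfolding pderiv_mult by (simp add: pderiv_smult pderiv_diff pderiv_pCons)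
      (simp add: algebra_simps power2_eq_square)
  then show ?thesis
    unfolding geg_pderiv_diff[of a m] Suc by (simp add: algebra_simps)
qed

section \<open>Orthogonality and norms of the Gegenbauer polynomials\<close>

locale gegenbauer_weight =
  fixes \<mu> :: real
  assumes mu: "\<mu> \<ge> 0"
begin

definition wint :: "real poly \<Rightarrow> real" where
  "wint q = (LINT t:{-1..1}|lebesgue. poly q t * (1 - t\<^sup>2) powr \<mu>)"

lemma weight_integrable: "set_integrable lebesgue {-1..1} (\<lambda>t. (1 - t\<^sup>2) powr \<mu>)"
proof -
  have "set_integrable lebesgue {-1..1} (\<lambda>t::real. 1 :: real)"
    by (simp add: absolutely_integrable_on_const lmeasurable_cbox)
  then have "set_integrable lebesgue {-1..1} (\<lambda>t. (1 - t\<^sup>2) powr \<mu> * 1)"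
  proof (rule set_integrable_bounded_mult)
    show "\<bar>(1 - t\<^sup>2) powr \<mu>\<bar> \<le> 1" if "t \<in> {-1..1}" for t
      using that mu powr_mono2[of \<mu> "1 - t\<^sup>2" 1] by (simp add: abs_square_le_1 abs_le_iff)
  qed measurable
  then show ?thesis by simp
qed

lemma positive_functional_wint: "positive_functional wint"
proof -
  have "t\<^sup>2 \<noteq> 1" if "-1 < t" "t < 1" for t :: real
    using that by (auto simp: power2_eq_1_iff)
  then show ?thesis
    unfolding wint_def[abs_def] by (intro positive_functional_weight weight_integrable) auto
qed

sublocale positive_functional wint
  by (rule positive_functional_wint)

text \<open>The integrand is the derivative of (1 - t^2)^(\<mu>+1) f(t), which vanishes at both
  endpoints.\<close>

lemma wint_divergence:
  "wint ([:1, 0, -1:] * pderiv f - smult (2 * \<mu> + 2) (pCons 0 f)) = 0"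
proof -
  let ?g = "[:1, 0, -1:] * pderiv f - smult (2 * \<mu> + 2) (pCons 0 f)"
  have "((\<lambda>t. poly ?g t * (1 - t\<^sup>2) powr \<mu>) has_integral
      (1 - 1\<^sup>2) powr (\<mu> + 1) * poly f 1 - (1 - (-1)\<^sup>2) powr (\<mu> + 1) * poly f (-1)) {-1..1}"
  proof (rule fundamental_theorem_of_calculus_interior)
    show "continuous_on {-1..1} (\<lambda>t. (1 - t\<^sup>2) powr (\<mu> + 1) * poly f t)"
      using mu by (intro continuous_intros continuous_on_powr') (auto simp: abs_square_le_1)
    show "((\<lambda>t. (1 - t\<^sup>2) powr (\<mu> + 1) * poly f t) has_vector_derivative
        poly ?g t * (1 - t\<^sup>2) powr \<mu>) (at t)" if "t \<in> {-1<..<1}" for t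
    proof -
      have t: "1 - t\<^sup>2 > 0"
        using that by (simp add: abs_square_less_1 abs_less_iff)
      have "((\<lambda>t. (1 - t\<^sup>2) powr (\<mu> + 1)) has_real_derivative
          (\<mu> + 1) * (1 - t\<^sup>2) powr \<mu> * (- 2 * t)) (at t)"
        using t by (auto intro!: derivative_eq_intros)
      from DERIV_mult[OF this poly_DERIV[of f t]]
      have "((\<lambda>t. (1 - t\<^sup>2) powr (\<mu> + 1) * poly f t) has_real_derivative
          (\<mu> + 1) * (1 - t\<^sup>2) powr \<mu> * (- 2 * t) * poly f t +
          poly (pderiv f) t * (1 - t\<^sup>2) powr (\<mu> + 1)) (at t)" .
      moreover have "(1 - t\<^sup>2) powr (\<mu> + 1) = (1 - t\<^sup>2) powr \<mu> * (1 - t\<^sup>2)"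
        using t by (simp add: powr_add)
      then have "(\<mu> + 1) * (1 - t\<^sup>2) powr \<mu> * (- 2 * t) * poly f t +
          poly (pderiv f) t * (1 - t\<^sup>2) powr (\<mu> + 1) = poly ?g t * (1 - t\<^sup>2) powr \<mu>"
        by (simp only:) (simp add: algebra_simps power2_eq_square)
      ultimately show ?thesis
        unfolding has_real_derivative_iff_has_vector_derivative[symmetric] by (simp only:)
    qed
  qed auto
  moreover have int: "set_integrable lebesgue {-1..1} (\<lambda>t. poly ?g t * (1 - t\<^sup>2) powr \<mu>)"
    by (intro set_integrable_continuous_mult weight_integrable continuous_intros) simp
  ultimately show ?thesis
    unfolding wint_def set_lebesgue_integral_eq_integral(2)[OF int]
    by (simp add: integral_unique)
qed

text \<open>Integration by parts. \<open>A\<close> is the Gegenbauer operator, and the right-hand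
  side is symmetric in \<open>p\<close> and \<open>q\<close>, so \<open>A\<close> is self-adjoint
  for \<open>wint\<close>.\<close>

lemma wint_symmetric:
  defines "A \<equiv> (\<lambda>p. [:1, 0, -1:] * pderiv (pderiv p) - smult (2 * \<mu> + 2) (pCons 0 (pderiv p)))"
  shows "wint (A p * q) = - wint ([:1, 0, -1:] * pderiv p * pderiv q)"
proof -
  let ?X = "[:1, 0, -1:] * pderiv (pderiv p * q) - smult (2 * \<mu> + 2) (pCons 0 (pderiv p * q))"
  have "A p * q = ?X - [:1, 0, -1:] * pderiv p * pderiv q"
    by (rule poly_ext) (simp add: A_def pderiv_mult algebra_simps)
  then have "wint (A p * q) = wint ?X - wint ([:1, 0, -1:] * pderiv p * pderiv q)"
    by (simp only: diff[of ?X])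
  then show ?thesis
    by (simp only: wint_divergence diff_0)
qed

definition C :: "nat \<Rightarrow> real poly" where "C k = geg (\<mu> + 1/2) k"

text \<open>Eigenfunctions of a symmetric operator for different eigenvalues. The eigenvalues differ
  by (m - n)(m + n + 2 \<mu> + 1) up to sign, and the second factor is positive.\<close>

lemma C_orthogonal:
  assumes "m \<noteq> n"
  shows "wint (C m * C n) = 0"
proof -
  have eig: "[:1, 0, -1:] * pderiv (pderiv (C k)) - smult (2 * \<mu> + 2) (pCons 0 (pderiv (C k))) =
      smult (- (real k * (real k + 2 * \<mu> + 1))) (C k)" for k
    by (rule poly_ext) (use geg_ode[of _ "\<mu> + 1/2" k] in \<open>simp add: C_def algebra_simps power2_eq_square\<close>)
  have sym: "wint (smult (- (real m * (real m + 2 * \<mu> + 1))) (C m) * C n) =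
      wint (smult (- (real n * (real n + 2 * \<mu> + 1))) (C n) * C m)"
    using wint_symmetric[of "C m" "C n"] wint_symmetric[of "C n" "C m"]
    unfolding eig by (simp only: mult_ac)
  have "- (real m * (real m + 2 * \<mu> + 1)) * wint (C m * C n) =
      - (real n * (real n + 2 * \<mu> + 1)) * wint (C m * C n)"
    using sym by (simp only: mult_smult_left smult mult.commute[of "C n"])
  then have "(real m * (real m + 2 * \<mu> + 1) - real n * (real n + 2 * \<mu> + 1)) * wint (C m * C n) = 0"
    by (simp only: left_diff_distrib) simp
  moreover have "real m * (real m + 2 * \<mu> + 1) - real n * (real n + 2 * \<mu> + 1) =
      (real m - real n) * (real m + real n + 2 * \<mu> + 1)"
    by (simp add: algebra_simps)
  moreover have "real m + real n + 2 * \<mu> + 1 > 0"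
    using mu by (simp add: add_nonneg_pos)
  ultimately show ?thesis
    using assms by simp
qed

lemma C_degree: "degree (C k) = k" and C_nonzero: "C k \<noteq> 0"
  using geg_degree[of "\<mu> + 1/2" k] mu by (auto simp: C_def)

lemma C_one: "poly (C k) 1 = pochhammer (2 * \<mu> + 1) k / fact k"
  using geg_one[of "\<mu> + 1/2" k] mu by (simp add: C_def algebra_simps)

lemma C_one_pos: "0 < poly (C k) 1"
  unfolding C_one using mu by (intro divide_pos_pos pochhammer_pos) auto

lemma C_lower:
  assumes "\<forall>i\<ge>k. coeff r i = 0"
  shows "wint (C k * r) = 0"
  by (rule orthogonal_lower[of k "C k" C]) (use assms C_orthogonal C_degree C_nonzero in auto)

text \<open>Orthogonality leaves one free factor in each degree, and the value at 1, which is
  positive for \<open>C\<close>, fixes it; so \<open>C\<close> is the only sequence that meets the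
  definite description.\<close>

lemma gegenbauer_eq: "gegenbauer (\<mu> + 1/2) = C"
proof -
  define is_geg where "is_geg q \<longleftrightarrow>
    orthogonal_polys {-1..1} (\<lambda>s. (1 - s\<^sup>2) powr (\<mu> + 1/2 - 1/2)) q \<and>
    (\<forall>k. poly (q k) 1 = pochhammer (2 * (\<mu> + 1/2)) k / fact k)" for q
  have is_geg: "is_geg q \<longleftrightarrow> (\<forall>k. degree (q k) = k) \<and>
      (\<forall>k l. k \<noteq> l \<longrightarrow> wint (q k * q l) = 0) \<and> (\<forall>k. poly (q k) 1 = poly (C k) 1)" for q
    by (simp add: is_geg_def orthogonal_polys_def wint_def C_one)
  have C: "is_geg C"
    unfolding is_geg using C_orthogonal C_degree by simp
  have unique: "q = C" if q: "is_geg q" for q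
  proof (rule ext)
    fix k
    have deg: "degree (q i) = i" and one: "poly (q i) 1 = poly (C i) 1"
      and orth: "i \<noteq> j \<Longrightarrow> wint (q i * q j) = 0" for i j
      using q unfolding is_geg by blast+
    have nz: "q i \<noteq> 0" for i
      using one[of i] C_one_pos[of i] by (metis less_irrefl poly_0)
    have low: "wint (q k * r) = 0" if "\<forall>i\<ge>k. coeff r i = 0" for r
      by (rule orthogonal_lower[OF orth _ that]) (simp_all add: deg nz)
    define c where "c = coeff (q k) k / lead_coeff (C k)"
    have eq: "q k = smult c (C k)"
      unfolding c_def
      by (rule orthogonal_unique[OF C_lower C_degree C_nonzero low]) (simp_all add: deg)
    then have "(c - 1) * poly (C k) 1 = 0"
      using one[of k] by (simp add: left_diff_distrib)
    then have "c = 1"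
      using C_one_pos[of k] by simp
    with eq show "q k = C k" by simp
  qed
  have "gegenbauer (\<mu> + 1/2) = (THE q. is_geg q)"
    by (simp add: gegenbauer_def is_geg_def)
  also have "\<dots> = C"
    using C unique by (rule the_equality)
  finally show ?thesis .
qed

text \<open>\<open>J\<close> links neighbouring square norms: the recurrence for degree k + 2 tested
  against \<open>C k\<close> expresses it by the norm of \<open>C k\<close>, the one for degree k +
  1 tested against \<open>C (Suc k)\<close> by the norm of \<open>C (Suc k)\<close>. The ratio to
  the value at 1 is the source of the factor in \<open>D_kernel\<close>.\<close>

lemma C_norm:
  "(real k + \<mu> + 1/2) * wint (C k * C k) = (\<mu> + 1/2) * poly (C k) 1 * wint 1"
proof (induction k)
  case 0
  then show ?case by (simp add: C_def)
next
  case (Suc k)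
  define a where "a = \<mu> + 1/2"
  define J where "J = wint (pCons 0 (C k) * C (Suc k))"
  have a: "a > 0" using mu by (simp add: a_def)
  have rec: "smult (real k + 2) (C (Suc (Suc k))) =
      smult (2 * (real k + 1 + a)) (pCons 0 (C (Suc k))) - smult (real k + 2 * a) (C k)" for k
    by (rule poly_ext) (simp add: C_def geg_rec a_def)
  have "wint (smult (real k + 2) (C (Suc (Suc k))) * C k) = 0"
    by (simp add: smult C_orthogonal)
  then have "2 * (real k + 1 + a) * wint (pCons 0 (C (Suc k)) * C k) =
      (real k + 2 * a) * wint (C k * C k)"
    unfolding rec left_diff_distrib by (simp only: mult_smult_left diff smult right_minus_eq)
  moreover have "pCons 0 (C (Suc k)) * C k = pCons 0 (C k) * C (Suc k)"
    by (rule poly_ext) (simp add: mult_ac)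
  ultimately have 1: "2 * (real k + 1 + a) * J = (real k + 2 * a) * wint (C k * C k)"
    unfolding J_def by (simp only:)
  have 2: "(real k + 1) * wint (C (Suc k) * C (Suc k)) = 2 * (real k + a) * J"
  proof (cases k)
    case 0
    have "C (Suc 0) * C (Suc 0) = smult (2 * a) (pCons 0 (C 0) * C (Suc 0))"
      by (rule poly_ext) (simp add: C_def a_def)
    then show ?thesis
      unfolding 0 J_def by (simp only: smult) (simp add: C_def)
  next
    case (Suc m)
    have "wint (smult (real m + 2) (C (Suc (Suc m))) * C (Suc (Suc m))) =
        2 * (real m + 1 + a) * J - (real m + 2 * a) * wint (C m * C (Suc (Suc m)))"
      unfolding rec left_diff_distrib J_def Suc by (simp only: mult_smult_left diff smult)
    then show ?thesis
      using C_orthogonal[of m "Suc (Suc m)"] by (simp add: smult Suc algebra_simps)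
  qed
  have 3: "(real k + 1) * poly (C (Suc k)) 1 = (real k + 2 * a) * poly (C k) 1"
    unfolding C_one by (simp add: pochhammer_Suc a_def field_simps del: of_nat_Suc) (simp add: algebra_simps)
  have IH: "(real k + a) * wint (C k * C k) = a * poly (C k) 1 * wint 1"
    using Suc.IH by (simp add: a_def algebra_simps)
  have "(real k + 1) * ((real k + 1 + a) * wint (C (Suc k) * C (Suc k))) =
      (real k + 1) * (a * poly (C (Suc k)) 1 * wint 1)"
    using 1 2 3 IH by algebra
  then have "(real k + 1 + a) * wint (C (Suc k) * C (Suc k)) = a * poly (C (Suc k)) 1 * wint 1"
    by simp
  then show ?case by (simp add: a_def algebra_simps)
qed

end


subsection \<open>Jacobi polynomials\<close>

definition jacobi_integral :: "real \<Rightarrow> real \<Rightarrow> real poly \<Rightarrow> real" where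
  "jacobi_integral \<alpha> \<beta> q =
     (LINT t:{-1..1}|lebesgue. poly q t * ((1 - t) powr \<alpha> * (1 + t) powr \<beta>))"

lemma jacobi_weight_integrable:
  assumes "\<alpha> > -1" "\<beta> \<ge> 0"
  shows "set_integrable lebesgue {-1..1} (\<lambda>t::real. (1 - t) powr \<alpha> * (1 + t) powr \<beta>)"
proof -
  have "set_integrable lebesgue {-1..1} (\<lambda>t::real. (1 + t) powr \<beta> * (1 - t) powr \<alpha>)"
  proof (rule set_integrable_bounded_mult[OF integral_one_minus_powr(1)[OF assms(1)]])
    show "\<bar>(1 + t) powr \<beta>\<bar> \<le> 2 powr \<beta>" if "t \<in> {-1..1}" for t
      using that assms(2) by (auto intro!: powr_mono2)
  qed measurable
  then show ?thesis by (simp add: mult.commute)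
qed

lemma positive_functional_jacobi:
  assumes "\<alpha> > -1" "\<beta> \<ge> 0"
  shows "positive_functional (jacobi_integral \<alpha> \<beta>)"
  unfolding jacobi_integral_def[abs_def]
  by (rule positive_functional_weight[OF jacobi_weight_integrable[OF assms]]) auto

text \<open>The definite description is matched with the functional divided by the mass
  \<open>c\<close> of the weight. Orthogonality is then stated for the plain integral, since the
  positive factor 1/c drops out.\<close>

lemma jacobi_orthonormal:
  fixes \<alpha> \<beta> :: real
  assumes "\<alpha> > -1" "\<beta> \<ge> 0"
  shows "degree (jacobi \<alpha> \<beta> k) = k" and "jacobi \<alpha> \<beta> k \<noteq> 0"
    and "k \<noteq> l \<Longrightarrow> jacobi_integral \<alpha> \<beta> (jacobi \<alpha> \<beta> k * jacobi \<alpha> \<beta> l) = 0"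
proof -
  interpret J: positive_functional "jacobi_integral \<alpha> \<beta>"
    using assms by (rule positive_functional_jacobi)
  define c where "c = jacobi_integral \<alpha> \<beta> 1"
  have c: "c > 0"
    using J.pos[of 1] by (simp add: c_def)
  interpret positive_functional "\<lambda>q. 1 / c * jacobi_integral \<alpha> \<beta> q"
    using c by (intro positive_functional_cmult positive_functional_jacobi assms) simp
  have "(LINT z:{-1..1}|lebesgue. poly p z * poly q z * jacobi_weight \<alpha> \<beta> z) =
      1 / c * jacobi_integral \<alpha> \<beta> (p * q)" for p q
  proof -
    have "(LINT z:{-1..1}|lebesgue. poly p z * poly q z * jacobi_weight \<alpha> \<beta> z) =
        (LINT z:{-1..1}|lebesgue.
          1 / c * (poly (p * q) z * ((1 - z) powr \<alpha> * (1 + z) powr \<beta>)))"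
      by (simp add: jacobi_weight_def c_def jacobi_integral_def)
    then show ?thesis
      by (simp only: set_integral_mult_right jacobi_integral_def)
  qed
  then have eq: "jacobi \<alpha> \<beta> = (THE p. (\<forall>k. degree (p k) = k) \<and>
      (\<forall>k l. 1 / c * jacobi_integral \<alpha> \<beta> (p k * p l) = (if k = l then 1 else 0)) \<and>
      (\<forall>l. 0 < lead_coeff (p l)))"
    unfolding jacobi_def orthonormal_polys_def by (simp only: conj_assoc)
  have J: "(\<forall>k. degree (jacobi \<alpha> \<beta> k) = k) \<and>
      (\<forall>k l. 1 / c * jacobi_integral \<alpha> \<beta> (jacobi \<alpha> \<beta> k * jacobi \<alpha> \<beta> l) =
        (if k = l then 1 else 0)) \<and>
      (\<forall>l. 0 < lead_coeff (jacobi \<alpha> \<beta> l))"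
    unfolding eq by (rule theI'[OF orthonormal_exists_unique])
  then show "degree (jacobi \<alpha> \<beta> k) = k"
    by blast
  have "0 < lead_coeff (jacobi \<alpha> \<beta> k)"
    using J by blast
  then show "jacobi \<alpha> \<beta> k \<noteq> 0"
    by (metis leading_coeff_0_iff less_irrefl)
  assume "k \<noteq> l"
  then have "1 / c * jacobi_integral \<alpha> \<beta> (jacobi \<alpha> \<beta> k * jacobi \<alpha> \<beta> l) = 0"
    using J by presburger
  then show "jacobi_integral \<alpha> \<beta> (jacobi \<alpha> \<beta> k * jacobi \<alpha> \<beta> l) = 0"
    using c by simp
qed

lemma jacobi_lower:
  fixes \<alpha> \<beta> :: real
  assumes "\<alpha> > -1" "\<beta> \<ge> 0" and r: "\<forall>i\<ge>k. coeff r i = 0"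
  shows "jacobi_integral \<alpha> \<beta> (jacobi \<alpha> \<beta> k * r) = 0"
proof -
  interpret positive_functional "jacobi_integral \<alpha> \<beta>"
    using assms(1,2) by (rule positive_functional_jacobi)
  show ?thesis
    by (rule orthogonal_lower[OF _ _ r, where p = "jacobi \<alpha> \<beta>"])
      (simp_all add: jacobi_orthonormal[OF assms(1,2)])
qed

text \<open>
  If \<open>1\<close> were a zero, integrating the polynomial against its quotient by \<open>t - 1\<close> would
  contradict orthogonality.
\<close>

lemma jacobi_one_nonzero:
  fixes \<alpha> \<beta> :: real
  assumes "\<alpha> > -1" "\<beta> \<ge> 0"
  shows "poly (jacobi \<alpha> \<beta> k) 1 \<noteq> 0"
proof
  assume "poly (jacobi \<alpha> \<beta> k) 1 = 0"
  then obtain q where q: "jacobi \<alpha> \<beta> k = [:-1, 1:] * q"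
    by (auto simp: poly_eq_0_iff_dvd elim: dvdE)
  have "q \<noteq> 0"
    using q jacobi_orthonormal(2)[OF assms, of k] by auto
  have "degree ([:-1, 1:] * q) = Suc (degree q)"
    using \<open>q \<noteq> 0\<close> by (subst degree_mult_eq) auto
  then have "degree q < k"
    using q jacobi_orthonormal(1)[OF assms, of k] by simp
  then have "jacobi_integral \<alpha> \<beta> (jacobi \<alpha> \<beta> k * q) = 0"
    by (intro jacobi_lower assms) (auto simp: coeff_eq_0)
  moreover have "0 < jacobi_integral (\<alpha> + 1) \<beta> (q * q)"
    using positive_functional.pos[OF positive_functional_jacobi \<open>q \<noteq> 0\<close>] assms by simp
  \<comment> \<open>The weight absorbs the factor \<open>t - 1\<close> up to sign: \<alpha> becomes
    \<alpha> + 1 and a square remains.\<close>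
  moreover have "jacobi_integral \<alpha> \<beta> (jacobi \<alpha> \<beta> k * q) = - jacobi_integral (\<alpha> + 1) \<beta> (q * q)"
  proof -
    have "jacobi_integral (\<alpha> + 1) \<beta> (q * q) = (LINT t:{-1..1}|lebesgue.
        (-1) * (poly (jacobi \<alpha> \<beta> k * q) t * ((1 - t) powr \<alpha> * (1 + t) powr \<beta>)))"
      unfolding jacobi_integral_def
    proof (rule set_lebesgue_integral_cong)
      show "\<forall>t. t \<in> {-1..1} \<longrightarrow> poly (q * q) t * ((1 - t) powr (\<alpha> + 1) * (1 + t) powr \<beta>) =
          (-1) * (poly (jacobi \<alpha> \<beta> k * q) t * ((1 - t) powr \<alpha> * (1 + t) powr \<beta>))"
      proof (intro allI impI)
        fix t :: real assume t: "t \<in> {-1..1}"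
        have "(1 - t) powr (\<alpha> + 1) = (1 - t) powr \<alpha> * (1 - t)"
          using t by (cases "t = 1") (simp_all add: powr_add)
        then show "poly (q * q) t * ((1 - t) powr (\<alpha> + 1) * (1 + t) powr \<beta>) =
            (-1) * (poly (jacobi \<alpha> \<beta> k * q) t * ((1 - t) powr \<alpha> * (1 + t) powr \<beta>))"
          unfolding q by (simp only:) (simp add: algebra_simps)
      qed
    qed simp
    then show ?thesis
      by (simp only: set_integral_mult_right jacobi_integral_def)
  qed
  ultimately show False by simp
qed


subsection \<open>Radial functions on the disk\<close>

lemma disk_eq_cball: "disk = cball 0 1"
  by (auto simp: disk_def norm_Pair dist_norm abs_square_le_1)

lemma disk_sets [measurable]: "disk \<in> sets borel" and compact_disk: "compact disk"
  by (simp_all add: disk_eq_cball)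

text \<open>This takes the place of polar coordinates. A disk of radius r has area pi r^2, so r^2 is
  uniformly distributed over the unit disk. The form 2 r^2 - 1 is the argument of the Jacobi
  polynomials, and pi/2 is the area pi over the length 2.\<close>

lemma distr_disk_radial:
  "distr (density lborel (\<lambda>v. ennreal (indicator disk v))) borel (\<lambda>(x, y). 2 * (x\<^sup>2 + y\<^sup>2) - 1) =
   density lborel (\<lambda>t::real. ennreal (pi / 2 * indicator {-1..1} t))"
  (is "?M = ?N")
proof (rule measure_eqI_lessThan)
  have R[measurable]: "(\<lambda>(x, y). 2 * (x\<^sup>2 + y\<^sup>2) - 1) \<in> borel_measurable (borel :: (real \<times> real) measure)"
    unfolding case_prod_unfold by (intro borel_measurable_continuous_onI continuous_intros)
  have cball: "emeasure lborel (cball (0 :: real \<times> real) r) = ennreal (pi * r\<^sup>2)" if "r \<ge> 0" for r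
    using emeasure_cball[OF that, of "0 :: real \<times> real"] by (simp add: unit_ball_vol_2 power2_eq_square)
  have N: "emeasure ?N {x<..} = ennreal (pi / 2 * (if x < -1 then 2 else if x \<le> 1 then 1 - x else 0))"
    for x
  proof -
    have "emeasure ?N {x<..} =
        (\<integral>\<^sup>+ t. ennreal (pi / 2) * indicator ({-1..1} \<inter> {x<..}) t \<partial>lborel)"
      by (subst emeasure_density) (auto intro!: nn_integral_cong simp: indicator_def)
    also have "\<dots> = ennreal (pi / 2) * emeasure lborel ({-1..1} \<inter> {x<..})"
      by (subst nn_integral_cmult_indicator) auto
    also have "{-1..1} \<inter> {x<..} = (if x < -1 then {-1..1} else {x<..1})"
      by auto
    also have "emeasure lborel (if x < -1 then {-1..1} else {x<..1}) =
        ennreal (if x < -1 then 2 else if x \<le> 1 then 1 - x else 0)"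
      by auto
    finally show ?thesis
      by (subst ennreal_mult) auto
  qed
  have "emeasure ?M {x<..} = emeasure lborel (disk \<inter> {v. x < (case v of (x, y) \<Rightarrow> 2 * (x\<^sup>2 + y\<^sup>2) - 1)})"
    for x
  proof -
    let ?A = "{v. x < (case v of (x, y) \<Rightarrow> 2 * (x\<^sup>2 + y\<^sup>2) - 1)}"
    have A: "?A \<in> sets (borel :: (real \<times> real) measure)"
      by measurable
    have "emeasure ?M {x<..} = emeasure (density lborel (\<lambda>v. ennreal (indicator disk v))) ?A"
      using R by (subst emeasure_distr) (auto simp: vimage_def)
    also have "\<dots> = (\<integral>\<^sup>+ v. ennreal (indicator disk v) * indicator ?A v \<partial>lborel)"
      using A by (intro emeasure_density) simp_all
    also have "\<dots> = (\<integral>\<^sup>+ v. indicator (disk \<inter> ?A) v \<partial>lborel)"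
      by (intro nn_integral_cong) (simp add: indicator_def)
    also have "\<dots> = emeasure lborel (disk \<inter> ?A)"
      using sets.Int[OF disk_sets A] by (intro nn_integral_indicator) (simp only: sets_lborel)
    finally show ?thesis .
  qed
  also have "emeasure lborel (disk \<inter> {v. x < (case v of (x, y) \<Rightarrow> 2 * (x\<^sup>2 + y\<^sup>2) - 1)}) =
      ennreal (pi / 2 * (if x < -1 then 2 else if x \<le> 1 then 1 - x else 0))" (is "emeasure _ ?B = _") for x
  proof -
    consider "x < -1" | "-1 \<le> x" "x \<le> 1" | "x > 1" by linarith
    then show ?thesis
    proof cases
      case 1
      have "a < 2 * (b\<^sup>2 + c\<^sup>2) - 1" if "a < -1" for a b c :: real
        by (rule less_le_trans[OF that]) simp
      then have "?B = cball 0 1"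
        using 1 by (auto simp: disk_eq_cball)
      then show ?thesis
        using 1 cball[of 1] by simp
    next
      case 2
      let ?r = "sqrt ((x + 1) / 2)"
      have r: "0 \<le> ?r" "?r \<le> 1" "?r\<^sup>2 = (x + 1) / 2"
        using 2 by auto
      have "x < 2 * (a\<^sup>2 + b\<^sup>2) - 1 \<longleftrightarrow> \<not> sqrt (a\<^sup>2 + b\<^sup>2) \<le> ?r" for a b
        by (auto simp: field_simps)
      then have "?B = cball 0 1 - cball 0 ?r"
        by (auto simp: disk_eq_cball norm_Pair dist_norm)
      then have "emeasure lborel ?B = emeasure lborel (cball 0 1 - cball (0 :: real \<times> real) ?r)"
        by (simp only:)
      also have "\<dots> = emeasure lborel (cball (0 :: real \<times> real) 1) - emeasure lborel (cball (0 :: real \<times> real) ?r)"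
        using cball[OF r(1)] by (intro emeasure_Diff subset_cball r(2)) simp_all
      also have "\<dots> = ennreal (pi * 1\<^sup>2) - ennreal (pi * ?r\<^sup>2)"
        using r cball[of 1] cball[of ?r] by simp
      also have "\<dots> = ennreal (pi * 1\<^sup>2 - pi * ?r\<^sup>2)"
        by (rule ennreal_minus) simp
      also have "pi * 1\<^sup>2 - pi * ?r\<^sup>2 = pi / 2 * (1 - x)"
        unfolding r by (simp add: field_simps)
      finally show ?thesis using 2 by simp
    next
      case 3
      have "\<not> x < 2 * (b\<^sup>2 + c\<^sup>2) - 1" if "b\<^sup>2 + c\<^sup>2 \<le> 1" for b c :: real
        using that 3 by simp
      then have "?B = {}"
        by (auto simp: disk_def)
      then have "emeasure lborel ?B = 0"
        by (simp only: emeasure_empty)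
      then show ?thesis
        using 3 by simp
    qed
  qed
  finally have M: "emeasure ?M {x<..} =
    ennreal (pi / 2 * (if x < -1 then 2 else if x \<le> 1 then 1 - x else 0))" for x .
  show "emeasure ?M {x<..} = emeasure ?N {x<..}" "emeasure ?M {x<..} < \<infinity>" for x
    unfolding M N by simp_all
qed simp_all

lemma set_lebesgue_lborel:
  fixes f :: "'a::euclidean_space \<Rightarrow> real"
  assumes "f \<in> borel_measurable borel" "A \<in> sets borel"
  shows "set_integrable lebesgue A f \<longleftrightarrow> integrable lborel (\<lambda>x. indicator A x * f x)"
    and "(LINT x:A|lebesgue. f x) = (LINT x|lborel. indicator A x * f x)"
proof -
  have "(\<lambda>x. indicator A x * f x) \<in> borel_measurable lborel"
    using assms by measurable
  then show "set_integrable lebesgue A f \<longleftrightarrow> integrable lborel (\<lambda>x. indicator A x * f x)"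
    and "(LINT x:A|lebesgue. f x) = (LINT x|lborel. indicator A x * f x)"
    unfolding set_integrable_def set_lebesgue_integral_def real_scaleR_def
    by (simp_all only: integrable_completion integral_completion)
qed

lemma disk_radial:
  fixes g :: "real \<Rightarrow> real"
  assumes [measurable]: "g \<in> borel_measurable borel"
  shows "set_integrable lebesgue disk (\<lambda>(x, y). g (2 * (x\<^sup>2 + y\<^sup>2) - 1)) \<longleftrightarrow>
      set_integrable lebesgue {-1..1} g"
    and "(LINT (x, y):disk|lebesgue. g (2 * (x\<^sup>2 + y\<^sup>2) - 1)) =
      pi / 2 * (LINT t:{-1..1}|lebesgue. g t)"
proof -
  let ?R = "\<lambda>(x, y). 2 * (x\<^sup>2 + y\<^sup>2) - 1 :: real"
  let ?M = "density lborel (\<lambda>v. ennreal (indicator disk v))"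
  let ?N = "density lborel (\<lambda>t::real. ennreal (pi / 2 * indicator {-1..1} t))"
  have R[measurable]: "?R \<in> borel_measurable borel"
    unfolding case_prod_unfold by (intro borel_measurable_continuous_onI continuous_intros)
  have gR[measurable]: "(\<lambda>v. g (?R v)) \<in> borel_measurable borel"
    by measurable
  have eq: "(\<lambda>(x, y). g (2 * (x\<^sup>2 + y\<^sup>2) - 1)) = (\<lambda>v. g (?R v))"
    by (simp add: fun_eq_iff)
  have "set_integrable lebesgue disk (\<lambda>v. g (?R v)) \<longleftrightarrow> integrable ?M (\<lambda>v. g (?R v))"
    using gR by (subst set_lebesgue_lborel(1)[OF gR disk_sets], subst integrable_density) auto
  also have "\<dots> \<longleftrightarrow> integrable (distr ?M borel ?R) g"
    by (rule integrable_distr_eq[symmetric]) measurable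
  also have "\<dots> \<longleftrightarrow> integrable lborel (\<lambda>t. (pi / 2) * (indicator {-1..1} t * g t))"
    unfolding distr_disk_radial by (subst integrable_density) (auto simp: mult.assoc)
  also have "\<dots> \<longleftrightarrow> set_integrable lebesgue {-1..1} g"
    unfolding integrable_mult_left_iff by (subst set_lebesgue_lborel(1)) auto
  finally show "set_integrable lebesgue disk (\<lambda>(x, y). g (2 * (x\<^sup>2 + y\<^sup>2) - 1)) \<longleftrightarrow>
      set_integrable lebesgue {-1..1} g"
    unfolding eq .
  have "(LINT v:disk|lebesgue. g (?R v)) = integral\<^sup>L ?M (\<lambda>v. g (?R v))"
    using gR by (subst set_lebesgue_lborel(2)[OF gR disk_sets], subst integral_density) auto
  also have "\<dots> = integral\<^sup>L (distr ?M borel ?R) g"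
    by (rule integral_distr[symmetric]) measurable
  also have "\<dots> = (LINT t|lborel. (pi / 2) * (indicator {-1..1} t * g t))"
    unfolding distr_disk_radial by (subst integral_density) (auto simp: mult.assoc)
  also have "\<dots> = pi / 2 * (LINT t:{-1..1}|lebesgue. g t)"
    by (subst set_lebesgue_lborel(2)) auto
  finally show "(LINT (x, y):disk|lebesgue. g (2 * (x\<^sup>2 + y\<^sup>2) - 1)) =
      pi / 2 * (LINT t:{-1..1}|lebesgue. g t)"
    unfolding eq .
qed

lemma W_disk_radial:
  "W_disk \<mu> (x, y) = (1/2) powr (\<mu> - 1/2) * (1 - (2 * (x\<^sup>2 + y\<^sup>2) - 1)) powr (\<mu> - 1/2)"
  if "(x, y) \<in> disk"
proof -
  have "1 - x\<^sup>2 - y\<^sup>2 = (1/2) * (1 - (2 * (x\<^sup>2 + y\<^sup>2) - 1))"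
    by (simp add: field_simps)
  moreover have "0 \<le> 1 - (2 * (x\<^sup>2 + y\<^sup>2) - 1)"
    using that by (simp add: disk_def)
  ultimately show ?thesis
    unfolding W_disk_def case_prod_conv by (simp only: powr_mult)
qed

lemma W_disk_borel [measurable]: "W_disk \<mu> \<in> borel_measurable borel"
  unfolding W_disk_def case_prod_unfold borel_prod[symmetric] by measurable

text \<open>The substitution t = 2 r^2 - 1 turns the weight into a multiple of (1 - t)^(\<mu>-1/2).
  The value is the reciprocal of \<open>a_const\<close>.\<close>

lemma W_disk_integrable:
  assumes "\<mu> \<ge> 0"
  shows "set_integrable lebesgue disk (W_disk \<mu>)"
    and "(LINT v:disk|lebesgue. W_disk \<mu> v) = pi / (\<mu> + 1/2)"
proof -
  let ?g = "\<lambda>t::real. (1/2) powr (\<mu> - 1/2) * (1 - t) powr (\<mu> - 1/2)"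
  have m: "?g \<in> borel_measurable borel" by measurable
  have a: "\<mu> - 1/2 > -1" using assms by simp
  have int: "set_integrable lebesgue {-1..1} ?g"
    by (intro set_integrable_mult_right integral_one_minus_powr a)
  have cong: "W_disk \<mu> v = (case v of (x, y) \<Rightarrow> ?g (2 * (x\<^sup>2 + y\<^sup>2) - 1))" if "v \<in> disk" for v
    using that W_disk_radial by (cases v) auto
  have "set_integrable lebesgue disk (\<lambda>(x, y). ?g (2 * (x\<^sup>2 + y\<^sup>2) - 1))"
    using int disk_radial(1)[OF m] by blast
  then show "set_integrable lebesgue disk (W_disk \<mu>)"
    by (subst set_integrable_cong[OF refl refl cong])
  have "(LINT v:disk|lebesgue. W_disk \<mu> v) =
      (LINT (x, y):disk|lebesgue. ?g (2 * (x\<^sup>2 + y\<^sup>2) - 1))"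
    by (intro set_lebesgue_integral_cong) (use cong in auto)
  also have "\<dots> = pi / 2 * (LINT t:{-1..1}|lebesgue. ?g t)"
    by (rule disk_radial(2)[OF m])
  also have "(LINT t:{-1..1}|lebesgue. ?g t) =
      (1/2) powr (\<mu> - 1/2) * (2 powr (\<mu> - 1/2 + 1) / (\<mu> - 1/2 + 1))"
    by (simp only: set_integral_mult_right integral_one_minus_powr(2)[OF a])
  also have "\<dots> = 2 / (\<mu> + 1/2)"
  proof -
    have "(1/2) powr a * 2 powr (a + 1) = (2::real)" for a
      by (simp only: powr_add powr_divide) simp
    from this[of "\<mu> - 1/2"] have "(1/2) powr (\<mu> - 1/2) * 2 powr (\<mu> - 1/2 + 1) = (2::real)" .
    then show ?thesis by simp
  qed
  finally show "(LINT v:disk|lebesgue. W_disk \<mu> v) = pi / (\<mu> + 1/2)"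
    by simp
qed

lemma disk_integrable:
  fixes g :: "real \<times> real \<Rightarrow> real"
  assumes "\<mu> \<ge> 0" "continuous_on UNIV g"
  shows "set_integrable lebesgue disk (\<lambda>v. g v * W_disk \<mu> v)"
  by (intro set_integrable_continuous_mult W_disk_integrable assms compact_disk)

lemma disk_rotation:
  fixes g :: "real \<times> real \<Rightarrow> real"
  assumes "\<mu> \<ge> 0" "continuous_on UNIV g" and cd: "c\<^sup>2 + d\<^sup>2 = (1::real)"
  shows "(LINT (t, s):disk|lebesgue. g (t * c - s * d, t * d + s * c) * W_disk \<mu> (t, s)) =
    (LINT v:disk|lebesgue. g v * W_disk \<mu> v)"
proof -
  have norm: "(t * c - s * d)\<^sup>2 + (t * d + s * c)\<^sup>2 = t\<^sup>2 + s\<^sup>2" for t s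
  proof -
    have "(t * c - s * d)\<^sup>2 + (t * d + s * c)\<^sup>2 = (t\<^sup>2 + s\<^sup>2) * (c\<^sup>2 + d\<^sup>2)"
      by algebra
    then show ?thesis using cd by simp
  qed
  let ?F = "\<lambda>v. indicator disk v * (g v * W_disk \<mu> v)"
  have "integrable lebesgue ?F"
    using disk_integrable[OF assms(1,2)] by (simp only: set_integrable_def real_scaleR_def)
  from lebesgue_rotation(2)[OF cd this]
  have "(LINT (t, s)|lebesgue. ?F (t * c - s * d, t * d + s * c)) = integral\<^sup>L lebesgue ?F" .
  also have "(\<lambda>(t, s). ?F (t * c - s * d, t * d + s * c)) =
      (\<lambda>v. indicator disk v * (case v of (t, s) \<Rightarrow> g (t * c - s * d, t * d + s * c) * W_disk \<mu> (t, s)))"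
    using norm by (auto simp: fun_eq_iff indicator_def disk_def W_disk_def diff_diff_eq)
  finally show ?thesis
    by (simp add: set_lebesgue_integral_def case_prod_unfold)
qed


subsection \<open>Polynomials in two variables\<close>

lemma finite_indices: "finite {(i, j). i + j < (k :: nat)}"
  by (rule finite_subset[of _ "{..<k} \<times> {..<k}"]) auto

lemma polys_below_zero: "(\<lambda>_. 0) \<in> polys_below k"
  unfolding polys_below_def by (auto intro!: exI[of _ "\<lambda>_ _. 0"])

lemma polys_below_add:
  assumes "P \<in> polys_below k" "Q \<in> polys_below k"
  shows "(\<lambda>v. P v + Q v) \<in> polys_below k"
proof -
  from assms obtain c d where
    "P = (\<lambda>(x, y). \<Sum>(i, j) \<in> {(i, j). i + j < k}. c i j * x ^ i * y ^ j)"
    "Q = (\<lambda>(x, y). \<Sum>(i, j) \<in> {(i, j). i + j < k}. d i j * x ^ i * y ^ j)"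
    unfolding polys_below_def by blast
  then show ?thesis
    unfolding polys_below_def
    by (auto intro!: exI[of _ "\<lambda>i j. c i j + d i j"]
        simp: fun_eq_iff sum.distrib[symmetric] algebra_simps case_prod_unfold)
qed

lemma polys_below_scale:
  assumes "P \<in> polys_below k"
  shows "(\<lambda>v. a * P v) \<in> polys_below k"
proof -
  from assms obtain c where
    "P = (\<lambda>(x, y). \<Sum>(i, j) \<in> {(i, j). i + j < k}. c i j * x ^ i * y ^ j)"
    unfolding polys_below_def by blast
  then show ?thesis
    unfolding polys_below_def
    by (auto intro!: exI[of _ "\<lambda>i j. a * c i j"]
        simp: fun_eq_iff sum_distrib_left algebra_simps case_prod_unfold)
qed

lemma polys_below_monomial:
  assumes "a + b < k"
  shows "(\<lambda>(x, y). x ^ a * y ^ b) \<in> polys_below k"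
proof -
  have "(\<Sum>(i, j) \<in> {(i, j). i + j < k}. (if (i, j) = (a, b) then 1 else 0) * x ^ i * y ^ j) =
      x ^ a * y ^ b" for x y :: real
  proof -
    have "(\<Sum>(i, j) \<in> {(i, j). i + j < k}. (if (i, j) = (a, b) then 1 else 0) * x ^ i * y ^ j) =
        (\<Sum>q \<in> {(i, j). i + j < k}. if q = (a, b) then x ^ a * y ^ b else 0)"
      by (intro sum.cong) (auto split: if_splits)
    also have "\<dots> = x ^ a * y ^ b"
      using assms by (subst sum.delta[OF finite_indices]) auto
    finally show ?thesis .
  qed
  then show ?thesis
    unfolding polys_below_def
    by (auto intro!: exI[of _ "\<lambda>i j. if (i, j) = (a, b) then 1 else 0"] simp: fun_eq_iff)
qed

text \<open>A linear property need only be followed through the addition of one monomial.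
  \<open>F\<close> is kept in \<open>polys_below k\<close>, so that its continuity is at hand when
  integrals are added.\<close>

lemma polys_below_induct [consumes 1, case_names zero add]:
  assumes P: "P \<in> polys_below k"
    and zero: "R (\<lambda>_. 0)"
    and add: "\<And>F c i j. F \<in> polys_below k \<Longrightarrow> R F \<Longrightarrow> i + j < k \<Longrightarrow>
      R (\<lambda>v. F v + c * (fst v ^ i * snd v ^ j))"
  shows "R P"
proof -
  from P obtain c where c:
    "P = (\<lambda>(x, y). \<Sum>(i, j) \<in> {(i, j). i + j < k}. c i j * x ^ i * y ^ j)"
    unfolding polys_below_def by blast
  let ?F = "\<lambda>A (v :: real \<times> real). \<Sum>(i, j)\<in>A. c i j * (fst v ^ i * snd v ^ j)"
  have "R (?F A) \<and> ?F A \<in> polys_below k" if "finite A" "A \<subseteq> {(i, j). i + j < k}" for A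
    using that
  proof (induction A rule: finite_induct)
    case empty
    then show ?case by (simp add: zero polys_below_zero)
  next
    case (insert q A)
    obtain a b where q: "q = (a, b)" by (cases q)
    have ab: "a + b < k" using insert q by auto
    have eq: "?F (insert q A) = (\<lambda>v. ?F A v + c a b * (fst v ^ a * snd v ^ b))"
      using insert by (simp add: q add.commute)
    have "(\<lambda>v. c a b * (fst v ^ a * snd v ^ b)) \<in> polys_below k"
      using polys_below_scale[OF polys_below_monomial[OF ab], of "c a b"]
      by (simp add: case_prod_unfold)
    then show ?case
      unfolding eq using insert ab by (auto intro!: add polys_below_add)
  qed
  from this[OF finite_indices[of k]] have "R (?F {(i, j). i + j < k})"
    by blast
  also have "?F {(i, j). i + j < k} = P"
    by (simp add: c fun_eq_iff case_prod_unfold mult.assoc)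
  finally show ?thesis .
qed

lemma polys_below_sum:
  assumes "\<And>i. i \<in> A \<Longrightarrow> P i \<in> polys_below k"
  shows "(\<lambda>v. \<Sum>i\<in>A. P i v) \<in> polys_below k"
  using assms
  by (induction A rule: infinite_finite_induct)
    (simp_all add: polys_below_zero polys_below_add)

lemma polys_below_mono:
  assumes "P \<in> polys_below k" "k \<le> l"
  shows "P \<in> polys_below l"
  using assms(1)
proof (induction rule: polys_below_induct)
  case zero
  show ?case by (rule polys_below_zero)
next
  case (add F c i j)
  then show ?case
    using assms(2) polys_below_monomial[of i j l]
    by (auto intro!: polys_below_add polys_below_scale simp: case_prod_unfold)
qed

lemma polys_below_const: "(\<lambda>_. c) \<in> polys_below (Suc k)"
  using polys_below_scale[OF polys_below_monomial[of 0 0 "Suc k"], of c] by (simp add: case_prod_unfold)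

lemma polys_below_mult:
  assumes "P \<in> polys_below (Suc a)" "Q \<in> polys_below (Suc b)"
  shows "(\<lambda>v. P v * Q v) \<in> polys_below (Suc (a + b))"
  using assms(1)
proof (induction rule: polys_below_induct)
  case zero
  show ?case by (simp add: polys_below_zero)
next
  case (add F c i j)
  have "(\<lambda>v. c * (fst v ^ i * snd v ^ j) * Q v) \<in> polys_below (Suc (a + b))"
    using assms(2)
  proof (induction rule: polys_below_induct)
    case zero
    show ?case by (simp add: polys_below_zero)
  next
    case (add G d k l)
    have "(\<lambda>v. c * d * (fst v ^ (i + k) * snd v ^ (j + l))) \<in> polys_below (Suc (a + b))"
      using add \<open>i + j < Suc a\<close> polys_below_monomial[of "i + k" "j + l" "Suc (a + b)"]
      by (auto intro!: polys_below_scale simp: case_prod_unfold)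
    from polys_below_add[OF add.IH this] show ?case
      by (simp add: algebra_simps power_add)
  qed
  from polys_below_add[OF add.IH this] show ?case
    by (simp add: algebra_simps)
qed

lemma polys_below_power:
  assumes "P \<in> polys_below (Suc a)"
  shows "(\<lambda>v. P v ^ n) \<in> polys_below (Suc (n * a))"
proof (induction n)
  case 0
  then show ?case using polys_below_const[of 1 0] by simp
next
  case (Suc n)
  from polys_below_mult[OF assms Suc] show ?case by simp
qed

lemma polys_below_poly:
  assumes "P \<in> polys_below (Suc a)"
  shows "(\<lambda>v. poly q (P v)) \<in> polys_below (Suc (degree q * a))"
proof -
  have "(\<lambda>v. coeff q i * P v ^ i) \<in> polys_below (Suc (degree q * a))" if "i \<le> degree q" for i
    using that by (intro polys_below_scale polys_below_mono[OF polys_below_power[OF assms]]) simp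
  then show ?thesis
    unfolding poly_altdef by (intro polys_below_sum) simp
qed

lemma polys_below_linear: "(\<lambda>v. a * fst v + b * snd v) \<in> polys_below (Suc 1)"
  using polys_below_monomial[of 1 0 "Suc 1"] polys_below_monomial[of 0 1 "Suc 1"]
  by (intro polys_below_add polys_below_scale) (simp_all add: case_prod_unfold)

lemma polys_below_rotation:
  assumes "P \<in> polys_below k"
  shows "(\<lambda>(t, s). P (t * c - s * d, t * d + s * c)) \<in> polys_below k"
  using assms
proof (induction rule: polys_below_induct)
  case zero
  show ?case by (simp add: polys_below_zero)
next
  case (add F a i j)
  have lin: "(\<lambda>v. fst v * c - snd v * d) \<in> polys_below (Suc 1)" "(\<lambda>v. fst v * d + snd v * c) \<in> polys_below (Suc 1)"
    using polys_below_linear[of c "- d"] polys_below_linear[of d c] by (simp_all add: mult.commute)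
  have "(\<lambda>v. (fst v * c - snd v * d) ^ i * (fst v * d + snd v * c) ^ j) \<in> polys_below (Suc (i * 1 + j * 1))"
    by (intro polys_below_mult polys_below_power lin)
  then have "(\<lambda>v. (fst v * c - snd v * d) ^ i * (fst v * d + snd v * c) ^ j) \<in> polys_below k"
    by (rule polys_below_mono) (use add in simp)
  from polys_below_add[OF add.IH polys_below_scale[OF this, of a]] show ?case
    by (simp add: case_prod_unfold)
qed

lemma polys_below_continuous:
  assumes "P \<in> polys_below k"
  shows "continuous_on A P"
  using assms
  by (induction rule: polys_below_induct) (auto intro!: continuous_intros)

text \<open>On a line through the origin a polynomial becomes univariate with the same degree bound.
  This serves to show that certain elements of \<open>V_space\<close> have degree exactly
  \<open>k\<close>: one direction with a nonzero coefficient at \<open>k\<close> is enough.\<close>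

lemma polys_below_ray:
  assumes "P \<in> polys_below k"
  obtains q where "\<forall>i\<ge>k. coeff q i = 0" "\<And>r. P (r * c, r * d) = poly q r"
proof -
  have "\<exists>q. (\<forall>i\<ge>k. coeff q i = 0) \<and> (\<forall>r. P (r * c, r * d) = poly q r)"
    using assms
  proof (induction rule: polys_below_induct)
    case zero
    show ?case by (auto intro!: exI[of _ 0])
  next
    case (add F a i j)
    then obtain q where q: "\<forall>i\<ge>k. coeff q i = 0" "\<And>r. F (r * c, r * d) = poly q r"
      by blast
    show ?case
      using q add.hyps
      by (intro exI[of _ "q + monom (a * c ^ i * d ^ j) (i + j)"])
        (auto simp: poly_monom power_mult_distrib power_add algebra_simps)
  qed
  with that show ?thesis by blast
qed


subsection \<open>Inner products on the disk\<close>

context gegenbauer_weight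
begin

definition dint :: "(real \<times> real \<Rightarrow> real) \<Rightarrow> real" where
  "dint g = (LINT v:disk|lebesgue. g v * W_disk \<mu> v)"

lemma disk_inner_dint: "disk_inner \<mu> P Q = a_const \<mu> * dint (\<lambda>v. P v * Q v)"
  by (simp add: disk_inner_def dint_def)

lemma a_const_pos: "a_const \<mu> > 0"
  using mu by (simp add: a_const_def)

lemma dint_add:
  assumes "continuous_on UNIV f" "continuous_on UNIV g"
  shows "dint (\<lambda>v. f v + g v) = dint f + dint g"
  unfolding dint_def distrib_right
  by (intro set_integral_add disk_integrable mu assms)

lemma dint_scale: "dint (\<lambda>v. c * f v) = c * dint f"
  by (simp add: dint_def mult.assoc)

lemma dint_sum:
  assumes "\<And>i. i \<in> A \<Longrightarrow> continuous_on UNIV (f i)"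
  shows "dint (\<lambda>v. \<Sum>i\<in>A. f i v) = (\<Sum>i\<in>A. dint (f i))"
  using assms
proof (induction A rule: infinite_finite_induct)
  case (insert a A)
  then show ?case
    by (simp add: dint_add continuous_on_sum)
qed (simp_all add: dint_def)

lemma dint_one: "a_const \<mu> * dint (\<lambda>_. 1) = 1"
  using W_disk_integrable(2)[OF mu] mu by (simp add: dint_def a_const_def)

lemma dint_rotation:
  assumes "continuous_on UNIV g" "c\<^sup>2 + d\<^sup>2 = (1::real)"
  shows "dint (\<lambda>(t, s). g (t * c - s * d, t * d + s * c)) = dint g"
  using disk_rotation[OF mu assms] by (simp add: dint_def case_prod_unfold)

text \<open>
  The slice of the weighted monomial \<open>y ^ j\<close> over \<open>x = t\<close> is the Gegenbauer weight
  \<open>(1 - t\<^sup>2) powr \<mu>\<close> times the polynomial \<open>slice j\<close>.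
\<close>

definition smoment :: "nat \<Rightarrow> real" where
  "smoment j = (LINT s:{-1..1}|lborel. s ^ j * (1 - s\<^sup>2) powr (\<mu> - 1/2))"

definition slice :: "nat \<Rightarrow> real poly" where
  "slice j = (if even j then smult (smoment j) ([:1, 0, -1:] ^ (j div 2)) else 0)"

lemma smoment_odd:
  assumes "odd j"
  shows "smoment j = 0"
proof -
  have "smoment j = (LINT s|lborel. indicator {-1..1} s * (s ^ j * (1 - s\<^sup>2) powr (\<mu> - 1/2)))"
    by (simp add: smoment_def set_lebesgue_integral_def)
  also have "\<dots> = (LINT s|lborel. indicator {-1..1} (- s) * ((- s) ^ j * (1 - (- s)\<^sup>2) powr (\<mu> - 1/2)))"
    by (subst lborel_integral_real_affine[of "-1" _ 0]) simp_all
  also have "\<dots> = (LINT s|lborel. - (indicator {-1..1} s * (s ^ j * (1 - s\<^sup>2) powr (\<mu> - 1/2))))"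
    using assms by (intro Bochner_Integration.integral_cong refl) (auto simp: indicator_def)
  also have "\<dots> = - smoment j"
    by (simp add: smoment_def set_lebesgue_integral_def)
  finally show ?thesis by simp
qed

text \<open>With r = sqrt (1 - t^2) and s replaced by r s the weight factors, as 1 - t^2 - (r s)^2 =
  (1 - t^2)(1 - s^2), and the extra r of the substitution raises the exponent from \<mu> - 1/2 to
  \<mu>.\<close>

lemma slice_integral:
  "(LINT s|lborel. indicator disk (t, s) * (s ^ j * W_disk \<mu> (t, s))) =
     indicator {-1..1} t * (poly (slice j) t * (1 - t\<^sup>2) powr \<mu>)"
proof (cases "\<bar>t\<bar> < 1")
  case True
  define r where "r = sqrt (1 - t\<^sup>2)"
  have t: "1 - t\<^sup>2 > 0" using True by (simp add: abs_square_less_1)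
  then have r: "r > 0" "r\<^sup>2 = 1 - t\<^sup>2" by (simp_all add: r_def)
  have "(LINT s|lborel. indicator disk (t, s) * (s ^ j * W_disk \<mu> (t, s))) =
      r * (LINT s|lborel. indicator disk (t, r * s) * ((r * s) ^ j * W_disk \<mu> (t, r * s)))"
    using r by (subst lborel_integral_real_affine[of r _ 0]) simp_all
  also have "(LINT s|lborel. indicator disk (t, r * s) * ((r * s) ^ j * W_disk \<mu> (t, r * s))) =
      (LINT s|lborel. (r ^ j * (1 - t\<^sup>2) powr (\<mu> - 1/2)) *
        (indicator {-1..1} s * (s ^ j * (1 - s\<^sup>2) powr (\<mu> - 1/2))))"
  proof (intro Bochner_Integration.integral_cong refl)
    fix s :: real
    have *: "1 - t\<^sup>2 - (r * s)\<^sup>2 = (1 - t\<^sup>2) * (1 - s\<^sup>2)"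
      by (simp add: power_mult_distrib r(2) algebra_simps)
    have "t\<^sup>2 + (r * s)\<^sup>2 \<le> 1 \<longleftrightarrow> 0 \<le> (1 - t\<^sup>2) * (1 - s\<^sup>2)"
      unfolding *[symmetric] by linarith
    also have "\<dots> \<longleftrightarrow> 0 \<le> 1 - s\<^sup>2"
      using mult_le_cancel_left_pos[OF t, of 0 "1 - s\<^sup>2"] by (simp only: mult_zero_right)
    also have "\<dots> \<longleftrightarrow> s \<in> {-1..1}"
      by (auto simp: abs_square_le_1 abs_le_iff)
    finally have ind: "indicator disk (t, r * s) = (indicator {-1..1} s :: real)"
      by (simp add: disk_def indicator_def)
    show "indicator disk (t, r * s) * ((r * s) ^ j * W_disk \<mu> (t, r * s)) =
        r ^ j * (1 - t\<^sup>2) powr (\<mu> - 1/2) * (indicator {-1..1} s * (s ^ j * (1 - s\<^sup>2) powr (\<mu> - 1/2)))"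
    proof (cases "s \<in> {-1..1}")
      case True
      then have "0 \<le> 1 - s\<^sup>2" by (simp add: abs_square_le_1 abs_le_iff)
      then have "W_disk \<mu> (t, r * s) = (1 - t\<^sup>2) powr (\<mu> - 1/2) * (1 - s\<^sup>2) powr (\<mu> - 1/2)"
        unfolding W_disk_def case_prod_conv * using t by (simp add: powr_mult)
      then show ?thesis
        by (simp add: ind power_mult_distrib)
    qed (simp add: ind)
  qed
  also have "\<dots> = (r ^ j * (1 - t\<^sup>2) powr (\<mu> - 1/2)) * smoment j"
    by (simp add: smoment_def set_lebesgue_integral_def)
  also have "r * \<dots> = poly (slice j) t * (1 - t\<^sup>2) powr \<mu>"
  proof (cases "even j")
    case True
    then have "r ^ j = (1 - t\<^sup>2) ^ (j div 2)"
      by (metis dvd_mult_div_cancel power_mult r(2))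
    moreover have "r * (1 - t\<^sup>2) powr (\<mu> - 1/2) = (1 - t\<^sup>2) powr \<mu>"
      using t powr_add[of "1 - t\<^sup>2" "1/2" "\<mu> - 1/2"] by (simp add: r_def powr_half_sqrt)
    ultimately show ?thesis
      using True by (simp add: slice_def power2_eq_square algebra_simps)
  qed (simp add: slice_def smoment_odd)
  finally show ?thesis
    using True by (simp add: abs_less_iff indicator_def)
next
  case False
  \<comment> \<open>At t = 1 and t = -1 both sides vanish thanks to \<open>0 powr a = 0\<close>,
    even when the exponent is 0.\<close>
  then have t: "t\<^sup>2 \<ge> 1" by (metis abs_square_less_1 linorder_not_less)
  have A: "indicator disk (t, s) * (s ^ j * W_disk \<mu> (t, s)) = 0" for s
  proof (cases "(t, s) \<in> disk")
    case True
    then have ts: "t\<^sup>2 + s\<^sup>2 \<le> 1"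
      by (simp add: disk_def)
    then have "s\<^sup>2 \<le> 0"
      using t by linarith
    then have "s = 0"
      by simp
    then have "1 - t\<^sup>2 - s\<^sup>2 = 0"
      using t ts by simp
    then show ?thesis by (simp add: W_disk_def)
  qed simp
  have B: "indicator {-1..1} t * (1 - t\<^sup>2) powr \<mu> = 0"
    using False by (cases "\<bar>t\<bar> = 1") (auto simp: indicator_def abs_if split: if_splits)
  show ?thesis
    by (simp only: A Bochner_Integration.integral_zero mult.left_commute[of _ "poly (slice j) t"] B
        mult_zero_right)
qed

lemma dint_slice: "dint (\<lambda>(x, y). poly q x * y ^ j) = wint (q * slice j)"
proof -
  let ?F = "\<lambda>v. indicator disk v * (poly q (fst v) * snd v ^ j * W_disk \<mu> v)"
  have "continuous_on UNIV (\<lambda>v :: real \<times> real. poly q (fst v) * snd v ^ j)"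
    by (intro continuous_intros)
  from disk_integrable[OF mu this] have int: "integrable lebesgue ?F"
    by (simp only: set_integrable_def real_scaleR_def)
  have "dint (\<lambda>(x, y). poly q x * y ^ j) = integral\<^sup>L lebesgue ?F"
    by (simp add: dint_def set_lebesgue_integral_def case_prod_unfold)
  also have "\<dots> = (LINT t|lebesgue. LINT s|lebesgue. ?F (t, s))"
    by (rule lebesgue_integral_pair[OF int])
  also have "\<dots> = (LINT t|lebesgue. indicator {-1..1} t * (poly (q * slice j) t * (1 - t\<^sup>2) powr \<mu>))"
  proof (intro Bochner_Integration.integral_cong refl)
    fix t
    have m: "(\<lambda>s. indicator disk (t, s) * (s ^ j * W_disk \<mu> (t, s))) \<in> borel_measurable lborel"
      unfolding W_disk_def disk_def indicator_def by measurable
    have "(LINT s|lebesgue. ?F (t, s)) =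
        (LINT s|lebesgue. poly q t * (indicator disk (t, s) * (s ^ j * W_disk \<mu> (t, s))))"
      by (simp add: mult_ac)
    also have "\<dots> = poly q t * (LINT s|lborel. indicator disk (t, s) * (s ^ j * W_disk \<mu> (t, s)))"
      using integral_completion[OF m] by simp
    finally show "(LINT s|lebesgue. ?F (t, s)) =
        indicator {-1..1} t * (poly (q * slice j) t * (1 - t\<^sup>2) powr \<mu>)"
      by (simp add: slice_integral)
  qed
  also have "\<dots> = wint (q * slice j)"
    by (simp add: wint_def set_lebesgue_integral_def)
  finally show ?thesis .
qed

lemma slice_degree: "degree (slice j) \<le> j"
proof -
  have "degree ([:1, 0, -1:] ^ (j div 2) :: real poly) \<le> 2 * (j div 2)"
    using degree_power_le[of "[:1, 0, -1:] :: real poly" "j div 2"] by simp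
  also have "\<dots> \<le> j" by simp
  finally show ?thesis
    unfolding slice_def by (auto intro: order_trans[OF degree_smult_le])
qed

text \<open>At t = 1 the chord shrinks to the point (1, 0), where only the zeroth power of y
  survives. This is how an integral over chords returns a point value.\<close>

lemma slice_one: "poly (slice j) 1 = smoment 0 * 0 ^ j"
  by (auto simp: slice_def power_0_left elim!: evenE)

text \<open>\<open>r\<close> is the projection of \<open>P\<close> along the lines x = t, divided by
  (1 - t^2)^\<mu>. It depends on \<open>P\<close> alone while \<open>q\<close> stays free, so
  orthogonality on the disk can be read as orthogonality on the interval.\<close>

lemma dint_polys_below_slice:
  assumes "P \<in> polys_below k"
  obtains r where "\<forall>i\<ge>k. coeff r i = 0" "poly r 1 = smoment 0 * P (1, 0)"
    "\<And>q. dint (\<lambda>v. poly q (fst v) * P v) = wint (q * r)"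
proof -
  have "\<exists>r. (\<forall>i\<ge>k. coeff r i = 0) \<and> poly r 1 = smoment 0 * P (1, 0) \<and>
      (\<forall>q. dint (\<lambda>v. poly q (fst v) * P v) = wint (q * r))"
    using assms
  proof (induction rule: polys_below_induct)
    case zero
    show ?case
      using dint_scale[of 0 "\<lambda>_. 0"] by (intro exI[of _ 0]) (simp add: positive_functional.zero[OF positive_functional_wint])
  next
    case (add F c i j)
    then obtain r where r: "\<forall>i\<ge>k. coeff r i = 0" "poly r 1 = smoment 0 * F (1, 0)"
      "\<And>q. dint (\<lambda>v. poly q (fst v) * F v) = wint (q * r)"
      by blast
    let ?m = "smult c (monom 1 i * slice j)"
    have "degree ?m \<le> i + j"
    proof -
      have "degree (monom 1 i * slice j) \<le> degree (monom (1 :: real) i) + degree (slice j)"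
        by (rule degree_mult_le)
      also have "\<dots> \<le> i + j"
        using slice_degree[of j] by (simp add: degree_monom_eq)
      finally show ?thesis
        by (rule order_trans[OF degree_smult_le])
    qed
    then have 1: "\<forall>i\<ge>k. coeff (r + ?m) i = 0"
      using r(1) add.hyps by (auto simp del: coeff_smult intro!: coeff_eq_0)
    have 2: "poly (r + ?m) 1 = smoment 0 * (F (1, 0) + c * (fst (1, 0) ^ i * snd (1, 0 :: real) ^ j))"
      by (simp add: r(2) slice_one poly_monom algebra_simps)
    have 3: "dint (\<lambda>v. poly q (fst v) * (F v + c * (fst v ^ i * snd v ^ j))) = wint (q * (r + ?m))" for q
    proof -
      have "dint (\<lambda>v. poly q (fst v) * (F v + c * (fst v ^ i * snd v ^ j))) =
          dint (\<lambda>v. poly q (fst v) * F v + c * (case v of (x, y) \<Rightarrow> poly (q * monom 1 i) x * y ^ j))"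
        by (rule arg_cong[of _ _ dint]) (simp add: fun_eq_iff poly_monom algebra_simps)
      also have "\<dots> = wint (q * r) + c * wint (q * monom 1 i * slice j)"
        using polys_below_continuous[OF add.hyps(1)] dint_slice[of "q * monom 1 i" j]
        by (subst dint_add) (auto simp: r(3) dint_scale dint_slice case_prod_unfold intro!: continuous_intros)
      also have "\<dots> = wint (q * (r + ?m))"
        by (simp only: distrib_left mult_smult_right positive_functional.add[OF positive_functional_wint] smult mult.assoc)
      finally show ?thesis .
    qed
    show ?case
      using 1 2 3 by (intro exI[of _ "r + ?m"]) simp
  qed
  with that show ?thesis by blast
qed

text \<open>For a unit vector (c, d), the square norm of \<open>zonal k c d\<close> divided by
  \<open>poly (C k) 1\<close>; the reciprocal is the factor in \<open>D_kernel\<close>.\<close>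

definition zonal_norm :: "nat \<Rightarrow> real" where
  "zonal_norm k = (\<mu> + 1/2) / (real k + \<mu> + 1/2)"

lemma zonal_norm_pos: "zonal_norm k > 0"
  using mu by (simp add: zonal_norm_def add_nonneg_pos)

text \<open>Integrating 1 over the disk chord by chord. The masses of the two one-dimensional
  weights are not evaluated: they occur as a product, which cancels against
  \<open>a_const\<close>.\<close>

lemma normalisation: "a_const \<mu> * (smoment 0 * wint 1) = 1"
proof -
  have "slice 0 = smult (smoment 0) 1"
    by (simp add: slice_def)
  then have "wint (1 * slice 0) = smoment 0 * wint 1"
    by (simp only: mult_1 smult)
  then have "dint (\<lambda>_. 1) = smoment 0 * wint 1"
    using dint_slice[of 1 0] by (simp add: case_prod_unfold)
  then show ?thesis using dint_one by simp
qed

section \<open>Ridge polynomials and the reproducing kernel\<close>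

lemma V_spaceD:
  assumes "P \<in> V_space \<mu> k"
  shows "P \<in> polys_below (Suc k)" "Q \<in> polys_below k \<Longrightarrow> dint (\<lambda>v. P v * Q v) = 0"
  using assms a_const_pos by (auto simp: V_space_def disk_inner_dint)

lemma V_space_zonal_axis:
  assumes P: "P \<in> polys_below (Suc k)"
    and orth: "\<And>Q. Q \<in> polys_below k \<Longrightarrow> dint (\<lambda>v. P v * Q v) = 0"
  shows "a_const \<mu> * dint (\<lambda>v. poly (C k) (fst v) * P v) = zonal_norm k * P (1, 0)"
proof -
  obtain r where r: "\<forall>i\<ge>Suc k. coeff r i = 0" "poly r 1 = smoment 0 * P (1, 0)"
    "\<And>q. dint (\<lambda>v. poly q (fst v) * P v) = wint (q * r)"
    using dint_polys_below_slice[OF P] by blast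
  \<comment> \<open>A polynomial in the first coordinate alone is a test function on the disk, so
    the orthogonality of \<open>P\<close> passes to \<open>r\<close>.\<close>
  have low: "wint (r * q) = 0" if q: "\<forall>i\<ge>k. coeff q i = 0" for q
  proof (cases "q = 0")
    case True
    then show ?thesis by (simp add: local.zero)
  next
    case False
    then have "degree q < k"
      using q by (metis leading_coeff_0_iff linorder_not_less)
    have "(\<lambda>v :: real \<times> real. 1 * fst v + 0 * snd v) \<in> polys_below (Suc 1)"
      by (rule polys_below_linear)
    from polys_below_poly[OF this, of q] have "(\<lambda>v. poly q (fst v)) \<in> polys_below k"
      using \<open>degree q < k\<close> by (auto elim: polys_below_mono)
    from orth[OF this] show ?thesis
      using r(3)[of q] by (simp add: mult.commute)
  qed
  have "degree r \<le> k"
    using r(1) by (intro degree_le) auto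
  define c where "c = coeff r k / lead_coeff (C k)"
  have rc: "r = smult c (C k)"
    unfolding c_def
    by (rule orthogonal_unique[OF C_lower C_degree C_nonzero low \<open>degree r \<le> k\<close>])
  have c: "c * poly (C k) 1 = smoment 0 * P (1, 0)"
    using r(2) by (simp add: rc)
  have "dint (\<lambda>v. poly (C k) (fst v) * P v) = c * wint (C k * C k)"
    unfolding r(3) rc by (simp add: smult)
  then have "(real k + \<mu> + 1/2) * (a_const \<mu> * dint (\<lambda>v. poly (C k) (fst v) * P v)) =
      a_const \<mu> * c * ((real k + \<mu> + 1/2) * wint (C k * C k))"
    by (simp only: mult_ac)
  also have "\<dots> = a_const \<mu> * wint 1 * (\<mu> + 1/2) * (c * poly (C k) 1)"
    unfolding C_norm by (simp only: mult_ac)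
  also have "\<dots> = (a_const \<mu> * (smoment 0 * wint 1)) * ((\<mu> + 1/2) * P (1, 0))"
    by (simp only: c mult_ac)
  also have "\<dots> = (\<mu> + 1/2) * P (1, 0)"
    by (simp only: normalisation mult_1)
  finally have eq: "(real k + \<mu> + 1/2) * (a_const \<mu> * dint (\<lambda>v. poly (C k) (fst v) * P v)) =
      (\<mu> + 1/2) * P (1, 0)" .
  have "real k + \<mu> + 1/2 > 0"
    using mu by (simp add: add_nonneg_pos)
  with eq show ?thesis
    by (simp add: zonal_norm_def field_simps)
qed

text \<open>The Gegenbauer polynomial as a plane wave, constant on the lines orthogonal to (c,
  d).\<close>

definition zonal :: "nat \<Rightarrow> real \<Rightarrow> real \<Rightarrow> real \<times> real \<Rightarrow> real" where
  "zonal k c d = (\<lambda>v. poly (C k) (c * fst v + d * snd v))"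

lemma zonal_polys_below: "zonal k c d \<in> polys_below (Suc k)"
  using polys_below_poly[OF polys_below_linear, of "C k" c d] by (simp add: zonal_def C_degree)

lemma dint_zonal_rotate:
  assumes cd: "c\<^sup>2 + d\<^sup>2 = 1" and P: "continuous_on UNIV P"
  shows "dint (\<lambda>v. zonal k c d v * P v) =
    dint (\<lambda>v. poly (C k) (fst v) * (case v of (t, s) \<Rightarrow> P (t * c - s * d, t * d + s * c)))"
proof -
  have "c * (t * c - s * d) + d * (t * d + s * c) = t" for t s
  proof -
    have "c * (t * c - s * d) + d * (t * d + s * c) = (c\<^sup>2 + d\<^sup>2) * t"
      by algebra
    then show ?thesis using cd by simp
  qed
  moreover have "continuous_on UNIV (\<lambda>v. zonal k c d v * P v)"
    using P by (auto simp: zonal_def intro!: continuous_intros)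
  from dint_rotation[OF this cd] have "dint (\<lambda>v. zonal k c d v * P v) =
      dint (\<lambda>(t, s). zonal k c d (t * c - s * d, t * d + s * c) * P (t * c - s * d, t * d + s * c))"
    by simp
  ultimately show ?thesis
    by (simp add: zonal_def case_prod_unfold)
qed

text \<open>Rotating (1, 0) to (c, d) reduces this to the axis case. The orthogonality of the
  rotated \<open>P\<close> is obtained by applying the inverse rotation to the test
  polynomial.\<close>

lemma zonal_reproducing:
  assumes P: "P \<in> V_space \<mu> k" and cd: "c\<^sup>2 + d\<^sup>2 = 1"
  shows "disk_inner \<mu> (zonal k c d) P = zonal_norm k * P (c, d)"
proof -
  let ?P = "\<lambda>v. case v of (t, s) \<Rightarrow> P (t * c - s * d, t * d + s * c)"
  note PV = V_spaceD[OF P]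
  have orth: "dint (\<lambda>v. ?P v * Q v) = 0" if Q: "Q \<in> polys_below k" for Q
  proof -
    let ?Q = "\<lambda>(t, s). Q (t * c - s * (- d), t * (- d) + s * c)"
    have Q': "?Q \<in> polys_below k"
      using Q by (rule polys_below_rotation)
    have inv: "?Q (t * c - s * d, t * d + s * c) = Q (t, s)" for t s
    proof -
      have "(t * c - s * d) * c - (t * d + s * c) * (- d) = (c\<^sup>2 + d\<^sup>2) * t"
        "(t * c - s * d) * (- d) + (t * d + s * c) * c = (c\<^sup>2 + d\<^sup>2) * s"
        by algebra+
      then show ?thesis using cd by simp
    qed
    have "continuous_on UNIV (\<lambda>v. P v * ?Q v)"
      by (intro continuous_on_mult polys_below_continuous[OF PV(1)] polys_below_continuous[OF Q'])
    from dint_rotation[OF this cd] have "dint (\<lambda>v. ?P v * Q v) = dint (\<lambda>v. P v * ?Q v)"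
      by (simp only: case_prod_unfold inv[unfolded case_prod_unfold] prod.collapse)
    then show ?thesis using PV(2)[OF Q'] by simp
  qed
  have "?P \<in> polys_below (Suc k)"
    using polys_below_rotation[OF PV(1), of c d] by (simp add: case_prod_unfold)
  from V_space_zonal_axis[OF this orth] show ?thesis
    unfolding disk_inner_dint dint_zonal_rotate[OF cd polys_below_continuous[OF PV(1)]] by simp
qed

text \<open>Along the direction (c, d) itself the function is \<open>C k\<close>, of exact degree
  \<open>k\<close>. Against a lower polynomial, projection along the lines leaves \<open>C k\<close>
  tested with a univariate polynomial of lower degree.\<close>

lemma zonal_V_space:
  assumes cd: "c\<^sup>2 + d\<^sup>2 = 1"
  shows "zonal k c d \<in> V_space \<mu> k"
proof -
  have "zonal k c d \<notin> polys_below k"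
  proof
    assume "zonal k c d \<in> polys_below k"
    from polys_below_ray[where c = c and d = d, OF this] obtain q where q: "\<forall>i\<ge>k. coeff q i = 0" "\<And>r. zonal k c d (r * c, r * d) = poly q r"
      by blast
    have "c * (r * c) + d * (r * d) = (c\<^sup>2 + d\<^sup>2) * r" for r
      by algebra
    then have "poly (C k) r = poly q r" for r
      using q(2)[of r] cd by (simp add: zonal_def)
    then have "C k = q"
      by (rule poly_ext)
    then have "coeff (C k) k = 0"
      using q(1) by simp
    then show False
      using C_nonzero[of k] by (metis C_degree leading_coeff_0_iff)
  qed
  moreover have "disk_inner \<mu> (zonal k c d) Q = 0" if Q: "Q \<in> polys_below k" for Q
  proof -
    define Q' where "Q' = (\<lambda>(t, s). Q (t * c - s * d, t * d + s * c))"
    have "Q' \<in> polys_below k"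
      unfolding Q'_def using Q by (rule polys_below_rotation)
    from this obtain r where r: "\<forall>i\<ge>k. coeff r i = 0" "poly r 1 = smoment 0 * Q' (1, 0)"
      "\<And>q. dint (\<lambda>v. poly q (fst v) * Q' v) = wint (q * r)"
      using dint_polys_below_slice by blast
    have "dint (\<lambda>v. zonal k c d v * Q v) = dint (\<lambda>v. poly (C k) (fst v) * Q' v)"
      unfolding dint_zonal_rotate[OF cd polys_below_continuous[OF Q]] Q'_def ..
    then show ?thesis
      by (simp add: disk_inner_dint r(3) C_lower[OF r(1)])
  qed
  ultimately show ?thesis
    using zonal_polys_below by (simp add: V_space_def)
qed

lemma disk_inner_sum_left:
  assumes "\<And>i. i \<in> A \<Longrightarrow> continuous_on UNIV (F i)" "continuous_on UNIV P"
  shows "disk_inner \<mu> (\<lambda>v. \<Sum>i\<in>A. c i * F i v) P = (\<Sum>i\<in>A. c i * disk_inner \<mu> (F i) P)"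
proof -
  have "dint (\<lambda>v. (\<Sum>i\<in>A. c i * F i v) * P v) = (\<Sum>i\<in>A. c i * dint (\<lambda>v. F i v * P v))"
    unfolding sum_distrib_right mult.assoc
    by (subst dint_sum) (auto intro!: continuous_intros assms simp: dint_scale)
  then show ?thesis
    by (simp add: disk_inner_dint sum_distrib_left mult_ac)
qed

text \<open>The ridge polynomial is expanded in \<open>B\<close>; by the reproducing property its
  coefficients are the values of \<open>B\<close> at (c, d), up to the factor. Only one argument of
  the kernel is tied to the circle, the other one is arbitrary.\<close>

lemma reproducing_kernel_circle:
  assumes B: "onb_V \<mu> k B" and cd: "c\<^sup>2 + d\<^sup>2 = 1"
  shows "poly (C k) (c * x + d * y) = zonal_norm k * (\<Sum>j\<le>k. B j (c, d) * B j (x, y))"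
proof -
  have BV: "B j \<in> V_space \<mu> k" if "j \<le> k" for j
    using B that by (simp add: onb_V_def)
  have cont: "continuous_on UNIV (B j)" if "j \<le> k" for j
    using V_spaceD(1)[OF BV[OF that]] by (rule polys_below_continuous)
  obtain a where a: "\<And>v. zonal k c d v = (\<Sum>j\<le>k. a j * B j v)"
    using B zonal_V_space[OF cd] unfolding onb_V_def by blast
  have "a i = zonal_norm k * B i (c, d)" if i: "i \<le> k" for i
  proof -
    have "zonal_norm k * B i (c, d) = disk_inner \<mu> (zonal k c d) (B i)"
      by (rule zonal_reproducing[OF BV[OF i] cd, symmetric])
    also have "zonal k c d = (\<lambda>v. \<Sum>j\<le>k. a j * B j v)"
      by (rule ext) (rule a)
    also have "disk_inner \<mu> (\<lambda>v. \<Sum>j\<le>k. a j * B j v) (B i) = (\<Sum>j\<le>k. a j * disk_inner \<mu> (B j) (B i))"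
      using i by (intro disk_inner_sum_left cont) auto
    also have "\<dots> = (\<Sum>j\<le>k. if j = i then a i else 0)"
      using B i by (intro sum.cong) (auto simp: onb_V_def)
    also have "\<dots> = a i"
      using i by simp
    finally show ?thesis ..
  qed
  then have "zonal k c d (x, y) = zonal_norm k * (\<Sum>j\<le>k. B j (c, d) * B j (x, y))"
    by (simp add: a sum_distrib_left mult.assoc)
  then show ?thesis
    by (simp add: zonal_def)
qed

subsection \<open>The Jacobi basis\<close>

definition Z :: "real \<times> real \<Rightarrow> complex" where
  "Z v = Complex (fst v) (snd v)"

definition \<rho> :: "real \<times> real \<Rightarrow> real" where
  "\<rho> v = 2 * ((fst v)\<^sup>2 + (snd v)\<^sup>2) - 1"

lemma continuous_on_Z [continuous_intros]: "continuous_on A Z"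
  unfolding Z_def Complex_eq by (intro continuous_intros)

lemma continuous_on_\<rho> [continuous_intros]: "continuous_on A \<rho>"
  unfolding \<rho>_def by (intro continuous_intros)

text \<open>Polynomials in z and its conjugate of total degree below \<open>k\<close>. On these
  monomials rotations act by scalars, which separates the angular from the radial
  orthogonality.\<close>

inductive cspan :: "nat \<Rightarrow> (real \<times> real \<Rightarrow> complex) \<Rightarrow> bool" for k where
  zero: "cspan k (\<lambda>_. 0)"
| add: "cspan k F \<Longrightarrow> a + b < k \<Longrightarrow> cspan k (\<lambda>v. F v + c * (Z v ^ a * cnj (Z v) ^ b))"

lemma cspan_add:
  assumes "cspan k F" "cspan k G"
  shows "cspan k (\<lambda>v. F v + G v)"
  using assms(2)
proof induction
  case zero
  then show ?case using assms(1) by simp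
next
  case (add G a b c)
  from cspan.add[OF add.IH add.hyps(2), of c] show ?case
    by (simp add: add.assoc)
qed

lemma cspan_scale:
  assumes "cspan k F"
  shows "cspan k (\<lambda>v. u * F v)"
  using assms
proof induction
  case zero
  then show ?case by (simp add: cspan.zero)
next
  case (add F a b c)
  from cspan.add[OF add.IH add.hyps(2), of "u * c"] show ?case
    by (simp add: algebra_simps)
qed

lemma cspan_mono:
  assumes "cspan k F" "k \<le> l"
  shows "cspan l F"
  using assms(1)
proof induction
  case zero
  then show ?case by (rule cspan.zero)
next
  case (add F a b c)
  then show ?case using assms(2) by (intro cspan.add) auto
qed

lemma cspan_Z:
  assumes "cspan k F"
  shows "cspan (Suc k) (\<lambda>v. Z v * F v)" and "cspan (Suc k) (\<lambda>v. cnj (Z v) * F v)"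
proof -
  show "cspan (Suc k) (\<lambda>v. Z v * F v)"
    using assms
  proof induction
    case zero
    then show ?case by (simp add: cspan.zero)
  next
    case (add F a b c)
    then have "Suc a + b < Suc k" by simp
    from cspan.add[OF add.IH this, of c] show ?case
      by (simp add: algebra_simps)
  qed
  show "cspan (Suc k) (\<lambda>v. cnj (Z v) * F v)"
    using assms
  proof induction
    case zero
    then show ?case by (simp add: cspan.zero)
  next
    case (add F a b c)
    then have "a + Suc b < Suc k" by simp
    from cspan.add[OF add.IH this, of c] show ?case
      by (simp add: algebra_simps)
  qed
qed

lemma cspan_coordinate:
  assumes "cspan k F"
  shows "cspan (Suc k) (\<lambda>v. of_real (fst v) * F v)" and "cspan (Suc k) (\<lambda>v. of_real (snd v) * F v)"
proof -
  have x: "(\<lambda>v. of_real (fst v) * F v) = (\<lambda>v. (1/2) * (Z v * F v) + (1/2) * (cnj (Z v) * F v))"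
    by (rule ext) (simp add: Z_def complex_eq_iff field_simps)
  have y: "(\<lambda>v. of_real (snd v) * F v) = (\<lambda>v. (- \<i>/2) * (Z v * F v) + (\<i>/2) * (cnj (Z v) * F v))"
    by (rule ext) (simp add: Z_def complex_eq_iff field_simps)
  show "cspan (Suc k) (\<lambda>v. of_real (fst v) * F v)"
    unfolding x by (intro cspan_add cspan_scale cspan_Z assms)
  show "cspan (Suc k) (\<lambda>v. of_real (snd v) * F v)"
    unfolding y by (intro cspan_add cspan_scale cspan_Z assms)
qed

lemma cspan_monomial: "cspan (Suc (i + j)) (\<lambda>v. of_real (fst v ^ i * snd v ^ j))"
proof (induction i)
  case 0
  show ?case
  proof (induction j)
    case 0
    show ?case using cspan.add[OF cspan.zero, of 0 0 "Suc 0" 1] by simp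
  next
    case (Suc j)
    from cspan_coordinate(2)[OF Suc] show ?case by simp
  qed
next
  case (Suc i)
  from cspan_coordinate(1)[OF Suc] show ?case by (simp add: mult.assoc)
qed

lemma cspan_polys_below:
  assumes "P \<in> polys_below k"
  shows "cspan k (\<lambda>v. of_real (P v))"
  using assms
proof (induction rule: polys_below_induct)
  case zero
  then show ?case by (simp add: cspan.zero)
next
  case (add F c i j)
  have "cspan k (\<lambda>v. of_real c * of_real (fst v ^ i * snd v ^ j))"
    using add.hyps(2) by (intro cspan_scale cspan_mono[OF cspan_monomial[of i j]]) simp
  from cspan_add[OF add.IH this] show ?case by simp
qed

text \<open>Rotation by \<open>pi / (a - b)\<close> changes the sign of the integrand.\<close>

lemma dint_monomial_offdiag:
  assumes "a \<noteq> b"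
  shows "dint (\<lambda>v. poly q (\<rho> v) * Re (u * (Z v ^ a * cnj (Z v) ^ b))) = 0"
proof -
  define \<theta> where "\<theta> = pi / (real a - real b)"
  let ?f = "\<lambda>v. poly q (\<rho> v) * Re (u * (Z v ^ a * cnj (Z v) ^ b))"
  let ?R = "\<lambda>(t, s). (t * cos \<theta> - s * sin \<theta>, t * sin \<theta> + s * cos \<theta>)"
  have "real a * \<theta> - real b * \<theta> = (real a - real b) * \<theta>"
    by (simp add: algebra_simps)
  also have "\<dots> = pi"
    using assms by (simp add: \<theta>_def)
  finally have ab: "real a * \<theta> + - (real b * \<theta>) = pi" by simp
  have Z: "Z (?R v) = cis \<theta> * Z v" for v
    by (simp add: Z_def complex_eq_iff case_prod_unfold algebra_simps)
  have R: "\<rho> (?R v) = \<rho> v" for v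
  proof -
    have "(fst v * cos \<theta> - snd v * sin \<theta>)\<^sup>2 + (fst v * sin \<theta> + snd v * cos \<theta>)\<^sup>2 =
        ((fst v)\<^sup>2 + (snd v)\<^sup>2) * ((cos \<theta>)\<^sup>2 + (sin \<theta>)\<^sup>2)"
      by algebra
    then show ?thesis by (simp add: \<rho>_def case_prod_unfold)
  qed
  have key: "Z (?R v) ^ a * cnj (Z (?R v)) ^ b = - (Z v ^ a * cnj (Z v) ^ b)" for v
  proof -
    have "cis \<theta> ^ a * cnj (cis \<theta>) ^ b = cis (real a * \<theta>) * cis (- (real b * \<theta>))"
      by (simp add: cis_cnj Complex.DeMoivre)
    also have "\<dots> = -1"
      by (simp only: cis_mult ab cis_pi)
    finally have "cis \<theta> ^ a * cnj (cis \<theta>) ^ b = -1" .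
    moreover have "Z (?R v) ^ a * cnj (Z (?R v)) ^ b =
        (cis \<theta> ^ a * cnj (cis \<theta>) ^ b) * (Z v ^ a * cnj (Z v) ^ b)"
      unfolding Z complex_cnj_mult power_mult_distrib by (simp only: mult_ac)
    ultimately show ?thesis by simp
  qed
  have f: "?f (?R v) = - 1 * ?f v" for v
    by (simp only: R key mult_minus_right uminus_complex.sel mult_minus_left mult_1_left)
  have "continuous_on UNIV ?f"
    by (intro continuous_intros)
  from dint_rotation[OF this, of "cos \<theta>" "sin \<theta>"] have "dint (\<lambda>v. ?f (?R v)) = dint ?f"
    by (simp add: case_prod_unfold)
  then have "dint (\<lambda>v. -1 * ?f v) = dint ?f"
    by (simp only: f)
  then show ?thesis
    by (simp only: dint_scale)
qed

text \<open>Under t = 2 r^2 - 1 the factor r^(2j) completes the weight to (1 - t)^(\<mu>-1/2) (1 +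
  t)^j up to constants. The remaining r^(2a) is a polynomial of degree a < l, to which the Jacobi
  polynomial is orthogonal.\<close>

lemma dint_radial_jacobi:
  assumes "a < l"
  shows "dint (\<lambda>v. poly (jacobi (\<mu> - 1/2) (real j) l) (\<rho> v) * ((fst v)\<^sup>2 + (snd v)\<^sup>2) ^ (j + a)) = 0"
proof -
  let ?J = "jacobi (\<mu> - 1/2) (real j) l"
  let ?K = "(1/2) powr (\<mu> - 1/2) * (1/2) ^ (j + a) :: real"
  let ?g = "\<lambda>t. ?K * (poly (?J * [:1, 1:] ^ a) t * ((1 - t) powr (\<mu> - 1/2) * (1 + t) ^ j))"
  have [measurable]: "poly r \<in> borel_measurable borel" for r :: "real poly"
    by (intro borel_measurable_continuous_onI continuous_intros)
  have g: "?g \<in> borel_measurable borel"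
    by (intro borel_measurable_times borel_measurable_const) measurable
  have "dint (\<lambda>v. poly ?J (\<rho> v) * ((fst v)\<^sup>2 + (snd v)\<^sup>2) ^ (j + a)) =
      (LINT (x, y):disk|lebesgue. ?g (2 * (x\<^sup>2 + y\<^sup>2) - 1))"
    unfolding dint_def
  proof (rule set_lebesgue_integral_cong)
    show "\<forall>v. v \<in> disk \<longrightarrow> poly ?J (\<rho> v) * ((fst v)\<^sup>2 + (snd v)\<^sup>2) ^ (j + a) * W_disk \<mu> v =
        (case v of (x, y) \<Rightarrow> ?g (2 * (x\<^sup>2 + y\<^sup>2) - 1))"
    proof (intro allI impI)
      fix v assume v: "v \<in> disk"
      obtain x y where xy: "v = (x, y)" by (cases v)
      define t where "t = 2 * (x\<^sup>2 + y\<^sup>2) - 1"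
      have W: "W_disk \<mu> v = (1/2) powr (\<mu> - 1/2) * (1 - t) powr (\<mu> - 1/2)"
        using W_disk_radial[of x y \<mu>] v by (simp add: xy t_def)
      have r: "x\<^sup>2 + y\<^sup>2 = (1/2) * (1 + t)"
        by (simp add: t_def)
      have "(x\<^sup>2 + y\<^sup>2) ^ (j + a) = (1/2) ^ (j + a) * ((1 + t) ^ a * (1 + t) ^ j)"
        unfolding r power_mult_distrib by (simp add: power_add)
      moreover have "\<rho> v = t"
        by (simp add: xy t_def \<rho>_def)
      ultimately show "poly ?J (\<rho> v) * ((fst v)\<^sup>2 + (snd v)\<^sup>2) ^ (j + a) * W_disk \<mu> v =
          (case v of (x, y) \<Rightarrow> ?g (2 * (x\<^sup>2 + y\<^sup>2) - 1))"
        unfolding W unfolding xy case_prod_conv t_def[symmetric] fst_conv snd_conv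
        by (simp add: poly_power mult_ac)
    qed
  qed simp
  also have "\<dots> = pi / 2 * (LINT t:{-1..1}|lebesgue. ?g t)"
    by (rule disk_radial(2)[OF g])
  also have "(LINT t:{-1..1}|lebesgue. ?g t) =
      (LINT t:{-1..1}|lebesgue. ?K * (poly (?J * [:1, 1:] ^ a) t * ((1 - t) powr (\<mu> - 1/2) * (1 + t) powr real j)))"
  proof (rule set_lebesgue_integral_cong_AE)
    \<comment> \<open>The Jacobi weight is written with \<open>powr\<close>, which for j = 0 differs
      from the power at t = -1: \<open>0 powr 0 = 0\<close> but \<open>0 ^ 0 = 1\<close>.\<close>
    have "AE t in lebesgue. t \<notin> {-1 :: real}"
      by (intro AE_completion AE_not_in finite_imp_null_set_lborel) simp
    then show "AE t\<in>{-1..1} in lebesgue. ?g t =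
        ?K * (poly (?J * [:1, 1:] ^ a) t * ((1 - t) powr (\<mu> - 1/2) * (1 + t) powr real j))"
      by eventually_elim (auto simp: powr_realpow)
    show "?g \<in> borel_measurable lebesgue"
      using g by (rule borel_measurable_lebesgueI)
    show "(\<lambda>t. ?K * (poly (?J * [:1, 1:] ^ a) t * ((1 - t) powr (\<mu> - 1/2) * (1 + t) powr real j)))
        \<in> borel_measurable lebesgue"
      by (intro borel_measurable_lebesgueI borel_measurable_times borel_measurable_const) measurable
  qed simp
  also have "\<dots> = ?K * jacobi_integral (\<mu> - 1/2) (real j) (?J * [:1, 1:] ^ a)"
    by (simp only: set_integral_mult_right jacobi_integral_def)
  also have "jacobi_integral (\<mu> - 1/2) (real j) (?J * [:1, 1:] ^ a) = 0"
  proof (rule jacobi_lower)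
    have "degree ([:1, 1:] ^ a :: real poly) \<le> a"
      using degree_power_le[of "[:1, 1:] :: real poly" a] by simp
    then show "\<forall>i\<ge>l. coeff ([:1, 1:] ^ a :: real poly) i = 0"
      using assms by (auto intro!: coeff_eq_0)
  qed (use mu in auto)
  finally show ?thesis by simp
qed

text \<open>Against the monomial with exponents a, b the angular integral vanishes unless b = j + a.
  Then a + b < 2 l + j forces a < l and the radial orthogonality applies. Continuity is carried
  along because the additivity of \<open>dint\<close> asks for it.\<close>

lemma dint_jacobi_cspan:
  assumes F: "cspan (2 * l + j) F"
  shows "dint (\<lambda>v. poly (jacobi (\<mu> - 1/2) (real j) l) (\<rho> v) * Re (u * Z v ^ j * F v)) = 0
    \<and> continuous_on UNIV F"
  using F
proof induction
  case zero
  then show ?case using dint_scale[of 0 "\<lambda>_. 0"] by simp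
next
  case (add F a b c)
  let ?J = "jacobi (\<mu> - 1/2) (real j) l"
  have "dint (\<lambda>v. poly ?J (\<rho> v) * Re (u * c * (Z v ^ (j + a) * cnj (Z v) ^ b))) = 0"
  proof (cases "b = j + a")
    case True
    have "Re (u * c * (Z v ^ (j + a) * cnj (Z v) ^ b)) = Re (u * c) * ((fst v)\<^sup>2 + (snd v)\<^sup>2) ^ (j + a)" for v
    proof -
      have "Z v ^ (j + a) * cnj (Z v) ^ b = of_real (((fst v)\<^sup>2 + (snd v)\<^sup>2) ^ (j + a))"
        unfolding True power_mult_distrib[symmetric] complex_mult_cnj by (simp add: Z_def)
      then show ?thesis
        by (simp only: Re_complex_of_real Im_complex_of_real times_complex.sel mult_zero_right diff_0_right)
    qed
    then have "dint (\<lambda>v. poly ?J (\<rho> v) * Re (u * c * (Z v ^ (j + a) * cnj (Z v) ^ b))) =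
        dint (\<lambda>v. Re (u * c) * (poly ?J (\<rho> v) * ((fst v)\<^sup>2 + (snd v)\<^sup>2) ^ (j + a)))"
      by (simp only: mult_ac)
    also have "\<dots> = 0"
      using add.hyps(2) True by (simp only: dint_scale) (simp add: dint_radial_jacobi)
    finally show ?thesis .
  next
    case False
    then show ?thesis by (intro dint_monomial_offdiag) simp
  qed
  moreover have "poly ?J (\<rho> v) * Re (u * Z v ^ j * (F v + c * (Z v ^ a * cnj (Z v) ^ b))) =
      poly ?J (\<rho> v) * Re (u * Z v ^ j * F v) + poly ?J (\<rho> v) * Re (u * c * (Z v ^ (j + a) * cnj (Z v) ^ b))"
    for v
  proof -
    have "u * Z v ^ j * (F v + c * (Z v ^ a * cnj (Z v) ^ b)) =
        u * Z v ^ j * F v + u * c * (Z v ^ (j + a) * cnj (Z v) ^ b)"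
      by (simp add: power_add algebra_simps)
    then show ?thesis
      by (simp only: plus_complex.sel distrib_left)
  qed
  moreover have "continuous_on UNIV F"
    using add.IH by blast
  then have "dint (\<lambda>v. poly ?J (\<rho> v) * Re (u * Z v ^ j * F v) +
        poly ?J (\<rho> v) * Re (u * c * (Z v ^ (j + a) * cnj (Z v) ^ b))) =
      dint (\<lambda>v. poly ?J (\<rho> v) * Re (u * Z v ^ j * F v)) +
      dint (\<lambda>v. poly ?J (\<rho> v) * Re (u * c * (Z v ^ (j + a) * cnj (Z v) ^ b)))"
    by (intro dint_add continuous_intros)
  moreover have "continuous_on UNIV (\<lambda>v. F v + c * (Z v ^ a * cnj (Z v) ^ b))"
    using \<open>continuous_on UNIV F\<close> by (intro continuous_intros)
  ultimately show ?case
    using add.IH by (simp only: add_0_left)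
qed

section \<open>The basis functions as polynomials of exact degree\<close>

definition trig_factor :: "nat \<Rightarrow> complex" where
  "trig_factor \<epsilon> = (if \<epsilon> = 0 then 1 else - \<i>)"

definition P_scale :: "nat \<Rightarrow> nat \<Rightarrow> real" where
  "P_scale l k = h_const \<mu> l k * (if k = 2 * l then 1 else sqrt 2)"

lemma h_const_pos: "h_const \<mu> l k > 0"
  using mu by (auto simp: h_const_def intro!: divide_pos_pos mult_pos_pos Gamma_real_pos)

lemma P_scale_nonzero: "P_scale l k \<noteq> 0"
  using h_const_pos[of l k] by (simp add: P_scale_def)

lemma Re_power_polar:
  "Re (trig_factor \<epsilon> * z ^ j) =
     cmod z ^ j * (if \<epsilon> = 0 then cos (real j * Arg z) else sin (real j * Arg z))"
proof -
  have "z ^ j = rcis (cmod z ^ j) (real j * Arg z)"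
    by (metis DeMoivre2 rcis_cmod_Arg)
  then show ?thesis
    by (simp add: trig_factor_def)
qed

text \<open>Removes the polar angle: r^j cos(j \<phi>) and r^j sin(j \<phi>) are the real parts of
  z^j and -i z^j, which accounts for the values of \<open>trig_factor\<close>.\<close>

lemma P_disk_eq:
  assumes "2 * l \<le> k"
  shows "P_disk \<mu> k l \<epsilon> v = P_scale l k * (poly (jacobi (\<mu> - 1/2) (real (k - 2 * l)) l) (\<rho> v) *
    Re (trig_factor \<epsilon> * Z v ^ (k - 2 * l)))"
proof -
  have "2 * (cmod (Z v))\<^sup>2 - 1 = \<rho> v"
    by (simp add: Z_def \<rho>_def cmod_power2)
  moreover have "k - 2 * l = 0 \<longleftrightarrow> k = 2 * l"
    using assms by auto
  ultimately show ?thesis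
    unfolding Re_power_polar
    by (simp add: P_disk_def case_prod_unfold Let_def Z_def[symmetric] circ_harm_def P_scale_def)
qed

text \<open>The factor \<open>u\<close> is kept general because multiplication by z mixes real and
  imaginary parts, and Im w = Re (-i w).\<close>

lemma Re_power_polys_below: "(\<lambda>v. Re (u * Z v ^ j)) \<in> polys_below (Suc j)"
proof (induction j arbitrary: u)
  case 0
  show ?case using polys_below_const[of "Re u" 0] by simp
next
  case (Suc j)
  have x: "(\<lambda>v. 1 * fst v + 0 * snd v) \<in> polys_below (Suc 1)"
    and y: "(\<lambda>v. 0 * fst v + (-1) * snd v) \<in> polys_below (Suc 1)"
    by (rule polys_below_linear)+
  have "Re (u * Z v ^ Suc j) = (1 * fst v + 0 * snd v) * Re (u * Z v ^ j) +
      (0 * fst v + (-1) * snd v) * Re ((- \<i> * u) * Z v ^ j)" for v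
    by (simp add: Z_def algebra_simps)
  then show ?case
    using polys_below_add[OF polys_below_mult[OF x Suc[of u]] polys_below_mult[OF y Suc[of "- \<i> * u"]]]
    by simp
qed

lemma P_disk_V_space:
  assumes le: "(l, \<epsilon>) \<in> adm_index k"
  shows "P_disk \<mu> k l \<epsilon> \<in> V_space \<mu> k"
proof -
  define j where "j = k - 2 * l"
  have k: "2 * l \<le> k" "k = 2 * l + j"
    using le by (auto simp: adm_index_def j_def)
  let ?J = "jacobi (\<mu> - 1/2) (real j) l"
  have \<alpha>: "\<mu> - 1/2 > -1" "real j \<ge> 0" using mu by auto
  have P: "P_disk \<mu> k l \<epsilon> = (\<lambda>v. P_scale l k * (poly ?J (\<rho> v) * Re (trig_factor \<epsilon> * Z v ^ j)))"
    unfolding j_def by (rule ext, rule P_disk_eq[OF k(1)])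
  have "(\<lambda>v. fst v ^ 2 * snd v ^ 0) \<in> polys_below (Suc 2)" "(\<lambda>v. fst v ^ 0 * snd v ^ 2) \<in> polys_below (Suc 2)"
    using polys_below_monomial[of 2 0 "Suc 2"] polys_below_monomial[of 0 2 "Suc 2"]
    by (simp_all add: case_prod_unfold)
  then have "(\<lambda>v. 2 * (fst v ^ 2 * snd v ^ 0 + fst v ^ 0 * snd v ^ 2) + (-1)) \<in> polys_below (Suc 2)"
    by (intro polys_below_add polys_below_scale polys_below_const)
  then have "\<rho> \<in> polys_below (Suc 2)"
    by (simp add: \<rho>_def[abs_def])
  from polys_below_poly[OF this, of ?J] have "(\<lambda>v. poly ?J (\<rho> v)) \<in> polys_below (Suc (l * 2))"
    by (simp add: jacobi_orthonormal(1)[OF \<alpha>])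
  from polys_below_mult[OF this Re_power_polys_below[of "trig_factor \<epsilon>" j]]
  have in_below: "P_disk \<mu> k l \<epsilon> \<in> polys_below (Suc k)"
    unfolding P by (intro polys_below_scale) (simp add: k(2) mult.commute)
  have orth: "disk_inner \<mu> (P_disk \<mu> k l \<epsilon>) Q = 0" if Q: "Q \<in> polys_below k" for Q
  proof -
    have "dint (\<lambda>v. poly ?J (\<rho> v) * Re (trig_factor \<epsilon> * Z v ^ j * of_real (Q v))) = 0"
      using dint_jacobi_cspan[of l j "\<lambda>v. of_real (Q v)"] cspan_polys_below[OF Q] by (simp only: k(2))
    moreover have "P_disk \<mu> k l \<epsilon> v * Q v =
        P_scale l k * (poly ?J (\<rho> v) * Re (trig_factor \<epsilon> * Z v ^ j * of_real (Q v)))" for v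
      unfolding P by (simp add: algebra_simps)
    ultimately show ?thesis
      by (simp only: disk_inner_dint dint_scale mult_zero_right)
  qed
  have "P_disk \<mu> k l \<epsilon> \<notin> polys_below k"
  proof
    assume below: "P_disk \<mu> k l \<epsilon> \<in> polys_below k"
    \<comment> \<open>A direction in which the angular factor is 1, so that the degree can be read
      off on a ray. For the sine this needs j > 0, which \<open>adm_index\<close> ensures.\<close>
    define \<phi> where "\<phi> = (if \<epsilon> = 0 then 0 else pi / (2 * real j))"
    have one: "Re (trig_factor \<epsilon> * cis \<phi> ^ j) = 1"
    proof (cases "\<epsilon> = 0")
      case False
      then have "j > 0"
        using le k by (auto simp: adm_index_def)
      then have "real j * \<phi> = pi / 2"
        using False by (simp add: \<phi>_def)
      then have "sin (real j * \<phi>) = 1"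
        by (simp only: sin_pi_half)
      then show ?thesis
        using False by (simp add: trig_factor_def Complex.DeMoivre)
    qed (simp add: trig_factor_def \<phi>_def)
    obtain q where q: "\<forall>i\<ge>k. coeff q i = 0" "\<And>r. P_disk \<mu> k l \<epsilon> (r * cos \<phi>, r * sin \<phi>) = poly q r"
      using polys_below_ray[where c = "cos \<phi>" and d = "sin \<phi>", OF below] by blast
    have "P_disk \<mu> k l \<epsilon> (r * cos \<phi>, r * sin \<phi>) =
        poly (smult (P_scale l k) (pcompose ?J [:-1, 0, 2:] * monom 1 j)) r" for r
    proof -
      have "Z (r * cos \<phi>, r * sin \<phi>) = of_real r * cis \<phi>"
        by (simp add: Z_def complex_eq_iff)
      then have "Re (trig_factor \<epsilon> * Z (r * cos \<phi>, r * sin \<phi>) ^ j) = Re (of_real (r ^ j) * (trig_factor \<epsilon> * cis \<phi> ^ j))"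
        by (simp only: power_mult_distrib of_real_power mult.left_commute)
      also have "\<dots> = r ^ j"
        using one by (simp only: times_complex.sel Re_complex_of_real Im_complex_of_real
          mult_zero_left diff_0_right mult_1_right)
      finally have 1: "Re (trig_factor \<epsilon> * Z (r * cos \<phi>, r * sin \<phi>) ^ j) = r ^ j" .
      have "(r * cos \<phi>)\<^sup>2 + (r * sin \<phi>)\<^sup>2 = r\<^sup>2 * ((cos \<phi>)\<^sup>2 + (sin \<phi>)\<^sup>2)"
        by (simp only: power_mult_distrib distrib_left)
      then have "\<rho> (r * cos \<phi>, r * sin \<phi>) = poly [:-1, 0, 2:] r"
        by (simp add: \<rho>_def power2_eq_square)
      with 1 show ?thesis
        by (simp only: P poly_smult poly_mult poly_pcompose poly_monom mult_1_left)
    qed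
    then have "poly (smult (P_scale l k) (pcompose ?J [:-1, 0, 2:] * monom 1 j)) r = poly q r" for r
      using q(2) by simp
    then have eq: "smult (P_scale l k) (pcompose ?J [:-1, 0, 2:] * monom 1 j) = q"
      by (rule poly_ext)
    have nz: "pcompose ?J [:-1, 0, 2:] \<noteq> 0"
      using jacobi_orthonormal(2)[OF \<alpha>, of l] by (simp add: pcompose_eq_0_iff)
    \<comment> \<open>The composition with 2 r^2 - 1 contributes 2 l to the degree and r^j
      contributes j.\<close>
    have "degree (pcompose ?J [:-1, 0, 2:] * monom 1 j) = k"
      using nz by (subst degree_mult_eq)
        (simp_all add: degree_pcompose jacobi_orthonormal(1)[OF \<alpha>] degree_monom_eq k(2) monom_eq_0_iff)
    then have "degree q = k" and "q \<noteq> 0"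
      using eq nz P_scale_nonzero[of l k] by (auto simp: monom_eq_0_iff)
    then show False
      using q(1) by (metis leading_coeff_0_iff order_refl)
  qed
  then show ?thesis
    using in_below orth by (simp add: V_space_def)
qed

end


subsection \<open>Discrete orthogonality on the circle\<close>

text \<open>A geometric sum in powers of exp(2 pi i m/(n + 1)). The bound on \<open>m\<close>
  excludes nonzero multiples of n + 1, for which every term would be 1.\<close>

lemma sum_cis_nodes:
  fixes m :: int
  assumes "\<bar>m\<bar> \<le> int n"
  shows "(\<Sum>\<nu>=0..n. cis (2 * of_int m * (real \<nu> * pi / real (n + 1)))) =
    (if m = 0 then of_nat (n + 1) else 0)"
proof (cases "m = 0")
  case False
  define \<omega> where "\<omega> = cis (2 * of_int m * pi / real (n + 1))"
  have power: "cis (2 * of_int m * (real \<nu> * pi / real (n + 1))) = \<omega> ^ \<nu>" for \<nu>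
    by (simp add: \<omega>_def Complex.DeMoivre mult_ac)
  have "\<omega> \<noteq> 1"
  proof
    assume "\<omega> = 1"
    then have "cos (2 * of_int m * pi / real (n + 1)) = 1"
      by (simp add: \<omega>_def complex_eq_iff)
    then obtain i :: int where "2 * of_int m * pi / real (n + 1) = of_int i * 2 * pi"
      by (auto simp: cos_one_2pi_int)
    then have "(2 * pi) * real_of_int m = (2 * pi) * (of_int i * real (n + 1))"
      by (simp add: field_simps)
    then have "real_of_int m = of_int i * real (n + 1)"
      using pi_neq_zero by (simp only: mult_cancel_left) auto
    also have "\<dots> = real_of_int (i * int (n + 1))"
      by simp
    finally have "m = i * int (n + 1)"
      by (simp only: of_int_eq_iff)
    then have "int (n + 1) dvd m" by simp
    with False have "int (n + 1) \<le> \<bar>m\<bar>"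
      by (metis abs_of_nat dvd_imp_le_int)
    with assms show False by simp
  qed
  moreover have "\<omega> ^ Suc n = 1"
  proof -
    have "\<omega> ^ Suc n = cis (real (n + 1) * (2 * of_int m * pi / real (n + 1)))"
      by (simp only: \<omega>_def Complex.DeMoivre Suc_eq_plus1)
    also have "real (n + 1) * (2 * of_int m * pi / real (n + 1)) = 2 * pi * of_int m"
      by simp
    also have "cis (2 * pi * of_int m) = 1"
      by (rule cis_multiple_2pi) simp
    finally show ?thesis .
  qed
  ultimately show ?thesis
    using False sum_gp0[of \<omega> n] unfolding power by (simp add: atLeast0AtMost)
qed simp

lemma sum_cos_sin_nodes:
  fixes m :: int
  assumes "\<bar>m\<bar> \<le> int n"
  shows "(\<Sum>\<nu>=0..n. cos (2 * of_int m * (real \<nu> * pi / real (n + 1)))) = (if m = 0 then real (n + 1) else 0)"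
    and "(\<Sum>\<nu>=0..n. sin (2 * of_int m * (real \<nu> * pi / real (n + 1)))) = 0"
  using arg_cong[OF sum_cis_nodes[OF assms], of Re] arg_cong[OF sum_cis_nodes[OF assms], of Im]
  by (auto simp: Re_sum Im_sum split: if_splits)

text \<open>The product formulas produce the frequencies i + j and i - j, both even by the parity
  assumption, with halves between -n and n. The factor sqrt 2 in \<open>circ_harm\<close>
  compensates the mean 1/2 of squared cosines and sines, so the diagonal value is n + 1 for every
  frequency.\<close>

lemma circ_harm_orthogonal:
  assumes le: "i \<le> n" "j \<le> n" and even: "even (i + j)"
    and \<epsilon>: "\<epsilon> < 2" "\<delta> < 2" "\<epsilon> = 1 \<Longrightarrow> i > 0" "\<delta> = 1 \<Longrightarrow> j > 0"
  shows "(\<Sum>\<nu>=0..n. circ_harm i \<epsilon> (real \<nu> * pi / real (n + 1)) * circ_harm j \<delta> (real \<nu> * pi / real (n + 1))) =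
    (if i = j \<and> \<epsilon> = \<delta> then real (n + 1) else 0)"
proof -
  let ?x = "\<lambda>\<nu>. real \<nu> * pi / real (n + 1)"
  obtain s where s: "i + j = 2 * s"
    using even by (rule evenE)
  define p where "p = int s"
  define q where "q = int i - int s"
  have pq: "2 * real_of_int p = real i + real j" "2 * real_of_int q = real i - real j"
    using arg_cong[OF s, of real] by (simp_all add: p_def q_def)
  have bounds: "\<bar>p\<bar> \<le> int n" "\<bar>q\<bar> \<le> int n"
    using le s by (auto simp: p_def q_def)
  have zero: "p = 0 \<longleftrightarrow> i = 0 \<and> j = 0" "q = 0 \<longleftrightarrow> i = j"
    using s by (auto simp: p_def q_def)
  have cp: "(\<Sum>\<nu>=0..n. cos ((real i + real j) * ?x \<nu>)) = (if i = 0 \<and> j = 0 then real (n + 1) else 0)"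
    and sp: "(\<Sum>\<nu>=0..n. sin ((real i + real j) * ?x \<nu>)) = 0"
    using sum_cos_sin_nodes[OF bounds(1)] unfolding pq zero by auto
  have cq: "(\<Sum>\<nu>=0..n. cos ((real i - real j) * ?x \<nu>)) = (if i = j then real (n + 1) else 0)"
    and sq: "(\<Sum>\<nu>=0..n. sin ((real i - real j) * ?x \<nu>)) = 0"
    using sum_cos_sin_nodes[OF bounds(2)] unfolding pq zero by auto
  define c where "c = (if i = 0 then 1 else sqrt 2) * (if j = 0 then 1 else sqrt 2)"
  have prod: "(\<Sum>\<nu>=0..n. circ_harm i \<epsilon> (?x \<nu>) * circ_harm j \<delta> (?x \<nu>)) =
      c * (\<Sum>\<nu>=0..n. (if \<epsilon> = 0 then cos (real i * ?x \<nu>) else sin (real i * ?x \<nu>)) *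
        (if \<delta> = 0 then cos (real j * ?x \<nu>) else sin (real j * ?x \<nu>)))"
    unfolding circ_harm_def c_def sum_distrib_left by (intro sum.cong refl) (simp only: mult_ac)
  have half: "(\<Sum>\<nu>=0..n. (f \<nu> + g \<nu>) / 2) = ((\<Sum>\<nu>=0..n. f \<nu>) + (\<Sum>\<nu>=0..n. g \<nu>)) / 2"
    "(\<Sum>\<nu>=0..n. (f \<nu> - g \<nu>) / 2) = ((\<Sum>\<nu>=0..n. f \<nu>) - (\<Sum>\<nu>=0..n. g \<nu>)) / 2"
    for f g :: "nat \<Rightarrow> real"
    by (simp_all add: sum_divide_distrib[symmetric] sum.distrib sum_subtractf)
  consider "\<epsilon> = 0" "\<delta> = 0" | "\<epsilon> = 0" "\<delta> = 1" | "\<epsilon> = 1" "\<delta> = 0" | "\<epsilon> = 1" "\<delta> = 1"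
    using \<epsilon>(1,2) by linarith
  then show ?thesis
  proof cases
    case 1
    have *: "cos (real i * x) * cos (real j * x) = (cos ((real i - real j) * x) + cos ((real i + real j) * x)) / 2" for x
      by (simp add: cos_times_cos algebra_simps)
    have "(\<Sum>\<nu>=0..n. cos (real i * ?x \<nu>) * cos (real j * ?x \<nu>)) = ((if i = j then real (n + 1) else 0) + (if i = 0 \<and> j = 0 then real (n + 1) else 0)) / 2"
      by (simp only: * half cp cq)
    then show ?thesis
      unfolding prod using 1 by (simp only: refl if_True if_False one_neq_zero zero_neq_one) (auto simp: c_def)
  next
    case 2
    have *: "cos (real i * x) * sin (real j * x) = (sin ((real i + real j) * x) - sin ((real i - real j) * x)) / 2" for x
      by (simp add: cos_times_sin algebra_simps)
    have "(\<Sum>\<nu>=0..n. cos (real i * ?x \<nu>) * sin (real j * ?x \<nu>)) = (0 - 0) / 2"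
      by (simp only: * half sp sq)
    then show ?thesis
      unfolding prod using 2 by (simp only: refl if_True if_False one_neq_zero zero_neq_one) (auto simp: c_def)
  next
    case 3
    have *: "sin (real i * x) * cos (real j * x) = (sin ((real i + real j) * x) + sin ((real i - real j) * x)) / 2" for x
      by (simp only: sin_times_cos distrib_right left_diff_distrib)
    have "(\<Sum>\<nu>=0..n. sin (real i * ?x \<nu>) * cos (real j * ?x \<nu>)) = (0 + 0) / 2"
      by (simp only: * half sp sq)
    then show ?thesis
      unfolding prod using 3 by (simp only: refl if_True if_False one_neq_zero zero_neq_one) (auto simp: c_def)
  next
    case 4
    have *: "sin (real i * x) * sin (real j * x) = (cos ((real i - real j) * x) - cos ((real i + real j) * x)) / 2" for x
      by (simp add: sin_times_sin algebra_simps)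
    have "(\<Sum>\<nu>=0..n. sin (real i * ?x \<nu>) * sin (real j * ?x \<nu>)) = ((if i = j then real (n + 1) else 0) - (if i = 0 \<and> j = 0 then real (n + 1) else 0)) / 2"
      by (simp only: * half cp cq)
    then show ?thesis
      unfolding prod using 4 \<epsilon>(3,4) by (simp only: refl if_True if_False one_neq_zero zero_neq_one) (auto simp: c_def)
  qed
qed


subsection \<open>The kernel identity\<close>

text \<open>A vector of \<open>span T\<close> outside \<open>span S\<close> could be adjoined to
  \<open>S\<close>, giving an independent set larger than \<open>T\<close>. The count is relative to
  \<open>T\<close> because the ambient space of functions may be infinite-dimensional.\<close>

lemma (in vector_space) span_subset_of_card_le:
  assumes T: "finite T" and S: "independent S" "S \<subseteq> span T" and card: "card T \<le> card S"
  shows "span T \<subseteq> span S"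
proof
  fix x assume x: "x \<in> span T"
  show "x \<in> span S"
  proof (rule ccontr)
    assume nin: "x \<notin> span S"
    then have "independent (insert x S)"
      using S(1) by (simp add: independent_insert)
    moreover have "insert x S \<subseteq> span T"
      using x S(2) by simp
    ultimately have "card (insert x S) \<le> card T"
      using independent_span_bound[OF T] by blast
    moreover have "finite S" "x \<notin> S"
      using independent_span_bound[OF T S] nin span_base by auto
    ultimately show False
      using card by simp
  qed
qed

interpretation fun_space: vector_space "\<lambda>(a :: real) (F :: 'a \<Rightarrow> real) v. a * F v"
  by unfold_locales (auto simp: fun_eq_iff algebra_simps)

lemma sum_fun_apply: "(\<Sum>i\<in>A. F i) v = (\<Sum>i\<in>A. F i v)" for F :: "'i \<Rightarrow> 'a \<Rightarrow> real"
  by (induction A rule: infinite_finite_induct) simp_all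

text \<open>\<open>l\<close> and \<epsilon> are the quotient and the remainder by 2 of the numbers
  0, ..., k.\<close>

lemma card_adm_index: "card (adm_index k) = Suc k" and finite_adm_index: "finite (adm_index k)"
proof -
  have "bij_betw (\<lambda>(l, \<epsilon>). 2 * l + \<epsilon>) (adm_index k) {..k}"
    by (rule bij_betw_byWitness[where f' = "\<lambda>i. (i div 2, i mod 2)"])
      (auto simp: adm_index_def, presburger)
  then show "card (adm_index k) = Suc k" "finite (adm_index k)"
    using bij_betw_same_card bij_betw_finite by fastforce+
qed

section \<open>Dual functionals on the circle\<close>

context gegenbauer_weight
begin

lemma H_const_nonzero: "H_const \<mu> l k \<noteq> 0"
  using h_const_pos[of l k] jacobi_one_nonzero[of "\<mu> - 1/2" "real (k - 2 * l)" l] mu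
  by (simp add: H_const_def)

text \<open>For r = 1 the argument 2 r^2 - 1 equals 1, so the radial part reduces to the constant
  \<open>H_const\<close>.\<close>

lemma P_disk_circle:
  assumes "(l, \<epsilon>) \<in> adm_index k"
  shows "P_disk \<mu> k l \<epsilon> (cos \<xi>, sin \<xi>) = H_const \<mu> l k * circ_harm (k - 2 * l) \<epsilon> \<xi>"
proof -
  have k: "2 * l \<le> k"
    using assms by (auto simp: adm_index_def)
  have "\<rho> (cos \<xi>, sin \<xi>) = 1"
    by (simp add: \<rho>_def)
  moreover have "Z (cos \<xi>, sin \<xi>) = cis \<xi>"
    by (simp add: Z_def complex_eq_iff)
  moreover have "Re (trig_factor \<epsilon> * cis \<xi> ^ j) = (if \<epsilon> = 0 then cos (real j * \<xi>) else sin (real j * \<xi>))" for j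
    by (simp add: trig_factor_def Complex.DeMoivre)
  moreover have "k - 2 * l = 0 \<longleftrightarrow> k = 2 * l"
    using k by auto
  ultimately show ?thesis
    unfolding P_disk_eq[OF k] by (simp add: P_scale_def H_const_def circ_harm_def)
qed

text \<open>On the circle one of the two factors \<open>H_const\<close> in
  \<open>lambda_const\<close> cancels. The other one normalises the harmonics so that they are dual
  to \<open>P_disk\<close> under the mean over the nodes.\<close>

lemma D_angle_eq:
  "D_angle \<mu> k \<xi> v =
    (\<Sum>(l, \<epsilon>) \<in> adm_index k. circ_harm (k - 2 * l) \<epsilon> \<xi> / H_const \<mu> l k * P_disk \<mu> k l \<epsilon> v)"
  unfolding D_angle_def lambda_const_def
  by (intro sum.cong refl) (auto simp: P_disk_circle power2_eq_square)

lemma circ_harm_adm_orthogonal: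
  assumes "k \<le> n" "(l, \<epsilon>) \<in> adm_index k" "(l', \<epsilon>') \<in> adm_index k"
  shows "(\<Sum>\<nu>=0..n. circ_harm (k - 2 * l) \<epsilon> (real \<nu> * pi / real (n + 1)) *
      circ_harm (k - 2 * l') \<epsilon>' (real \<nu> * pi / real (n + 1))) =
    (if (l, \<epsilon>) = (l', \<epsilon>') then real (n + 1) else 0)"
proof -
  have l: "2 * l \<le> k" "2 * l' \<le> k"
    using assms by (auto simp: adm_index_def)
  then have "(k - 2 * l) + (k - 2 * l') = 2 * (k - l - l')"
    by simp
  then have even: "even ((k - 2 * l) + (k - 2 * l'))"
    by (metis dvd_triv_left)
  have "k - 2 * l = k - 2 * l' \<longleftrightarrow> l = l'"
    using l by auto
  then show ?thesis
    using circ_harm_orthogonal[of "k - 2 * l" n "k - 2 * l'" \<epsilon> \<epsilon>', OF _ _ even] assms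
    by (auto simp: adm_index_def)
qed

text \<open>
  The functionals \<open>Q \<mapsto> \<Sum>\<^sub>\<nu> Q(e\<^sub>\<nu>) S(\<xi>\<^sub>\<nu>) / (n + 1)\<close> are dual to the Jacobi basis up to scaling, so
  that basis is independent and, having \<open>k + 1\<close> elements, spans the space of degree \<open>k\<close>.
\<close>

lemma D_angle_reconstruct:
  assumes k: "k \<le> n" and B: "onb_V \<mu> k B" and i: "i \<le> k"
  shows "(\<Sum>\<nu>=0..n. B i (cos (real \<nu> * pi / real (n + 1)), sin (real \<nu> * pi / real (n + 1))) *
      D_angle \<mu> k (real \<nu> * pi / real (n + 1)) v) = real (n + 1) * B i v"
proof -
  let ?x = "\<lambda>\<nu>. real \<nu> * pi / real (n + 1)"
  define P where "P q = P_disk \<mu> k (fst q) (snd q)" for q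
  define S where "S q = circ_harm (k - 2 * fst q) (snd q)" for q
  define H where "H q = H_const \<mu> (fst q) k" for q :: "nat \<times> nat"
  define \<phi> where "\<phi> q Q = (\<Sum>\<nu>=0..n. Q (cos (?x \<nu>), sin (?x \<nu>)) * S q (?x \<nu>))" for q Q
  have H: "H q \<noteq> 0" for q
    using H_const_nonzero by (simp add: H_def)
  have dual: "\<phi> q (P q') = (if q = q' then real (n + 1) * H q else 0)"
    if "q \<in> adm_index k" "q' \<in> adm_index k" for q q'
  proof -
    have "\<phi> q (P q') = H q' * (\<Sum>\<nu>=0..n. S q' (?x \<nu>) * S q (?x \<nu>))"
      using that P_disk_circle[of "fst q'" "snd q'" k]
      by (simp add: \<phi>_def P_def S_def H_def sum_distrib_left mult.assoc)
    then show ?thesis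
      using that circ_harm_adm_orthogonal[OF k, of "fst q'" "snd q'" "fst q" "snd q"]
      by (auto simp: S_def)
  qed
  have inj: "inj_on P (adm_index k)"
  proof (rule inj_onI, rule ccontr)
    fix q q' assume q: "q \<in> adm_index k" "q' \<in> adm_index k" "P q = P q'" "q \<noteq> q'"
    have "real (n + 1) * H q = \<phi> q (P q)"
      using dual[OF q(1,1)] by simp
    also have "\<dots> = 0"
      unfolding q(3) using dual[OF q(1,2)] q(4) by simp
    finally show False
      using H[of q] by simp
  qed
  have ind: "fun_space.independent (P ` adm_index k)"
  proof (rule fun_space.independent_if_scalars_zero)
    show "finite (P ` adm_index k)"
      using finite_adm_index by simp
    fix f F assume sum0: "(\<Sum>F\<in>P ` adm_index k. (\<lambda>v. f F * F v)) = 0" and "F \<in> P ` adm_index k"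
    then obtain q where q: "q \<in> adm_index k" "F = P q" by blast
    have "(\<Sum>q\<in>adm_index k. f (P q) * P q v) = 0" for v
      using fun_cong[OF sum0, of v] by (simp add: sum_fun_apply sum.reindex[OF inj])
    then have "\<phi> q (\<lambda>v. \<Sum>q'\<in>adm_index k. f (P q') * P q' v) = 0"
      by (simp add: \<phi>_def)
    also have "\<phi> q (\<lambda>v. \<Sum>q'\<in>adm_index k. f (P q') * P q' v) =
        (\<Sum>q'\<in>adm_index k. f (P q') * \<phi> q (P q'))"
      unfolding \<phi>_def sum_distrib_right sum_distrib_left by (subst sum.swap) (simp only: mult.assoc)
    also have "\<dots> = (\<Sum>q'\<in>adm_index k. if q' = q then f (P q) * (real (n + 1) * H q) else 0)"
      using q(1) dual by (intro sum.cong) auto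
    also have "\<dots> = f (P q) * (real (n + 1) * H q)"
      using q(1) finite_adm_index by simp
    finally show "f F = 0"
      using H[of q] q(2) by simp
  qed
  have "P ` adm_index k \<subseteq> fun_space.span (B ` {..k})"
  proof (rule image_subsetI)
    fix q assume "q \<in> adm_index k"
    then have "P q \<in> V_space \<mu> k"
      by (cases q) (simp add: P_def P_disk_V_space)
    then obtain c where "\<And>v. P q v = (\<Sum>j\<le>k. c j * B j v)"
      using B unfolding onb_V_def by blast
    then have "P q = (\<Sum>j\<le>k. (\<lambda>v. c j * B j v))"
      by (simp add: fun_eq_iff sum_fun_apply)
    then show "P q \<in> fun_space.span (B ` {..k})"
      by (simp only:) (intro fun_space.span_sum fun_space.span_scale fun_space.span_base imageI)
  qed
  moreover have "card (B ` {..k}) \<le> card (P ` adm_index k)"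
    using card_image_le[of "{..k}" B] by (simp add: card_image[OF inj] card_adm_index)
  ultimately have "fun_space.span (B ` {..k}) \<subseteq> fun_space.span (P ` adm_index k)"
    by (intro fun_space.span_subset_of_card_le ind) auto
  moreover have "B i \<in> fun_space.span (B ` {..k})"
    using i by (intro fun_space.span_base) simp
  \<comment> \<open>The claim is linear in the polynomial, so it passes from the Jacobi basis to its
    span and thus to \<open>B i\<close>.\<close>
  moreover define X where
    "X = {Q. \<forall>v. (\<Sum>\<nu>=0..n. Q (cos (?x \<nu>), sin (?x \<nu>)) * D_angle \<mu> k (?x \<nu>) v) = real (n + 1) * Q v}"
  have "fun_space.subspace X"
    unfolding fun_space.subspace_def X_def
    by (auto simp: distrib_right distrib_left sum.distrib mult.assoc sum_distrib_left[symmetric])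
  moreover have "P ` adm_index k \<subseteq> X"
  proof (rule image_subsetI)
    fix q assume q: "q \<in> adm_index k"
    have "(\<Sum>\<nu>=0..n. P q (cos (?x \<nu>), sin (?x \<nu>)) * D_angle \<mu> k (?x \<nu>) v) = real (n + 1) * P q v" for v
    proof -
      have "D_angle \<mu> k \<xi> v = (\<Sum>q'\<in>adm_index k. S q' \<xi> / H q' * P q' v)" for \<xi>
        by (simp add: D_angle_eq S_def H_def P_def case_prod_unfold)
      then have "(\<Sum>\<nu>=0..n. P q (cos (?x \<nu>), sin (?x \<nu>)) * D_angle \<mu> k (?x \<nu>) v) =
          (\<Sum>\<nu>=0..n. \<Sum>q'\<in>adm_index k. (P q' v / H q') * (P q (cos (?x \<nu>), sin (?x \<nu>)) * S q' (?x \<nu>)))"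
        by (simp only: sum_distrib_left) (intro sum.cong refl, simp)
      also have "\<dots> = (\<Sum>q'\<in>adm_index k. (P q' v / H q') * \<phi> q' (P q))"
        unfolding \<phi>_def sum_distrib_left by (rule sum.swap)
      also have "\<dots> = (\<Sum>q'\<in>adm_index k. if q' = q then real (n + 1) * P q v else 0)"
        using q dual H by (intro sum.cong) auto
      also have "\<dots> = real (n + 1) * P q v"
        using q finite_adm_index by simp
      finally show ?thesis .
    qed
    then show "P q \<in> X"
      by (simp add: X_def)
  qed
  ultimately have "B i \<in> X"
    using fun_space.span_minimal by blast
  then show ?thesis
    unfolding X_def by blast
qed

text \<open>The prefactor in \<open>D_kernel\<close> cancels \<open>zonal_norm\<close>, which leaves
  the kernel between \<open>u\<close> and a node; \<open>D_angle_reconstruct\<close> then replaces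
  the values at the nodes by the value at the free point \<open>v\<close>.\<close>

lemma reproducing_kernel_nodes:
  assumes k: "k \<le> n" and B: "onb_V \<mu> k B"
  shows "real (n + 1) * (\<Sum>j\<le>k. B j u * B j v) =
    (\<Sum>\<nu>=0..n. D_kernel \<mu> k (real \<nu> * pi / real (n + 1))
      (cos (real \<nu> * pi / real (n + 1)) * fst u + sin (real \<nu> * pi / real (n + 1)) * snd u) v)"
proof -
  let ?x = "\<lambda>\<nu>. real \<nu> * pi / real (n + 1)"
  have "(real k + \<mu> + 1/2) / (\<mu> + 1/2) * poly (C k) (cos \<xi> * fst u + sin \<xi> * snd u) =
      (\<Sum>j\<le>k. B j (cos \<xi>, sin \<xi>) * B j u)" for \<xi>
  proof -
    have "(real k + \<mu> + 1/2) / (\<mu> + 1/2) * zonal_norm k = 1"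
      using mu zonal_norm_pos[of k] by (simp add: zonal_norm_def)
    moreover have "poly (C k) (cos \<xi> * fst u + sin \<xi> * snd u) =
        zonal_norm k * (\<Sum>j\<le>k. B j (cos \<xi>, sin \<xi>) * B j u)"
      using reproducing_kernel_circle[OF B, of "cos \<xi>" "sin \<xi>" "fst u" "snd u"] by simp
    ultimately show ?thesis
      by (simp only: mult.assoc[symmetric] mult_1_left)
  qed
  then have "(\<Sum>\<nu>=0..n. D_kernel \<mu> k (?x \<nu>) (cos (?x \<nu>) * fst u + sin (?x \<nu>) * snd u) v) =
      (\<Sum>\<nu>=0..n. (\<Sum>j\<le>k. B j (cos (?x \<nu>), sin (?x \<nu>)) * B j u) * D_angle \<mu> k (?x \<nu>) v)"
    by (simp only: D_kernel_def gegenbauer_eq)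
  also have "\<dots> = (\<Sum>j\<le>k. B j u * (\<Sum>\<nu>=0..n. B j (cos (?x \<nu>), sin (?x \<nu>)) * D_angle \<mu> k (?x \<nu>) v))"
    unfolding sum_distrib_right sum_distrib_left by (subst sum.swap) (simp only: mult_ac)
  also have "\<dots> = (\<Sum>j\<le>k. B j u * (real (n + 1) * B j v))"
    using D_angle_reconstruct[OF k B] by (intro sum.cong) auto
  also have "\<dots> = real (n + 1) * (\<Sum>j\<le>k. B j u * B j v)"
    by (simp add: sum_distrib_left mult_ac)
  finally show ?thesis ..
qed

end


subsection \<open>Integration over the cylinder\<close>

lemma AE_lborel_snd:
  assumes "AE y in lborel. Q y"
  shows "AE v in (lborel :: ('a::euclidean_space \<times> 'b::euclidean_space) measure). Q (snd v)"
proof -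
  obtain N where N: "N \<in> null_sets lborel" "{y. \<not> Q y} \<subseteq> N"
    using assms unfolding eventually_ae_filter by auto
  have meas: "{v :: 'a \<times> 'b. snd v \<notin> N} \<in> sets borel"
  proof -
    have "snd \<in> borel_measurable (borel :: ('a \<times> 'b) measure)"
      by (intro borel_measurable_continuous_onI continuous_intros)
    from measurable_sets[OF this, of "- N"] show ?thesis
      using N(1) by (auto simp: vimage_def null_sets_def)
  qed
  have "AE x in (lborel :: 'a measure). AE y in lborel. snd (x, y) \<notin> N"
    using AE_not_in[OF N(1)] by simp
  then have "AE v in (lborel :: ('a \<times> 'b) measure). snd v \<notin> N"
    using lborel_pair.AE_pair_measure[of "\<lambda>v. snd v \<notin> N"] meas unfolding lborel_prod by simp
  then show ?thesis
    by eventually_elim (use N(2) in auto)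
qed

lemma compact_cylinder: "compact (cylinder L)"
proof -
  have "cylinder L = (\<lambda>(v, z). (fst v, snd v, z)) ` (disk \<times> {0..L})"
    by (force simp: cylinder_def)
  moreover have "compact ((\<lambda>(v, z). (fst v, snd v, z)) ` (disk \<times> {0..L}))"
    unfolding case_prod_unfold
    by (intro compact_continuous_image compact_Times compact_disk compact_Icc continuous_intros)
  ultimately show ?thesis by simp
qed

lemma lborel_Fubini_integrable:
  fixes G :: "'a::euclidean_space \<times> 'b::euclidean_space \<Rightarrow> real"
  assumes "G \<in> borel_measurable borel"
    and "integrable lborel (\<lambda>x. LINT y|lborel. norm (G (x, y)))"
    and "AE x in lborel. integrable lborel (\<lambda>y. G (x, y))"
  shows "integrable lborel G"
  using lborel_pair.Fubini_integrable[of G] assms unfolding lborel_prod by simp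

lemma borel_measurable_fst_snd:
  fixes f :: "'a::euclidean_space \<Rightarrow> 'c::topological_space" and g :: "'b::euclidean_space \<Rightarrow> 'c"
  shows "f \<in> borel_measurable borel \<Longrightarrow> (\<lambda>v :: 'a \<times> 'b. f (fst v)) \<in> borel_measurable borel"
    and "g \<in> borel_measurable borel \<Longrightarrow> (\<lambda>v :: 'a \<times> 'b. g (snd v)) \<in> borel_measurable borel"
  by (rule measurable_compose[rotated], assumption,
      intro borel_measurable_continuous_onI continuous_intros)+

lemma integrable_lborel_product:
  fixes f :: "'a::euclidean_space \<Rightarrow> real" and g :: "'b::euclidean_space \<Rightarrow> real"
  assumes f: "integrable lborel f" and g: "integrable lborel g"
  shows "integrable lborel (\<lambda>v. f (fst v) * g (snd v))"
proof (rule lborel_Fubini_integrable)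
  have "f \<in> borel_measurable borel" "g \<in> borel_measurable borel"
    using borel_measurable_integrable[OF f] borel_measurable_integrable[OF g] by simp_all
  then show "(\<lambda>v. f (fst v) * g (snd v)) \<in> borel_measurable borel"
    by (intro borel_measurable_times borel_measurable_fst_snd)
  show "integrable lborel (\<lambda>x. LINT y|lborel. norm (f (fst (x, y)) * g (snd (x, y))))"
    using f by (simp add: abs_mult)
  show "AE x in lborel. integrable lborel (\<lambda>y. f (fst (x, y)) * g (snd (x, y)))"
    using g by simp
qed

text \<open>\<open>W\<close> is only Lebesgue measurable, hence the Borel representative
  \<open>g\<close>. As points are nested as (x, (y, z)), the product of h (x, y) and g z is
  integrated over (y, z) for fixed x, where it splits.\<close>

lemma W_cyl_integrable:
  assumes "\<mu> \<ge> 0" and W: "weight_function L W"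
  shows "set_integrable lebesgue (cylinder L) (W_cyl \<mu> W)"
proof -
  let ?w = "\<lambda>z. indicator {0..L} z * W z"
  have "set_integrable lebesgue {0..L} (\<lambda>z. z ^ 0 * W z)"
    using W unfolding weight_function_def by blast
  then have w: "integrable lebesgue ?w"
    by (simp add: set_integrable_def)
  obtain g where g: "g \<in> borel_measurable borel" "AE z in lborel. ?w z = g z"
    using borel_representative borel_measurable_integrable[OF w] by blast
  have g_int: "integrable lborel g"
    using w lebesgue_eq_AE_borel(2)[OF g] by simp
  define h where "h v = indicator disk v * W_disk \<mu> v" for v
  have h: "h \<in> borel_measurable borel"
    unfolding h_def by (intro borel_measurable_times borel_measurable_indicator disk_sets W_disk_borel)
  have h_int: "integrable lborel h"
    using W_disk_integrable(1)[OF assms(1)] set_lebesgue_lborel(1)[OF W_disk_borel disk_sets, of \<mu>]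
    by (simp add: h_def[abs_def])
  have h0: "0 \<le> h v" for v
    by (simp add: h_def W_disk_def case_prod_unfold)
  define G where "G v = h (fst v, fst (snd v)) * g (snd (snd v))" for v :: "real \<times> real \<times> real"
  have "(\<lambda>v :: real \<times> real \<times> real. (fst v, fst (snd v))) \<in> borel_measurable borel"
    by (intro borel_measurable_continuous_onI continuous_intros)
  then have G: "G \<in> borel_measurable borel"
    unfolding G_def[abs_def]
    by (intro borel_measurable_times measurable_compose[OF _ h] borel_measurable_fst_snd g(1))
  have slice: "AE x in lborel. integrable lborel (\<lambda>y. h (x, y))"
    and h_fst: "integrable lborel (\<lambda>x. LINT y|lborel. h (x, y))"
    using lborel_integral_pair(2)[OF h_int] lborel_pair.integrable_fst'[of h] h_int
    unfolding lborel_prod by simp_all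
  have "integrable lborel G"
  proof (rule lborel_Fubini_integrable[OF G])
    show "AE x in lborel. integrable lborel (\<lambda>q. G (x, q))"
      using slice
    proof eventually_elim
      case (elim x)
      from integrable_lborel_product[OF this g_int] show ?case
        by (simp add: G_def)
    qed
    have "(\<lambda>v. norm (G v)) \<in> borel_measurable borel"
      using G by measurable
    then have m: "(\<lambda>x. LINT q|lborel. norm (G (x, q))) \<in> borel_measurable lborel"
      using borel_measurable_LINT_pair by simp
    have "AE x in lborel. (LINT q|lborel. norm (G (x, q))) =
        (LINT y|lborel. h (x, y)) * (LINT z|lborel. \<bar>g z\<bar>)"
      using slice
    proof eventually_elim
      case (elim x)
      have "integrable lborel (\<lambda>q. h (x, fst q) * \<bar>g (snd q)\<bar>)"
        using integrable_lborel_product[OF elim integrable_abs[OF g_int]] .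
      from lborel_integral_pair(1)[OF this] show ?case
        using h0 by (simp add: G_def abs_mult)
    qed
    moreover have "integrable lborel (\<lambda>x. (LINT y|lborel. h (x, y)) * (LINT z|lborel. \<bar>g z\<bar>))"
      using h_fst by simp
    ultimately show "integrable lborel (\<lambda>x. LINT q|lborel. norm (G (x, q)))"
      using m borel_measurable_integrable integrable_cong_AE by blast
  qed
  moreover have "AE v in lborel. indicator (cylinder L) v * W_cyl \<mu> W v = G v"
    using AE_lborel_snd[OF AE_lborel_snd[OF g(2)]]
  proof eventually_elim
    case (elim v)
    then show ?case
      by (cases v) (auto simp: G_def h_def W_cyl_def cylinder_def indicator_def)
  qed
  ultimately show ?thesis
    using lebesgue_eq_AE_borel(2)[OF G] by (simp add: set_integrable_def)
qed

text \<open>By |f| <= 1 + f^2 and the finite mass of the weight, \<open>f\<close> times the weight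
  is integrable; \<open>g\<close> is bounded on the compact cylinder.\<close>

lemma L2_mult_integrable:
  assumes mu: "\<mu> \<ge> 0" and W: "weight_function L W"
    and f: "f \<in> L2_space (W_cyl \<mu> W) (cylinder L)"
    and g: "continuous_on UNIV g"
  shows "set_integrable lebesgue (cylinder L) (\<lambda>v. f v * g v * W_cyl \<mu> W v)"
proof -
  let ?A = "cylinder L" and ?w = "W_cyl \<mu> W"
  have w: "integrable lebesgue (\<lambda>v. indicator ?A v * ?w v)"
    using W_cyl_integrable[OF mu W] by (simp add: set_integrable_def)
  have f2: "integrable lebesgue (\<lambda>v. indicator ?A v * ((f v)\<^sup>2 * ?w v))"
    and fm: "(\<lambda>v. indicator ?A v * f v) \<in> borel_measurable lebesgue"
    using f by (simp_all add: L2_space_def set_integrable_def set_borel_measurable_def)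
  have w0: "0 \<le> ?w v" if "v \<in> ?A" for v
    using that W by (auto simp: W_cyl_def W_disk_def cylinder_def weight_function_def)
  \<comment> \<open>\<open>f\<close> and the weight are known to be measurable only on the cylinder,
    so each carries its own indicator.\<close>
  have "(\<lambda>v. (indicator ?A v * f v) * (indicator ?A v * ?w v)) \<in> borel_measurable lebesgue"
    using fm borel_measurable_integrable[OF w] by (rule borel_measurable_times)
  then have m: "(\<lambda>v. indicator ?A v * (f v * ?w v)) \<in> borel_measurable lebesgue"
    by (rule back_subst[of "\<lambda>h. h \<in> borel_measurable lebesgue"]) (auto simp: fun_eq_iff indicator_def)
  have "integrable lebesgue (\<lambda>v. indicator ?A v * (f v * ?w v))"
  proof (rule Bochner_Integration.integrable_bound[OF _ m])
    show "integrable lebesgue (\<lambda>v. indicator ?A v * ?w v + indicator ?A v * ((f v)\<^sup>2 * ?w v))"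
      using w f2 by (rule Bochner_Integration.integrable_add)
    have "norm (indicator ?A v * (f v * ?w v)) \<le>
        norm (indicator ?A v * ?w v + indicator ?A v * ((f v)\<^sup>2 * ?w v))" for v
    proof (cases "v \<in> ?A")
      case True
      have "2 * \<bar>f v\<bar> \<le> 1 + (f v)\<^sup>2"
        using sum_squares_bound[of "\<bar>f v\<bar>" 1] by simp
      then have "\<bar>f v\<bar> \<le> 1 + (f v)\<^sup>2"
        by (smt (verit) abs_ge_zero)
      then have "\<bar>f v\<bar> * ?w v \<le> (1 + (f v)\<^sup>2) * ?w v"
        using w0[OF True] by (rule mult_right_mono)
      then show ?thesis
        using True w0[OF True] by (simp add: abs_mult algebra_simps)
    qed simp
    then show "AE v in lebesgue. norm (indicator ?A v * (f v * ?w v)) \<le>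
        norm (indicator ?A v * ?w v + indicator ?A v * ((f v)\<^sup>2 * ?w v))"
      by simp
  qed
  then have "set_integrable lebesgue ?A (\<lambda>v. f v * ?w v)"
    by (simp add: set_integrable_def)
  from set_integrable_continuous_mult[OF this g compact_cylinder] show ?thesis
    by (simp only: mult_ac)
qed

text \<open>In the rotated coordinates \<Psi> depends only on t and w, so it leaves the integral
  over s; what remains of that integral is the Radon projection.\<close>

lemma cylinder_radon:
  assumes cd: "c = cos \<xi>" "d = sin \<xi>"
    and int: "set_integrable lebesgue (cylinder L)
      (\<lambda>v. f v * \<Psi> (snd (snd v)) (c * fst v + d * fst (snd v)) * W_cyl \<mu> W v)"
  shows "(LINT v:cylinder L|lebesgue. f v * \<Psi> (snd (snd v)) (c * fst v + d * fst (snd v)) * W_cyl \<mu> W v) =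
    (LINT t:{-1..1}|lebesgue. LINT w:{0..L}|lebesgue.
      radon \<mu> \<xi> (\<lambda>(x, y). f (x, y, w)) t * \<Psi> w t * W w)"
proof -
  have one: "c\<^sup>2 + d\<^sup>2 = 1"
    by (simp add: cd)
  let ?F = "\<lambda>v. indicator (cylinder L) v * (f v * \<Psi> (snd (snd v)) (c * fst v + d * fst (snd v)) * W_cyl \<mu> W v)"
  have F: "integrable lebesgue ?F"
    using int by (simp add: set_integrable_def)
  let ?T = "\<lambda>(t, w, s). (t * c - s * d, t * d + s * c, w)"
  have FT: "integrable lebesgue (\<lambda>v. ?F (?T v))" "(LINT v|lebesgue. ?F (?T v)) = integral\<^sup>L lebesgue ?F"
    using lebesgue_rotation_cylinder[OF one F] by (simp_all only: case_prod_unfold)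
  have point: "?F (?T (t, w, s)) = indicator {-1..1} t * (indicator {0..L} w * ((\<Psi> w t * W w) *
      (indicator {- sqrt (1 - t\<^sup>2)..sqrt (1 - t\<^sup>2)} s *
        (f (t * c - s * d, t * d + s * c, w) * (1 - s\<^sup>2 - t\<^sup>2) powr (\<mu> - 1/2)))))" for t w s
  proof -
    have "(t * c - s * d)\<^sup>2 + (t * d + s * c)\<^sup>2 = (t\<^sup>2 + s\<^sup>2) * (c\<^sup>2 + d\<^sup>2)"
      by algebra
    then have norm: "(t * c - s * d)\<^sup>2 + (t * d + s * c)\<^sup>2 = t\<^sup>2 + s\<^sup>2"
      by (simp add: one)
    have "c * (t * c - s * d) + d * (t * d + s * c) = (c\<^sup>2 + d\<^sup>2) * t"
      by algebra
    then have t: "c * (t * c - s * d) + d * (t * d + s * c) = t"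
      by (simp add: one)
    \<comment> \<open>Also right for |t| > 1: \<open>sqrt\<close> of a negative number is negative,
      so the interval for \<open>s\<close> is empty.\<close>
    have ind: "t\<^sup>2 + s\<^sup>2 \<le> 1 \<longleftrightarrow> t \<in> {-1..1} \<and> s \<in> {- sqrt (1 - t\<^sup>2)..sqrt (1 - t\<^sup>2)}"
    proof -
      have "s \<in> {- sqrt (1 - t\<^sup>2)..sqrt (1 - t\<^sup>2)} \<longleftrightarrow> \<bar>s\<bar> \<le> sqrt (1 - t\<^sup>2)"
        by (auto simp: abs_le_iff)
      also have "\<dots> \<longleftrightarrow> s\<^sup>2 \<le> 1 - t\<^sup>2"
        by (metis real_sqrt_abs real_sqrt_le_iff)
      finally have s: "s \<in> {- sqrt (1 - t\<^sup>2)..sqrt (1 - t\<^sup>2)} \<longleftrightarrow> t\<^sup>2 + s\<^sup>2 \<le> 1"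
        by linarith
      have "t \<in> {-1..1}" if "t\<^sup>2 + s\<^sup>2 \<le> 1"
      proof -
        have "t\<^sup>2 \<le> t\<^sup>2 + s\<^sup>2" by simp
        with that have "t\<^sup>2 \<le> 1" by (rule order_trans[rotated])
        then show ?thesis by (simp add: abs_square_le_1 abs_le_iff)
      qed
      with s show ?thesis by blast
    qed
    have "W_disk \<mu> (t * c - s * d, t * d + s * c) = (1 - s\<^sup>2 - t\<^sup>2) powr (\<mu> - 1/2)"
      using norm by (simp add: W_disk_def diff_diff_eq add.commute)
    moreover have "indicator (cylinder L) (t * c - s * d, t * d + s * c, w) =
        (indicator {-1..1} t * (indicator {0..L} w * indicator {- sqrt (1 - t\<^sup>2)..sqrt (1 - t\<^sup>2)} s) :: real)"
      using ind by (auto simp: cylinder_def disk_def norm indicator_def)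
    ultimately show ?thesis
      by (simp only: case_prod_conv fst_conv snd_conv t W_cyl_def) (simp only: mult_ac)
  qed
  have "(LINT v:cylinder L|lebesgue. f v * \<Psi> (snd (snd v)) (c * fst v + d * fst (snd v)) * W_cyl \<mu> W v) =
      (LINT v|lebesgue. ?F (?T v))"
    unfolding FT(2) by (simp add: set_lebesgue_integral_def)
  also have "\<dots> = (LINT t|lebesgue. LINT w|lebesgue. LINT s|lebesgue. ?F (?T (t, w, s)))"
    using FT(1) by (rule lebesgue_integral_triple)
  also have "\<dots> = (LINT t:{-1..1}|lebesgue. LINT w:{0..L}|lebesgue.
      radon \<mu> \<xi> (\<lambda>(x, y). f (x, y, w)) t * \<Psi> w t * W w)"
    unfolding point integral_mult_right_zero
    by (simp add: set_lebesgue_integral_def radon_def cd mult_ac)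
  finally show ?thesis .
qed

section \<open>Assembly of the reconstruction formula\<close>

lemma sum_triangle_swap:
  fixes G :: "nat \<Rightarrow> nat \<Rightarrow> real"
  shows "(\<Sum>l=0..n. \<Sum>k=0..l. G k (l - k)) = (\<Sum>k=0..n. \<Sum>m=0..n - k. G k m)"
proof -
  have "(SIGMA k:{0..n}. {0..n - k}) = {(k, m). k + m \<le> n}"
    by auto
  then have "(\<Sum>k=0..n. \<Sum>m=0..n - k. G k m) = (\<Sum>(k, m)\<in>{(k, m). k + m \<le> n}. G k m)"
    by (simp add: sum.Sigma)
  then show ?thesis
    by (simp add: sum.triangle_reindex_eq atLeast0AtMost)
qed

theorem theorem5p2:
  fixes \<mu> L :: real and W :: "real \<Rightarrow> real" and n :: nat
    and p :: "nat \<Rightarrow> real poly"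
    and B :: "nat \<Rightarrow> nat \<Rightarrow> real \<times> real \<Rightarrow> real"
    and f :: "real \<times> real \<times> real \<Rightarrow> real"
    and v :: "real \<times> real \<times> real"
  assumes "\<mu> \<ge> 0"
    and "L > 0"
    and "weight_function L W"
    and "orthonormal_polys {0..L} W p"
    and "\<And>k. onb_V \<mu> k (B k)"
    and "f \<in> L2_space (W_cyl \<mu> W) (cylinder L)"
    and "v \<in> cylinder L"
  shows "partial_sum \<mu> L W B p n f v =
    1 / real (n + 1) *
      (\<Sum>\<nu>=0..n. let \<xi> = real \<nu> * pi / real (n + 1) in
         a_const \<mu> *
         (LINT t:{-1..1}|lebesgue. LINT w:{0..L}|lebesgue.
            radon \<mu> \<xi> (\<lambda>(x, y). f (x, y, w)) t * Phi_kernel \<mu> p n \<xi> w t v * W w))"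
proof -
  interpret gegenbauer_weight \<mu>
    by unfold_locales (rule assms(1))
  obtain x1 x2 x3 where v: "v = (x1, x2, x3)"
    by (cases v)
  \<comment> \<open>A Fourier coefficient without \<open>a_const\<close>. Additivity rests on the
    integrability of each product with \<open>f\<close>, which is why continuity is tracked
    below.\<close>
  define I where "I g = (LINT u:cylinder L|lebesgue. f u * g u * W_cyl \<mu> W u)" for g
  note int = L2_mult_integrable[OF assms(1,3,6)]
  have I_add: "I (\<lambda>u. g u + h u) = I g + I h"
    if "continuous_on UNIV g" "continuous_on UNIV h" for g h
    unfolding I_def distrib_left distrib_right by (intro set_integral_add int that)
  have I_scale: "I (\<lambda>u. c * g u) = c * I g" for c g
  proof -
    have "I (\<lambda>u. c * g u) = (LINT u:cylinder L|lebesgue. c * (f u * g u * W_cyl \<mu> W u))"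
      unfolding I_def by (simp only: mult_ac)
    then show ?thesis
      by (simp only: set_integral_mult_right I_def)
  qed
  have I_sum: "I (\<lambda>u. \<Sum>i\<in>A. g i u) = (\<Sum>i\<in>A. I (g i))"
    if "finite A" "\<And>i. i \<in> A \<Longrightarrow> continuous_on UNIV (g i)" for A :: "nat set" and g
    using that
  proof (induction A rule: finite_induct)
    case empty
    then show ?case using I_scale[of 0 "\<lambda>_. 0"] by simp
  next
    case (insert a A)
    then show ?case by (simp add: I_add continuous_on_sum)
  qed
  have cont_B: "continuous_on UNIV (B k j)" if "j \<le> k" for k j
  proof -
    have "B k j \<in> V_space \<mu> k"
      using assms(5)[of k] that by (simp add: onb_V_def)
    then show ?thesis
      using V_spaceD(1) polys_below_continuous by blast
  qed
  have cont_P: "continuous_on UNIV (P_cyl B p l k j)" if "j \<le> k" for l k j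
    unfolding P_cyl_def case_prod_unfold
    by (intro continuous_intros continuous_on_compose2[OF cont_B[OF that]]) auto
  define q where "q k w = (\<Sum>m=0..n - k. poly (p m) w * poly (p m) x3)" for k w
  define \<Phi> where "\<Phi> \<nu> w t = Phi_kernel \<mu> p n (real \<nu> * pi / real (n + 1)) w t v" for \<nu> w t
  let ?c = "\<lambda>\<nu>. cos (real \<nu> * pi / real (n + 1))" and ?s = "\<lambda>\<nu>. sin (real \<nu> * pi / real (n + 1))"
  \<comment> \<open>The kernel as a function on the cylinder: \<open>t\<close> becomes the
    coordinate of the point in the direction of the node, the form that
    \<open>cylinder_radon\<close> accepts.\<close>
  define \<Psi> where "\<Psi> \<nu> u = \<Phi> \<nu> (snd (snd u)) (?c \<nu> * fst u + ?s \<nu> * fst (snd u))"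
    for \<nu> and u :: "real \<times> real \<times> real"
  have cont_\<Psi>: "continuous_on UNIV (\<Psi> \<nu>)" for \<nu>
    unfolding \<Psi>_def[abs_def] \<Phi>_def Phi_kernel_def v case_prod_conv D_kernel_def
    by (intro continuous_intros)
  \<comment> \<open>An identity between functions of \<open>u\<close>; integration enters only when
    \<open>I\<close> is applied to both sides.\<close>
  have kernel: "(\<Sum>l=0..n. \<Sum>k=0..l. \<Sum>j=0..k. P_cyl B p l k j v * P_cyl B p l k j u) =
      1 / real (n + 1) * (\<Sum>\<nu>=0..n. \<Psi> \<nu> u)" for u
  proof -
    obtain u1 u2 u3 where u: "u = (u1, u2, u3)"
      by (cases u)
    define K where "K k = (\<Sum>j\<le>k. B k j (u1, u2) * B k j (x1, x2))" for k
    have K: "K k = 1 / real (n + 1) * (\<Sum>\<nu>=0..n. D_kernel \<mu> k (real \<nu> * pi / real (n + 1))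
        (?c \<nu> * u1 + ?s \<nu> * u2) (x1, x2))" if "k \<le> n" for k
      using reproducing_kernel_nodes[OF that assms(5), of "(u1, u2)" "(x1, x2)"]
      by (simp add: K_def field_simps)
    have "(\<Sum>l=0..n. \<Sum>k=0..l. \<Sum>j=0..k. P_cyl B p l k j v * P_cyl B p l k j u) =
        (\<Sum>l=0..n. \<Sum>k=0..l. K k * (poly (p (l - k)) u3 * poly (p (l - k)) x3))"
      by (simp add: P_cyl_def K_def u v sum_distrib_left sum_distrib_right atLeast0AtMost mult_ac)
    \<comment> \<open>Grouping by the disk degree k: the substitution m = l - k produces the inner
      sum of \<open>Phi_kernel\<close>.\<close>
    also have "\<dots> = (\<Sum>k=0..n. \<Sum>m=0..n - k. K k * (poly (p m) u3 * poly (p m) x3))"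
      by (rule sum_triangle_swap)
    also have "\<dots> = (\<Sum>k=0..n. K k * q k u3)"
      by (simp add: q_def sum_distrib_left)
    also have "\<dots> = (\<Sum>k=0..n. \<Sum>\<nu>=0..n. 1 / real (n + 1) *
        (D_kernel \<mu> k (real \<nu> * pi / real (n + 1)) (?c \<nu> * u1 + ?s \<nu> * u2) (x1, x2) * q k u3))"
      by (intro sum.cong refl) (simp add: K sum_distrib_left sum_distrib_right mult.assoc)
    also have "\<dots> = (\<Sum>\<nu>=0..n. 1 / real (n + 1) * \<Psi> \<nu> u)"
      by (subst sum.swap) (simp add: \<Psi>_def \<Phi>_def Phi_kernel_def q_def u v sum_distrib_left)
    finally show ?thesis
      by (simp only: sum_distrib_left)
  qed
  have "partial_sum \<mu> L W B p n f v =
      (\<Sum>l=0..n. \<Sum>k=0..l. \<Sum>j=0..k. a_const \<mu> * (P_cyl B p l k j v * I (P_cyl B p l k j)))"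
    by (simp add: partial_sum_def fourier_coeff_def I_def mult_ac)
  also have "\<dots> = a_const \<mu> * (\<Sum>l=0..n. \<Sum>k=0..l. \<Sum>j=0..k. I (\<lambda>u. P_cyl B p l k j v * P_cyl B p l k j u))"
    by (simp only: sum_distrib_left I_scale)
  also have "(\<Sum>l=0..n. \<Sum>k=0..l. \<Sum>j=0..k. I (\<lambda>u. P_cyl B p l k j v * P_cyl B p l k j u)) =
      (\<Sum>l=0..n. \<Sum>k=0..l. I (\<lambda>u. \<Sum>j=0..k. P_cyl B p l k j v * P_cyl B p l k j u))"
    by (intro sum.cong refl I_sum[symmetric]) (auto intro!: continuous_intros cont_P)
  also have "\<dots> = (\<Sum>l=0..n. I (\<lambda>u. \<Sum>k=0..l. \<Sum>j=0..k. P_cyl B p l k j v * P_cyl B p l k j u))"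
    by (intro sum.cong refl I_sum[symmetric]) (auto intro!: continuous_intros cont_P)
  also have "\<dots> = I (\<lambda>u. \<Sum>l=0..n. \<Sum>k=0..l. \<Sum>j=0..k. P_cyl B p l k j v * P_cyl B p l k j u)"
    by (intro I_sum[symmetric]) (auto intro!: continuous_intros cont_P)
  also have "\<dots> = 1 / real (n + 1) * (\<Sum>\<nu>=0..n. I (\<Psi> \<nu>))"
    unfolding kernel I_scale by (subst I_sum) (simp_all add: cont_\<Psi>)
  also have "a_const \<mu> * \<dots> = 1 / real (n + 1) * (\<Sum>\<nu>=0..n. a_const \<mu> * I (\<Psi> \<nu>))"
    by (simp only: sum_distrib_left mult.left_commute)
  also have "(\<Sum>\<nu>=0..n. a_const \<mu> * I (\<Psi> \<nu>)) =
      (\<Sum>\<nu>=0..n. let \<xi> = real \<nu> * pi / real (n + 1) in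
         a_const \<mu> *
         (LINT t:{-1..1}|lebesgue. LINT w:{0..L}|lebesgue.
            radon \<mu> \<xi> (\<lambda>(x, y). f (x, y, w)) t * Phi_kernel \<mu> p n \<xi> w t v * W w))"
  proof (rule sum.cong[OF refl])
    fix \<nu>
    have "I (\<Psi> \<nu>) = (LINT t:{-1..1}|lebesgue. LINT w:{0..L}|lebesgue.
        radon \<mu> (real \<nu> * pi / real (n + 1)) (\<lambda>(x, y). f (x, y, w)) t * \<Phi> \<nu> w t * W w)"
      unfolding I_def \<Psi>_def
      by (rule cylinder_radon[OF refl refl]) (rule int[OF cont_\<Psi>[unfolded \<Psi>_def[abs_def]]])
    then show "a_const \<mu> * I (\<Psi> \<nu>) = (let \<xi> = real \<nu> * pi / real (n + 1) in
         a_const \<mu> *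
         (LINT t:{-1..1}|lebesgue. LINT w:{0..L}|lebesgue.
            radon \<mu> \<xi> (\<lambda>(x, y). f (x, y, w)) t * Phi_kernel \<mu> p n \<xi> w t v * W w))"
      by (simp only: Let_def \<Phi>_def)
  qed
  finally show ?thesis .
qed

end
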